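(* Let $x_0$ be a regular point of $\mathfrak S_\star$, with associated unit vector $\vec e_{x_0}$. Given any $\theta>0$ there exists a radius $R_{\rm cone}(\theta,x_0)>0$ such that $$\mathfrak S_\star\cap \mathbb D^2(x_0,r)\subset \mathcal C_{\rm one}(x_0,\vec e_{x_0},\theta)\quad\text{for any }0<r\le R_{\rm cone}(\theta,x_0).$$
   Context: Let $k\ge 1$ and let $V:\mathbb R^k\to\mathbb R$ be smooth with $\inf V=0$ and satisfying: (1) $\Sigma:=\{y\in\mathbb R^k: V(y)=0\}=\{\sigma_1,\dots,\sigma_q\}$ is finite with $q\ge2$; (2) the Hessian $\nabla^2V(\sigma_i)$ is positive definite for every $i$; (3) there are constants $\alpha_\infty>0$, $R_\infty>0$ such that $y\cdot\nabla V(y)\ge\alpha_\infty|y|^2$ if $|y|>R_\infty$, and $V(y)\to+\infty$ as $|y|\to+\infty$. For $\varepsilon>0$, $e_\varepsilon(u)=\varepsilon\frac{|\nabla u|^2}{2}+\frac1\varepsilon V(u)$. $\mathbb D^2(x,r)$ is the open disc of center $x$ and radius $r$ in $\mathbb R^2$. Let $\Omega\subset\mathbb R^2$ be a smooth bounded domain, $M_0>0$, $(\varepsilon_n)\subset(0,1]$ a decreasing sequence tending to $0$, and $u_{\varepsilon_n}:\Omega\to\mathbb R^k$ smooth solutions of $-\Delta u_{\varepsilon_n}=-\varepsilon_n^{-2}\nabla V(u_{\varepsilon_n})$ in $\Omega$ with $\int_\Omega e_{\varepsilon_n}(u_{\varepsilon_n})\,dx\le M_0$, such that the measures $e_{\varepsilon_n}(u_{\varepsilon_n})\,dx$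 converge in the sense of measures on $\Omega$ (against continuous functions with compact support in $\Omega$) to a measure $\nu_\star$. There is a constant $\eta_0>0$ depending only on $V$ with the clearing-out property: if $\mathbb D^2(x,r)\subset\Omega$ and $\nu_\star(\overline{\mathbb D^2(x,r)})<\eta_0 r$, then $\nu_\star(\overline{\mathbb D^2(x,r/2)})=0$. Fix such an $\eta_0$ and define $\theta_\star(x)=\liminf_{r\to0}\frac{\nu_\star(\overline{\mathbb D^2(x,r)})}{r}$ for $x\in\Omega$ and $\mathfrak S_\star=\{x\in\Omega:\theta_\star(x)\ge\eta_0\}$. For $x_0\in\mathbb R^2$, a unit vector $\vec e$ with orthogonal unit vector $\vec e^\perp$, and $\theta>0$, set $\mathcal C_{\rm one}(x_0,\vec e,\theta)=\{y\in\mathbb R^2: |\vec e^\perp\cdot(y-x_0)|\le\theta|\vec e\cdot(y-x_0)|\}$. A point $x_0\in\mathcal S$ is a regular point of a set $\mathcal S\subset \mathbb R^2$ if there is a unit vector $\vec e_{x_0}$ such that for every $\theta>0$, $\lim_{r\to0}\frac1r\mathcal H^1\big(\mathcal S\cap(\mathbb D^2(x_0,r)\setminus\mathcal C_{\rm one}(x_0,\vec e_{x_0},\theta))\big)=0$, where $\mathcal H^1$ is one-dimensional Hausdorff measure. *)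

theory Defs
  imports "HOL-Analysis.Analysis"
begin

section \<open>Differential calculus\<close>

(* Intended for open S: the derivatives are unrestricted Frechet derivatives at the points of S. *)
primrec Ck_on :: "nat \<Rightarrow> ('a::euclidean_space \<Rightarrow> 'b::real_normed_vector) \<Rightarrow> 'a set \<Rightarrow> bool" where
  "Ck_on 0 f S \<longleftrightarrow> continuous_on S f"
| "Ck_on (Suc n) f S \<longleftrightarrow>
     (\<forall>x\<in>S. f differentiable (at x)) \<and>
     (\<forall>v. Ck_on n (\<lambda>x. frechet_derivative f (at x) v) S)"

definition smooth_on :: "('a::euclidean_space \<Rightarrow> 'b::real_normed_vector) \<Rightarrow> 'a set \<Rightarrow> bool" where
  "smooth_on f S \<longleftrightarrow> (\<forall>n. Ck_on n f S)"

definition grad :: "('a::euclidean_space \<Rightarrow> real) \<Rightarrow> 'a \<Rightarrow> 'a" where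
  "grad f x = (\<Sum>i\<in>Basis. frechet_derivative f (at x) i *\<^sub>R i)"

definition second_deriv ::
  "('a::euclidean_space \<Rightarrow> 'b::real_normed_vector) \<Rightarrow> 'a \<Rightarrow> 'a \<Rightarrow> 'a \<Rightarrow> 'b" where
  "second_deriv f x v w = frechet_derivative (\<lambda>y. frechet_derivative f (at y) v) (at x) w"

definition hessian_pos_def :: "('a::euclidean_space \<Rightarrow> real) \<Rightarrow> 'a \<Rightarrow> bool" where
  "hessian_pos_def f x \<longleftrightarrow> (\<forall>v. v \<noteq> 0 \<longrightarrow> second_deriv f x v v > 0)"

definition laplacian :: "('a::euclidean_space \<Rightarrow> 'b::real_normed_vector) \<Rightarrow> 'a \<Rightarrow> 'b" where
  "laplacian u x = (\<Sum>i\<in>Basis. second_deriv u x i i)"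

definition grad_norm_sq :: "('a::euclidean_space \<Rightarrow> 'b::real_normed_vector) \<Rightarrow> 'a \<Rightarrow> real" where
  "grad_norm_sq u x = (\<Sum>i\<in>Basis. (norm (frechet_derivative u (at x) i))\<^sup>2)"

section \<open>Potentials, domains, and the energy\<close>

definition admissible_potential :: "('a::euclidean_space \<Rightarrow> real) \<Rightarrow> bool" where
  "admissible_potential V \<longleftrightarrow>
     smooth_on V UNIV \<and>
     bdd_below (range V) \<and> (INF y. V y) = 0 \<and>
     finite {y. V y = 0} \<and> card {y. V y = 0} \<ge> 2 \<and>
     (\<forall>y. V y = 0 \<longrightarrow> hessian_pos_def V y) \<and>
     (\<exists>\<alpha>>0. \<exists>R>0. \<forall>y. norm y > R \<longrightarrow> y \<bullet> grad V y \<ge> \<alpha> * (norm y)\<^sup>2) \<and>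
     filterlim V at_top at_infinity"

definition perp :: "real^2 \<Rightarrow> real^2" where
  "perp e = vector [- (e$2), e$1]"

(* The boundary is locally a smooth graph in rotated coordinates, with the domain on one side. *)
definition smooth_bounded_domain :: "(real^2) set \<Rightarrow> bool" where
  "smooth_bounded_domain \<Omega> \<longleftrightarrow>
     open \<Omega> \<and> connected \<Omega> \<and> \<Omega> \<noteq> {} \<and> bounded \<Omega> \<and>
     (\<forall>p\<in>frontier \<Omega>. \<exists>r>0. \<exists>e. \<exists>\<gamma>::real \<Rightarrow> real.
        norm e = 1 \<and> smooth_on \<gamma> UNIV \<and>
        \<Omega> \<inter> ball p r = {x \<in> ball p r. \<gamma> (e \<bullet> x) < perp e \<bullet> x})"

definition energy_density ::
  "('b::euclidean_space \<Rightarrow> real) \<Rightarrow> real \<Rightarrow> (real^2 \<Rightarrow> 'b) \<Rightarrow> real^2 \<Rightarrow> real" where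
  "energy_density V \<epsilon> u x = \<epsilon> * (grad_norm_sq u x / 2) + (1 / \<epsilon>) * V (u x)"

(* A locally finite Borel measure whose underlying space is the set itself. *)
definition radon_measure_on :: "'a::euclidean_space set \<Rightarrow> 'a measure \<Rightarrow> bool" where
  "radon_measure_on \<Omega> \<nu> \<longleftrightarrow>
     sets \<nu> = sets (restrict_space borel \<Omega>) \<and>
     (\<forall>K. compact K \<and> K \<subseteq> \<Omega> \<longrightarrow> emeasure \<nu> K < \<infinity>)"

(* Convergence of the measures f n dx on the set to the given measure, tested against
   continuous functions with compact support in the set. *)
definition densities_converge_on ::
  "'a::euclidean_space set \<Rightarrow> (nat \<Rightarrow> 'a \<Rightarrow> real) \<Rightarrow> 'a measure \<Rightarrow> bool" where
  "densities_converge_on \<Omega> f \<nu> \<longleftrightarrow>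
     (\<forall>\<phi>::'a \<Rightarrow> real.
        continuous_on UNIV \<phi> \<and> compact (closure {x. \<phi> x \<noteq> 0}) \<and> closure {x. \<phi> x \<noteq> 0} \<subseteq> \<Omega> \<longrightarrow>
        (\<lambda>n. set_lebesgue_integral lborel \<Omega> (\<lambda>x. \<phi> x * f n x))
          \<longlonglongrightarrow> integral\<^sup>L \<nu> \<phi>)"

definition limit_setting ::
  "('b::euclidean_space \<Rightarrow> real) \<Rightarrow> (real^2) set \<Rightarrow> real \<Rightarrow> (nat \<Rightarrow> real) \<Rightarrow>
   (nat \<Rightarrow> real^2 \<Rightarrow> 'b) \<Rightarrow> (real^2) measure \<Rightarrow> bool" where
  "limit_setting V \<Omega> M\<^sub>0 \<epsilon> u \<nu> \<longleftrightarrow>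
     smooth_bounded_domain \<Omega> \<and> M\<^sub>0 > 0 \<and>
     (\<forall>n. 0 < \<epsilon> n \<and> \<epsilon> n \<le> 1) \<and> decseq \<epsilon> \<and> \<epsilon> \<longlonglongrightarrow> 0 \<and>
     (\<forall>n. smooth_on (u n) \<Omega>) \<and>
     (\<forall>n. \<forall>x\<in>\<Omega>. - laplacian (u n) x = - ((1 / (\<epsilon> n)\<^sup>2) *\<^sub>R grad V (u n x))) \<and>
     (\<forall>n. (\<integral>\<^sup>+x\<in>\<Omega>. ennreal (energy_density V (\<epsilon> n) (u n) x) \<partial>lborel) \<le> ennreal M\<^sub>0) \<and>
     radon_measure_on \<Omega> \<nu> \<and>
     densities_converge_on \<Omega> (\<lambda>n. energy_density V (\<epsilon> n) (u n)) \<nu>"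

section \<open>Clearing-out and the concentration set\<close>

(* The constant depends only on V, so the property is required for every admissible choice of
   the remaining data.  Closed discs are intersected with the domain because the measure lives
   there, and the closure of an open disc inside the domain may touch the boundary. *)
definition clearing_out_constant :: "('b::euclidean_space \<Rightarrow> real) \<Rightarrow> real \<Rightarrow> bool" where
  "clearing_out_constant V \<eta>\<^sub>0 \<longleftrightarrow>
     \<eta>\<^sub>0 > 0 \<and>
     (\<forall>\<Omega> M\<^sub>0 \<epsilon> u \<nu>. limit_setting V \<Omega> M\<^sub>0 \<epsilon> u \<nu> \<longrightarrow>
        (\<forall>x r. r > 0 \<and> ball x r \<subseteq> \<Omega> \<and> emeasure \<nu> (cball x r \<inter> \<Omega>) < ennreal (\<eta>\<^sub>0 * r) \<longrightarrow>
           emeasure \<nu> (cball x (r / 2) \<inter> \<Omega>) = 0))"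

definition lower_density :: "(real^2) set \<Rightarrow> (real^2) measure \<Rightarrow> real^2 \<Rightarrow> ennreal" where
  "lower_density \<Omega> \<nu> x =
     Liminf (at_right 0) (\<lambda>r. emeasure \<nu> (cball x r \<inter> \<Omega>) / ennreal r)"

definition concentration_set ::
  "(real^2) set \<Rightarrow> (real^2) measure \<Rightarrow> real \<Rightarrow> (real^2) set" where
  "concentration_set \<Omega> \<nu> \<eta>\<^sub>0 = {x \<in> \<Omega>. lower_density \<Omega> \<nu> x \<ge> ennreal \<eta>\<^sub>0}"

section \<open>One-dimensional Hausdorff measure and regular points\<close>

(* Boundedness is required because the library's diameter of an unbounded set is unspecified. *)
definition hausdorff1_pre :: "real \<Rightarrow> 'a::metric_space set \<Rightarrow> ennreal" where
  "hausdorff1_pre \<delta> A =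
     (INF C \<in> {C :: nat \<Rightarrow> 'a set. A \<subseteq> (\<Union>i. C i) \<and> (\<forall>i. bounded (C i) \<and> diameter (C i) \<le> \<delta>)}.
        \<Sum>i. ennreal (diameter (C i)))"

definition hausdorff1 :: "'a::metric_space set \<Rightarrow> ennreal" where
  "hausdorff1 A = (SUP \<delta> \<in> {0<..}. hausdorff1_pre \<delta> A)"

definition cone_one :: "real^2 \<Rightarrow> real^2 \<Rightarrow> real \<Rightarrow> (real^2) set" where
  "cone_one x\<^sub>0 e \<theta> = {y. \<bar>perp e \<bullet> (y - x\<^sub>0)\<bar> \<le> \<theta> * \<bar>e \<bullet> (y - x\<^sub>0)\<bar>}"

definition regular_point_with :: "(real^2) set \<Rightarrow> real^2 \<Rightarrow> real^2 \<Rightarrow> bool" where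
  "regular_point_with S x\<^sub>0 e \<longleftrightarrow>
     x\<^sub>0 \<in> S \<and> norm e = 1 \<and>
     (\<forall>\<theta>>0. ((\<lambda>r. hausdorff1 (S \<inter> (ball x\<^sub>0 r - cone_one x\<^sub>0 e \<theta>)) / ennreal r)
                \<longlongrightarrow> 0) (at_right 0))"

end

theory Submission
  imports Defs
begin

text \<open>
  If a point \<open>x\<close> of the concentration set lay outside the cone at distance \<open>\<rho>\<close> from \<open>x\<^sub>0\<close>, then a disc about
  \<open>x\<close> of radius \<open>c * \<rho>\<close> would lie outside the cone of half the slope, where the concentration set has
  one-dimensional measure \<open>o(\<rho>)\<close>.  The distance to \<open>x\<close> is 1-Lipschitz, so some circle about \<open>x\<close> misses the
  concentration set, and by clearing-out a whole annulus is \<open>\<nu>\<close>-null.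

  A null annulus forces the enclosed disc to be null.  Pohozaev's identity with a radial cutoff
  bounds the potential energy inside by the energy in the annulus, so it tends to zero.  It
  dominates the gradient energy up to \<open>O(sqrt \<epsilon>)\<close>: where \<open>u\<close> is near a well \<open>s\<close>, test the equation with a
  truncation of \<open>u - s\<close>, using that \<open>grad V y \<bullet> (y - s) \<ge> 0\<close> there; where \<open>u\<close> is away from all wells,
  combine \<open>V \<ge> c\<close> with the interior estimate \<open>\<epsilon> * norm (D u) \<le> C\<close>.
\<close>

section \<open>Second derivatives and the divergence theorem\<close>

text \<open>Clearing-out alone cannot finish the argument: it needs \<open>\<nu>\<close> to be small
  relative to the radius, and a heavy disc surrounded by a null annulus does not contradict it. The
  equation has to exclude that configuration, and the only link between \<open>\<nu>\<close> and the
  solutions is the convergence of energy densities tested against continuous functions with compact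
  support in \<open>\<Omega>\<close>. Hence the estimates compare energies weighted by a cutoff with
  energies weighted by its slope, on one disc, with constants fixed before \<open>\<epsilon>\<close>
  and the solution; in this form they pass to the limit. The slope lives on the annulus, which is
  why its weighted energy tends to zero.

  The interior estimate on the derivative starts from the energy bound and the radial growth of the
  potential. The mean value inequality at scale \<open>\<epsilon>\<close> bounds the squared norm of
  the solution by a multiple of \<open>1 / \<epsilon>\<close>; a barrier on a fixed scale improves
  this to a constant; the half-ball gradient estimate at scale \<open>\<epsilon>\<close> then gives
  the order \<open>1 / \<epsilon>\<close>.\<close>

lemma local_max_second_derivative_nonpos:
  fixes h h' :: "real \<Rightarrow> real"
  assumes "d > 0"
    and max: "\<And>t. \<bar>t\<bar> < d \<Longrightarrow> h t \<le> h 0"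
    and h: "\<And>t. \<bar>t\<bar> < d \<Longrightarrow> (h has_real_derivative h' t) (at t)"
    and h': "(h' has_real_derivative c) (at 0)"
  shows "c \<le> 0"
proof (rule ccontr)
  assume "\<not> c \<le> 0"
  then have "c > 0" by simp
  have "h' 0 = 0"
    using DERIV_local_max[OF h[of 0] \<open>d > 0\<close>] max \<open>d > 0\<close> by auto
  \<comment> \<open>A positive \<open>c\<close> makes \<open>h'\<close> positive just to the right
    of its zero at 0, so \<open>h\<close> would rise above its maximum.\<close>
  obtain e where e: "e > 0" "\<And>t. 0 < t \<Longrightarrow> t < e \<Longrightarrow> h' 0 < h' (0 + t)"
    using DERIV_pos_inc_right[OF h' \<open>c > 0\<close>] by auto
  define t where "t = min d e / 2"
  have t: "0 < t" "t < d" "t < e"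
    using \<open>d > 0\<close> e(1) by (auto simp: t_def min_def)
  obtain z where z: "0 < z" "z < t" "h t - h 0 = (t - 0) * h' z"
    using MVT2[of 0 t h h'] h t by auto
  have "h' z > 0" using e(2)[of z] z t \<open>h' 0 = 0\<close> by auto
  then show False using max[of t] t z by (smt (verit) mult_pos_pos)
qed

lemma has_derivative_line:
  assumes "(g has_derivative G) (at (x + t *\<^sub>R v))"
  shows "((\<lambda>t. g (x + t *\<^sub>R v)) has_vector_derivative G v) (at t)"
proof -
  have "((\<lambda>t. x + t *\<^sub>R v) has_derivative (\<lambda>t. t *\<^sub>R v)) (at t)"
    by (auto intro!: derivative_eq_intros)
  from diff_chain_at[OF this assms] have "((\<lambda>t. g (x + t *\<^sub>R v)) has_derivative (\<lambda>t. G (t *\<^sub>R v))) (at t)"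
    by (simp add: o_def)
  then show ?thesis
    using has_derivative_linear[OF assms] by (simp add: has_vector_derivative_def linear_cmul)
qed

lemma has_real_derivative_line:
  assumes "(g has_derivative G) (at (x + t *\<^sub>R v))"
  shows "((\<lambda>t. g (x + t *\<^sub>R v)) has_real_derivative G v) (at t)"
  using has_derivative_line[OF assms] by (simp add: has_real_derivative_iff_has_vector_derivative)

text \<open>A maximum principle: a positive maximum must lie in \<open>U\<close>, where all pure
  second derivatives are then nonpositive and the Laplacian cannot be positive. Positivity of the
  Laplacian is demanded only where \<open>g > 0\<close>, so a barrier has to work only above the
  level it is compared with.\<close>

lemma strict_subsolution_nonpos:
  fixes g :: "'a::euclidean_space \<Rightarrow> real"
  assumes "compact K" "open U" "U \<subseteq> K" and cont: "continuous_on K g"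
    and bdry: "\<And>x. x \<in> K - U \<Longrightarrow> g x \<le> 0"
    and G: "\<And>x. x \<in> U \<Longrightarrow> (g has_derivative G x) (at x)"
    and H: "\<And>x i. x \<in> U \<Longrightarrow> i \<in> Basis \<Longrightarrow> ((\<lambda>y. G y i) has_derivative H i x) (at x)"
    and pos: "\<And>x. x \<in> U \<Longrightarrow> g x > 0 \<Longrightarrow> (\<Sum>i\<in>Basis. H i x i) > 0"
    and "x \<in> K"
  shows "g x \<le> 0"
proof (rule ccontr)
  assume "\<not> g x \<le> 0"
  obtain z where z: "z \<in> K" "\<And>y. y \<in> K \<Longrightarrow> g y \<le> g z"
    using continuous_attains_sup[OF \<open>compact K\<close> _ cont] \<open>x \<in> K\<close> by blast
  have "g z > 0" using z(2)[OF \<open>x \<in> K\<close>] \<open>\<not> g x \<le> 0\<close> by simp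
  then have "z \<in> U" using bdry z(1) by fastforce
  obtain d where d: "d > 0" "ball z d \<subseteq> U"
    using \<open>open U\<close> \<open>z \<in> U\<close> open_contains_ball by blast
  have "H i z i \<le> 0" if i: "i \<in> Basis" for i
  proof (rule local_max_second_derivative_nonpos[of d "\<lambda>t. g (z + t *\<^sub>R i)" "\<lambda>t. G (z + t *\<^sub>R i) i"])
    have inU: "z + t *\<^sub>R i \<in> U" if "\<bar>t\<bar> < d" for t
      using d(2) that i by (auto simp: dist_norm subset_iff)
    show "g (z + t *\<^sub>R i) \<le> g (z + 0 *\<^sub>R i)" if "\<bar>t\<bar> < d" for t
      using z(2) inU[OF that] \<open>U \<subseteq> K\<close> by auto
    show "((\<lambda>t. g (z + t *\<^sub>R i)) has_real_derivative G (z + t *\<^sub>R i) i) (at t)"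
      if "\<bar>t\<bar> < d" for t
      using G[OF inU[OF that]] by (rule has_real_derivative_line)
    show "((\<lambda>t. G (z + t *\<^sub>R i) i) has_real_derivative H i z i) (at 0)"
      by (rule has_real_derivative_line) (use H[OF \<open>z \<in> U\<close> i] in simp)
  qed (fact d)
  then have "(\<Sum>i\<in>Basis. H i z i) \<le> 0" by (simp add: sum_nonpos)
  then show False using pos[OF \<open>z \<in> U\<close> \<open>g z > 0\<close>] by simp
qed

text \<open>The second difference \<open>Q h\<close> over the parallelogram spanned by
  \<open>h *\<^sub>R v\<close> and \<open>h *\<^sub>R w\<close> is symmetric in \<open>v\<close> and
  \<open>w\<close>. Two mean value steps, taken in either order, turn it into \<open>h * h\<close>
  times a mixed derivative near \<open>x\<close>; dividing and letting \<open>h\<close> tend to 0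
  identifies the two mixed derivatives at \<open>x\<close>.\<close>

lemma second_directional_derivatives_commute_real:
  fixes f :: "'a::euclidean_space \<Rightarrow> real"
  assumes "open U" "x \<in> U"
    and f: "\<And>y. y \<in> U \<Longrightarrow> (f has_derivative F y) (at y)"
    and v: "\<And>y. y \<in> U \<Longrightarrow> ((\<lambda>z. F z v) has_derivative Fv y) (at y)"
    and w: "\<And>y. y \<in> U \<Longrightarrow> ((\<lambda>z. F z w) has_derivative Fw y) (at y)"
    and cv: "continuous_on U (\<lambda>y. Fv y w)" and cw: "continuous_on U (\<lambda>y. Fw y v)"
  shows "Fv x w = Fw x v"
proof -
  obtain d where d: "d > 0" "ball x d \<subseteq> U"
    using \<open>open U\<close> \<open>x \<in> U\<close> open_contains_ball by blast
  define m where "m = norm v + norm w + 1"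
  have m: "m > 0" by (simp add: m_def add_nonneg_pos)
  have inU: "x + s *\<^sub>R v + t *\<^sub>R w \<in> U" if "\<bar>s\<bar> \<le> h" "\<bar>t\<bar> \<le> h" "h < d / m" for s t h
  proof -
    have "norm (s *\<^sub>R v + t *\<^sub>R w) \<le> \<bar>s\<bar> * norm v + \<bar>t\<bar> * norm w"
      by (metis norm_scaleR norm_triangle_ineq)
    also have "\<dots> \<le> h * norm v + h * norm w"
      using that by (intro add_mono mult_right_mono) auto
    also have "\<dots> \<le> h * m" using that by (simp add: m_def algebra_simps)
    also have "\<dots> < d" using that m by (simp add: field_simps)
    finally have "x + (s *\<^sub>R v + t *\<^sub>R w) \<in> ball x d" by (metis add.commute add_diff_cancel_right' dist_commute dist_norm mem_ball)
    then show ?thesis using d(2) by (auto simp: add.assoc)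
  qed
  define Q where "Q h = f (x + h *\<^sub>R v + h *\<^sub>R w) - f (x + h *\<^sub>R v) - f (x + h *\<^sub>R w) + f x" for h
  \<comment> \<open>\<open>a\<close> and \<open>b\<close> stand for \<open>v\<close> and
    \<open>w\<close> in either order, so one computation serves both mixed derivatives.\<close>
  have *: "\<exists>s t. 0 < s \<and> s < h \<and> 0 < t \<and> t < h \<and> Q h = h * h * Gv (x + s *\<^sub>R a + t *\<^sub>R b) b"
    if h: "0 < h" "h < d / m" and ab: "a = v \<and> b = w \<or> a = w \<and> b = v"
      and Gv: "\<And>y. y \<in> U \<Longrightarrow> ((\<lambda>z. F z a) has_derivative Gv y) (at y)" for h a b Gv
  proof -
    have inU': "x + s *\<^sub>R a + t *\<^sub>R b \<in> U" if "\<bar>s\<bar> \<le> h" "\<bar>t\<bar> \<le> h" for s t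
      using inU[of s h t] inU[of t h s] that h ab by (auto simp: algebra_simps)
    define q where "q s = f (x + h *\<^sub>R b + s *\<^sub>R a) - f (x + s *\<^sub>R a)" for s
    have "(q has_real_derivative F (x + h *\<^sub>R b + s *\<^sub>R a) a - F (x + s *\<^sub>R a) a) (at s)"
      if "0 \<le> s" "s \<le> h" for s
      unfolding q_def
      by (intro DERIV_diff has_real_derivative_line f)
        (use inU'[of s h] inU'[of s 0] that h in \<open>auto simp: algebra_simps\<close>)
    then obtain s where s: "0 < s" "s < h"
      "q h - q 0 = (h - 0) * (F (x + h *\<^sub>R b + s *\<^sub>R a) a - F (x + s *\<^sub>R a) a)"
      using MVT2[of 0 h q "\<lambda>s. F (x + h *\<^sub>R b + s *\<^sub>R a) a - F (x + s *\<^sub>R a) a"] h by auto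
    have "((\<lambda>t. F (x + s *\<^sub>R a + t *\<^sub>R b) a) has_real_derivative Gv (x + s *\<^sub>R a + t *\<^sub>R b) b) (at t)"
      if "0 \<le> t" "t \<le> h" for t
      by (rule has_real_derivative_line[where g = "\<lambda>z. F z a"])
        (use inU'[of s t] that h s in \<open>auto intro!: Gv\<close>)
    then obtain t where t: "0 < t" "t < h"
      "F (x + s *\<^sub>R a + h *\<^sub>R b) a - F (x + s *\<^sub>R a + 0 *\<^sub>R b) a = (h - 0) * Gv (x + s *\<^sub>R a + t *\<^sub>R b) b"
      using MVT2[of 0 h "\<lambda>t. F (x + s *\<^sub>R a + t *\<^sub>R b) a" "\<lambda>t. Gv (x + s *\<^sub>R a + t *\<^sub>R b) b"] h by auto
    have "Q h = q h - q 0" using ab by (auto simp: Q_def q_def algebra_simps)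
    also have "\<dots> = h * (F (x + s *\<^sub>R a + h *\<^sub>R b) a - F (x + s *\<^sub>R a + 0 *\<^sub>R b) a)"
      using s by (simp add: algebra_simps)
    also have "\<dots> = h * h * Gv (x + s *\<^sub>R a + t *\<^sub>R b) b" unfolding t(3) by simp
    finally show ?thesis using s t by blast
  qed
  have lim: "(\<lambda>n. Gv (x + s n *\<^sub>R a + t n *\<^sub>R b) b) \<longlonglongrightarrow> Gv x b"
    if "\<And>n. 0 < s n \<and> s n < h n" "\<And>n. 0 < t n \<and> t n < h n" "h \<longlonglongrightarrow> 0"
      "continuous_on U (\<lambda>y. Gv y b)" for s t h :: "nat \<Rightarrow> real" and a b and Gv :: "'a \<Rightarrow> 'a \<Rightarrow> real"
  proof -
    have "s \<longlonglongrightarrow> 0" "t \<longlonglongrightarrow> 0"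
      by (rule tendsto_sandwich[OF _ _ tendsto_const that(3)];
          use that(1,2) in \<open>auto intro!: always_eventually less_imp_le\<close>)+
    then have "(\<lambda>n. x + s n *\<^sub>R a + t n *\<^sub>R b) \<longlonglongrightarrow> x + 0 *\<^sub>R a + 0 *\<^sub>R b"
      by (intro tendsto_intros)
    moreover have "isCont (\<lambda>y. Gv y b) x"
      using that(4) \<open>open U\<close> \<open>x \<in> U\<close> by (simp add: continuous_on_eq_continuous_at)
    ultimately show ?thesis by (auto intro: isCont_tendsto_compose[where g = "\<lambda>y. Gv y b"])
  qed
  \<comment> \<open>The shift by 2 makes the divisor exceed 1 already at \<open>n = 0\<close>, so
    every \<open>h n\<close> is strictly below \<open>d / m\<close>.\<close>
  define h where "h n = d / m / real (n + 2)" for n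
  have h: "0 < h n" "h n < d / m" for n
  proof -
    have "d / m / real (n + 2) < d / m / 1"
      using d m by (intro divide_strict_left_mono) auto
    then show "0 < h n" "h n < d / m" using d m by (auto simp: h_def)
  qed
  have "h \<longlonglongrightarrow> 0"
    unfolding h_def using LIMSEQ_ignore_initial_segment[OF lim_const_over_n, of "d / m" 2] by simp
  have "\<forall>n. \<exists>s t. 0 < s \<and> s < h n \<and> 0 < t \<and> t < h n \<and> Q (h n) = h n * h n * Fv (x + s *\<^sub>R v + t *\<^sub>R w) w"
    using *[OF h _ v] by blast
  then obtain s t where st: "\<And>n. 0 < s n \<and> s n < h n" "\<And>n. 0 < t n \<and> t n < h n"
    "\<And>n. Q (h n) = h n * h n * Fv (x + s n *\<^sub>R v + t n *\<^sub>R w) w" by metis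
  have "\<forall>n. \<exists>s t. 0 < s \<and> s < h n \<and> 0 < t \<and> t < h n \<and> Q (h n) = h n * h n * Fw (x + s *\<^sub>R w + t *\<^sub>R v) v"
    using *[OF h _ w] by blast
  then obtain s' t' where st': "\<And>n. 0 < s' n \<and> s' n < h n" "\<And>n. 0 < t' n \<and> t' n < h n"
    "\<And>n. Q (h n) = h n * h n * Fw (x + s' n *\<^sub>R w + t' n *\<^sub>R v) v" by metis
  have "Fv (x + s n *\<^sub>R v + t n *\<^sub>R w) w = Fw (x + s' n *\<^sub>R w + t' n *\<^sub>R v) v" for n
    using st(3)[of n] st'(3)[of n] h[of n] by auto
  moreover have "(\<lambda>n. Fv (x + s n *\<^sub>R v + t n *\<^sub>R w) w) \<longlonglongrightarrow> Fv x w"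
    by (rule lim[where Gv = Fv, OF st(1,2) \<open>h \<longlonglongrightarrow> 0\<close> cv])
  moreover have "(\<lambda>n. Fw (x + s' n *\<^sub>R w + t' n *\<^sub>R v) v) \<longlonglongrightarrow> Fw x v"
    by (rule lim[where Gv = Fw, OF st'(1,2) \<open>h \<longlonglongrightarrow> 0\<close> cw])
  ultimately show ?thesis using LIMSEQ_unique by simp
qed

lemma second_directional_derivatives_commute:
  fixes f :: "'a::euclidean_space \<Rightarrow> 'b::euclidean_space"
  assumes "open U" "x \<in> U"
    and f: "\<And>y. y \<in> U \<Longrightarrow> (f has_derivative F y) (at y)"
    and v: "\<And>y. y \<in> U \<Longrightarrow> ((\<lambda>z. F z v) has_derivative Fv y) (at y)"
    and w: "\<And>y. y \<in> U \<Longrightarrow> ((\<lambda>z. F z w) has_derivative Fw y) (at y)"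
    and cv: "continuous_on U (\<lambda>y. Fv y w)" and cw: "continuous_on U (\<lambda>y. Fw y v)"
  shows "Fv x w = Fw x v"
proof (rule euclidean_eqI)
  fix b :: 'b assume "b \<in> Basis"
  show "Fv x w \<bullet> b = Fw x v \<bullet> b"
    by (rule second_directional_derivatives_commute_real[of U x "\<lambda>y. f y \<bullet> b" "\<lambda>y h. F y h \<bullet> b"
          v "\<lambda>y h. Fv y h \<bullet> b" w "\<lambda>y h. Fw y h \<bullet> b"])
      (auto intro!: assms has_derivative_inner_left continuous_intros)
qed

text \<open>Difference quotients have integral zero because Lebesgue measure is translation
  invariant, so the divergence theorem below needs no iterated integration.\<close>

lemma integral_directional_derivative_zero:
  fixes F F' :: "'a::euclidean_space \<Rightarrow> real"
  assumes "compact S" and F0: "\<And>x. x \<notin> S \<Longrightarrow> F x = 0"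
    and contF: "continuous_on UNIV F" and contF': "continuous_on UNIV F'"
    and F': "\<And>x. ((\<lambda>t. F (x + t *\<^sub>R v)) has_real_derivative F' x) (at 0)"
  shows "integral\<^sup>L lborel F' = 0"
proof -
  have F't: "((\<lambda>t. F (x + t *\<^sub>R v)) has_real_derivative F' (x + t *\<^sub>R v)) (at t)" for x t
  proof -
    have "((\<lambda>s. F (x + t *\<^sub>R v + s *\<^sub>R v)) has_real_derivative F' (x + t *\<^sub>R v)) (at 0)"
      by (rule F')
    then have "((\<lambda>s. F (x + (s + t) *\<^sub>R v)) has_real_derivative F' (x + t *\<^sub>R v)) (at 0)"
      by (simp add: algebra_simps)
    then show ?thesis
      using DERIV_shift[of "\<lambda>t. F (x + t *\<^sub>R v)" "F' (x + t *\<^sub>R v)" 0 t] by simp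
  qed
  have F'0: "F' x = 0" if "x \<notin> S" for x
  proof -
    have "open ((\<lambda>t. x + t *\<^sub>R v) -` (- S))"
      using \<open>compact S\<close> by (intro open_vimage continuous_intros) (auto dest: compact_imp_closed)
    then have "eventually (\<lambda>t. t \<in> (\<lambda>t. x + t *\<^sub>R v) -` (- S)) (nhds 0)"
      using that by (intro eventually_nhds_in_open) auto
    then have "eventually (\<lambda>t. F (x + t *\<^sub>R v) = 0) (nhds 0)"
      by eventually_elim (auto intro: F0)
    then have "((\<lambda>t. F (x + t *\<^sub>R v)) has_real_derivative 0) (at 0)"
      using DERIV_cong_ev[of 0 0 "\<lambda>t. F (x + t *\<^sub>R v)" "\<lambda>t. 0" 0 0] by simp
    then show ?thesis using F'[of x] DERIV_unique by blast
  qed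
  obtain B where B: "\<And>x. \<bar>F' x\<bar> \<le> B" "B \<ge> 0"
  proof -
    have "bounded (F' ` S)"
      using \<open>compact S\<close> contF' by (intro compact_imp_bounded compact_continuous_image)
        (auto intro: continuous_on_subset)
    then obtain B where "B > 0" "\<forall>x\<in>S. \<bar>F' x\<bar> \<le> B"
      by (auto simp: bounded_pos)
    then show ?thesis using F'0 that[of B] by (metis abs_0 less_imp_le)
  qed
  \<comment> \<open>\<open>T\<close> is \<open>S\<close> swept backwards along \<open>v\<close> for
    times up to 1. It contains the supports of all the difference quotients used below and so
    carries the dominating function.\<close>
  define T where "T = (\<lambda>(x, t). x - t *\<^sub>R v) ` (S \<times> {0..1::real})"
  have "compact T" unfolding T_def
    using \<open>compact S\<close> by (intro compact_continuous_image compact_Times) (auto simp: case_prod_unfold intro!: continuous_intros)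
  have "S \<subseteq> T" unfolding T_def by (force intro: rev_image_eqI)
  have T: "F (x + t *\<^sub>R v) = 0" if "x \<notin> T" "0 \<le> t" "t \<le> 1" for x t
  proof (rule F0, rule notI)
    assume "x + t *\<^sub>R v \<in> S"
    then have "x \<in> T" unfolding T_def using that(2,3)
      by (intro image_eqI[of _ _ "(x + t *\<^sub>R v, t)"]) auto
    then show False using that by simp
  qed
  have intF: "integrable lborel F"
  proof -
    have "integrable lborel (\<lambda>x. indicator S x *\<^sub>R F x)"
      using \<open>compact S\<close> contF by (intro borel_integrable_compact) (auto intro: continuous_on_subset)
    moreover have "(\<lambda>x. indicator S x *\<^sub>R F x) = F" using F0 by (auto simp: indicator_def fun_eq_iff)
    ultimately show ?thesis by simp
  qed
  have transl: "integrable lborel (\<lambda>x. F (x + c))" "integral\<^sup>L lborel (\<lambda>x. F (x + c)) = integral\<^sup>L lborel F" for c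
  proof -
    have m: "F \<in> borel_measurable borel" using contF by (rule borel_measurable_continuous_onI)
    have d: "distr lborel borel ((+) c) = (lborel :: 'a measure)" by (rule lborel_distr_plus)
    have "integrable (distr lborel borel ((+) c)) F" using intF d by simp
    then have "integrable lborel (\<lambda>x. F (c + x))"
      by (subst (asm) integrable_distr_eq) (use m in auto)
    then show "integrable lborel (\<lambda>x. F (x + c))" by (simp add: add.commute)
    have "integral\<^sup>L (distr lborel borel ((+) c)) F = integral\<^sup>L lborel (\<lambda>x. F (c + x))"
      by (subst integral_distr) (use m in auto)
    then show "integral\<^sup>L lborel (\<lambda>x. F (x + c)) = integral\<^sup>L lborel F"
      using d by (simp add: add.commute)
  qed
  define h where "h n = 1 / real (Suc n)" for n
  have h: "0 < h n" "h n \<le> 1" for n by (auto simp: h_def)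
  define q where "q n x = (F (x + h n *\<^sub>R v) - F x) / h n" for n x
  have q0: "integral\<^sup>L lborel (q n) = 0" for n
    unfolding q_def using intF transl by simp
  have mq: "q n \<in> borel_measurable lborel" for n
    unfolding q_def using intF transl by (intro borel_measurable_divide borel_measurable_diff) auto
  have "(\<lambda>n. integral\<^sup>L lborel (q n)) \<longlonglongrightarrow> integral\<^sup>L lborel F'"
  proof (rule integral_dominated_convergence[where w = "\<lambda>x. indicator T x *\<^sub>R B"])
    show "F' \<in> borel_measurable lborel" using contF' by (simp add: borel_measurable_continuous_onI)
    show "q n \<in> borel_measurable lborel" for n by (rule mq)
    show "integrable lborel (\<lambda>x. indicator T x *\<^sub>R B)"
      using \<open>compact T\<close> by (intro borel_integrable_compact) auto
    show "AE x in lborel. (\<lambda>n. q n x) \<longlonglongrightarrow> F' x"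
    proof (intro AE_I2)
      fix x
      have "(\<lambda>t. (F (x + t *\<^sub>R v) - F x) / t) \<midarrow>0\<rightarrow> F' x"
        using F'[of x] by (simp add: has_field_derivative_def DERIV_def[unfolded has_field_derivative_def])
      moreover have "h \<longlonglongrightarrow> 0" unfolding h_def by (rule LIMSEQ_Suc[OF lim_1_over_n])
      then have "filterlim h (at 0) sequentially"
        using h by (auto simp: filterlim_at less_imp_neq[THEN not_sym])
      ultimately show "(\<lambda>n. q n x) \<longlonglongrightarrow> F' x"
        unfolding q_def by (rule filterlim_compose)
    qed
    show "AE x in lborel. norm (q n x) \<le> indicator T x *\<^sub>R B" for n
    proof (intro AE_I2)
      fix x
      show "norm (q n x) \<le> indicator T x *\<^sub>R B"
      proof (cases "x \<in> T")
        case True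
        obtain z where "F (x + h n *\<^sub>R v) - F (x + 0 *\<^sub>R v) = (h n - 0) * F' (x + z *\<^sub>R v)"
          using MVT2[of 0 "h n" "\<lambda>t. F (x + t *\<^sub>R v)" "\<lambda>t. F' (x + t *\<^sub>R v)"] F't h by blast
        then have "q n x = F' (x + z *\<^sub>R v)" using h[of n] by (simp add: q_def)
        then show ?thesis using B True by simp
      next
        case False
        then show ?thesis using T[of x "h n"] T[of x 0] h[of n] by (simp add: q_def)
      qed
    qed
  qed
  then show ?thesis using q0 by (simp add: LIMSEQ_const_iff)
qed

text \<open>Differentiability is assumed on \<open>U\<close> only, but \<open>W\<close> vanishes off
  the compact set \<open>S\<close>, so its derivative is zero off \<open>U\<close>. The diagonal
  derivatives extended by zero stay continuous because \<open>U\<close> and \<open>- S\<close> are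
  two open sets covering the space; each of them then integrates to zero in its own
  direction.\<close>

lemma set_integral_divergence_zero:
  fixes W :: "'a::euclidean_space \<Rightarrow> 'a \<Rightarrow> real"
  assumes "open U" "compact S" "S \<subseteq> U"
    and W0: "\<And>i x. i \<in> Basis \<Longrightarrow> x \<notin> S \<Longrightarrow> W i x = 0"
    and W': "\<And>i x. i \<in> Basis \<Longrightarrow> x \<in> U \<Longrightarrow> (W i has_derivative W' i x) (at x)"
    and cont: "\<And>i. i \<in> Basis \<Longrightarrow> continuous_on U (\<lambda>x. W' i x i)"
  shows "set_lebesgue_integral lborel S (\<lambda>x. \<Sum>i\<in>Basis. W' i x i) = 0"
proof -
  define D where "D i x = (if x \<in> U then W' i x i else 0)" for i x
  have deriv: "(W i has_derivative (if x \<in> U then W' i x else (\<lambda>_. 0))) (at x)" if i: "i \<in> Basis" for i x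
  proof (cases "x \<in> U")
    case True then show ?thesis using W' i by simp
  next
    case False
    have "((\<lambda>x. 0) has_derivative (\<lambda>_. 0)) (at x)" by simp
    then have "(W i has_derivative (\<lambda>_. 0)) (at x)"
      by (rule has_derivative_transform_within_open[where s = "- S"])
        (use False \<open>S \<subseteq> U\<close> \<open>compact S\<close> W0 i in \<open>auto simp: compact_imp_closed open_Compl\<close>)
    then show ?thesis using False by simp
  qed
  have D0: "D i x = 0" if i: "i \<in> Basis" and "x \<notin> S" for i x
  proof (cases "x \<in> U")
    case True
    have "((\<lambda>x. 0) has_derivative (\<lambda>_. 0)) (at x)" by simp
    then have "(W i has_derivative (\<lambda>_. 0)) (at x)"
      by (rule has_derivative_transform_within_open[where s = "- S"])
        (use that \<open>S \<subseteq> U\<close> \<open>compact S\<close> W0 i in \<open>auto simp: compact_imp_closed open_Compl\<close>)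
    then have "W' i x = (\<lambda>_. 0)" using W'[OF i True] has_derivative_unique by blast
    then show ?thesis by (simp add: D_def)
  qed (simp add: D_def)
  have contD: "continuous_on UNIV (D i)" if i: "i \<in> Basis" for i
  proof -
    have "continuous_on U (D i)" using cont[OF i] by (simp add: D_def cong: continuous_on_cong)
    moreover have "continuous_on (- S) (D i)"
      using D0[OF i] by (subst continuous_on_cong[where g = "\<lambda>_. 0"]) auto
    moreover have "U \<union> - S = UNIV" using \<open>S \<subseteq> U\<close> by auto
    ultimately show ?thesis
      using continuous_on_open_Un[of U "- S" "D i"] \<open>open U\<close> \<open>compact S\<close>
      by (simp add: compact_imp_closed open_Compl)
  qed
  have int: "integrable lborel (D i)" if i: "i \<in> Basis" for i
  proof -
    have "integrable lborel (\<lambda>x. indicator S x *\<^sub>R D i x)"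
      using \<open>compact S\<close> contD[OF i] by (intro borel_integrable_compact) (auto intro: continuous_on_subset)
    moreover have "(\<lambda>x. indicator S x *\<^sub>R D i x) = D i" using D0[OF i] by (auto simp: indicator_def fun_eq_iff)
    ultimately show ?thesis by simp
  qed
  have "integral\<^sup>L lborel (D i) = 0" if i: "i \<in> Basis" for i
  proof (rule integral_directional_derivative_zero[OF \<open>compact S\<close> W0[OF i] _ contD[OF i], where v = i])
    show "continuous_on UNIV (W i)"
      using deriv[OF i] has_derivative_continuous by (blast intro: continuous_at_imp_continuous_on)
    show "((\<lambda>t. W i (x + t *\<^sub>R i)) has_real_derivative D i x) (at 0)" for x
      using has_real_derivative_line[of "W i" _ x 0 i] deriv[OF i, of x] by (auto simp: D_def split: if_splits)
  qed
  then have "integral\<^sup>L lborel (\<lambda>x. \<Sum>i\<in>Basis. D i x) = 0"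
    using int by (simp add: Bochner_Integration.integral_sum)
  moreover have "indicator S x *\<^sub>R (\<Sum>i\<in>Basis. W' i x i) = (\<Sum>i\<in>Basis. D i x)" for x
    using D0 \<open>S \<subseteq> U\<close> by (auto simp: D_def indicator_def)
  ultimately show ?thesis by (simp add: set_lebesgue_integral_def)
qed

section \<open>Gradient estimate and mean value inequality\<close>

text \<open>The odd part of \<open>w\<close> across the hyperplane through \<open>p\<close> is compared with an explicit barrier on a half ball
  (Gilbarg and Trudinger, Section 3.4).\<close>

lemma gradient_estimate_half_ball:
  fixes w :: "'a::euclidean_space \<Rightarrow> real"
  assumes "open U" "cball p d \<subseteq> U" "d > 0" "M \<ge> 0" and j: "j \<in> Basis"
    and W: "\<And>x. x \<in> U \<Longrightarrow> (w has_derivative W x) (at x)"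
    and H: "\<And>x i. x \<in> U \<Longrightarrow> i \<in> Basis \<Longrightarrow> ((\<lambda>y. W y i) has_derivative H i x) (at x)"
    and M: "\<And>x. x \<in> cball p d \<Longrightarrow> \<bar>w x\<bar> \<le> M"
    and N: "\<And>x. x \<in> cball p d \<Longrightarrow> \<bar>\<Sum>i\<in>Basis. H i x i\<bar> \<le> N"
  shows "W p j \<le> real DIM('a) * M / d + N * d / 2"
proof -
  define n where "n = real DIM('a)"
  have "W p j \<le> n * M / d + N * d / 2 + e" if "e > 0" for e
  proof -
    \<comment> \<open>The slack \<open>e\<close> is spent on \<open>N' > N\<close>, which makes the
      comparison strict, as the maximum principle requires.\<close>
    define N' where "N' = N + 2 * e / d"
    have "N' > N" using that \<open>d > 0\<close> by (simp add: N'_def)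
    have "N \<ge> 0" using N[of p] \<open>d > 0\<close> by fastforce
    define m c where "m = M / d\<^sup>2" and "c = N' / 2"
    have mc: "m \<ge> 0" "c \<ge> 0" "m * d\<^sup>2 = M" "2 * c = N'"
      using \<open>d > 0\<close> \<open>M \<ge> 0\<close> \<open>N \<ge> 0\<close> \<open>N' > N\<close> by (auto simp: m_def c_def)
    define r where "r x = x - (2 * ((x - p) \<bullet> j)) *\<^sub>R j" for x
    \<comment> \<open>The barrier. The \<open>m\<close> part is harmonic, since the squared norm
      contributes \<open>2 * n\<close> and the quadratic in the normal coordinate
      \<open>- 2 * n\<close>; on the spherical part of the boundary it is at least
      \<open>m * d\<^sup>2 = M\<close>. The \<open>c\<close> part has Laplacian
      \<open>- 2 * c = - N'\<close>. Both are nonnegative on the half ball.\<close>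
    define \<psi> where "\<psi> x = m * ((x - p) \<bullet> (x - p) + n * (((x - p) \<bullet> j) * (d - (x - p) \<bullet> j)))
        + c * (((x - p) \<bullet> j) * (d - (x - p) \<bullet> j))" for x
    define g where "g x = (1/2) * (w x - w (r x)) - \<psi> x" for x
    define G where "G x h = (1/2) * (W x h - W (r x) (h - (2 * (h \<bullet> j)) *\<^sub>R j))
        - (m * (2 * ((x - p) \<bullet> h) + n * ((h \<bullet> j) * (d - 2 * ((x - p) \<bullet> j))))
           + c * ((h \<bullet> j) * (d - 2 * ((x - p) \<bullet> j))))" for x h
    \<comment> \<open>The eigenvalue of the linear part of the reflection \<open>r\<close> on the
      basis vector \<open>i\<close>. It enters once per derivative, so it squares to 1 in pure
      second derivatives.\<close>
    define \<sigma> where "\<sigma> i = (if i = j then -1 else 1 :: real)" for i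
    have \<sigma>: "i - (2 * (i \<bullet> j)) *\<^sub>R j = \<sigma> i *\<^sub>R i" if "i \<in> Basis" for i
      using that j by (auto simp: \<sigma>_def inner_Basis scaleR_2)
    have \<sigma>2: "\<sigma> i * \<sigma> i = 1" for i by (simp add: \<sigma>_def)
    define H' where "H' i x h = (1/2) * (H i x h - \<sigma> i * H i (r x) (h - (2 * (h \<bullet> j)) *\<^sub>R j))
        - (m * (2 * (h \<bullet> i) + n * ((i \<bullet> j) * (- 2 * (h \<bullet> j))))
           + c * ((i \<bullet> j) * (- 2 * (h \<bullet> j))))" for i x h
    have dr: "(r has_derivative (\<lambda>h. h - (2 * (h \<bullet> j)) *\<^sub>R j)) (at x)" for x
      unfolding r_def by (auto intro!: derivative_eq_intros)
    have nr: "norm (r x - p) = norm (x - p)" for x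
    proof -
      have "(r x - p) \<bullet> (r x - p) = (x - p) \<bullet> (x - p)"
        using j by (simp add: r_def algebra_simps inner_simps inner_commute)
      then show ?thesis by (simp add: norm_eq_sqrt_inner)
    qed
    have rin: "r x \<in> cball p d" if "x \<in> cball p d" for x
      using that nr[of x] by (simp add: dist_norm norm_minus_commute)
    let ?K = "cball p d \<inter> {x. 0 \<le> (x - p) \<bullet> j}"
    let ?V = "ball p d \<inter> {x. 0 < (x - p) \<bullet> j}"
    have VU: "x \<in> U \<and> r x \<in> U \<and> x \<in> cball p d" if "x \<in> ?V" for x
      using that rin[of x] \<open>cball p d \<subseteq> U\<close> by (auto simp: subset_iff)
    have le0: "g x \<le> 0" if "x \<in> ?K" for x
    proof (rule strict_subsolution_nonpos[of ?K ?V g G H'])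
      show "compact ?K"
        by (intro compact_Int_closed compact_cball closed_Collect_le continuous_intros)
      show "open ?V" by (intro open_Int open_ball open_Collect_less continuous_intros)
      show "?V \<subseteq> ?K" by auto
      have cw: "continuous_on U w"
        using W has_derivative_continuous by (blast intro: continuous_at_imp_continuous_on)
      have cr: "continuous_on ?K r" unfolding r_def by (intro continuous_intros)
      have "continuous_on ?K (w \<circ> r)"
        by (rule continuous_on_compose[OF cr continuous_on_subset[OF cw]])
          (use rin \<open>cball p d \<subseteq> U\<close> in auto)
      moreover have "continuous_on ?K w"
        by (rule continuous_on_subset[OF cw]) (use \<open>cball p d \<subseteq> U\<close> in auto)
      ultimately show "continuous_on ?K g"
        unfolding g_def \<psi>_def o_def by (intro continuous_intros) auto
      show "g x \<le> 0" if x: "x \<in> ?K - ?V" for x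
      proof -
        let ?s = "(x - p) \<bullet> j"
        have s: "0 \<le> ?s" "?s \<le> d"
          using x Basis_le_norm[OF j, of "x - p"] by (auto simp: dist_norm norm_minus_commute)
        have "norm (x - p) = d \<or> ?s = 0" using x by (auto simp: dist_norm norm_minus_commute)
        then show ?thesis
        proof
          assume "norm (x - p) = d"
          then have *: "(x - p) \<bullet> (x - p) = d\<^sup>2" by (metis power2_norm_eq_inner)
          have "m * (d\<^sup>2 + 0) + 0 \<le> \<psi> x"
            unfolding \<psi>_def * using s mc
            by (intro add_mono mult_left_mono mult_nonneg_nonneg) (auto simp: n_def)
          then have "M \<le> \<psi> x" using mc by simp
          moreover have "\<bar>w x\<bar> \<le> M" "\<bar>w (r x)\<bar> \<le> M" using x M rin by auto
          ultimately show ?thesis unfolding g_def by (simp add: abs_le_iff field_simps)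
        next
          assume "?s = 0"
          then have "r x = x" "0 \<le> \<psi> x" using mc by (auto simp: r_def \<psi>_def)
          then show ?thesis by (simp add: g_def)
        qed
      qed
      show "(g has_derivative G x) (at x)" if "x \<in> ?V" for x
      proof -
        have 1: "((\<lambda>x. w (r x)) has_derivative (\<lambda>h. W (r x) (h - (2 * (h \<bullet> j)) *\<^sub>R j))) (at x)"
          using diff_chain_at[OF dr W] VU[OF that] by (simp add: o_def)
        have 2: "(w has_derivative W x) (at x)" using W VU[OF that] by blast
        show ?thesis unfolding g_def \<psi>_def G_def
          by (auto intro!: derivative_eq_intros 1 2 simp: fun_eq_iff algebra_simps inner_commute)
      qed
      show "((\<lambda>y. G y i) has_derivative H' i x) (at x)" if "x \<in> ?V" and i: "i \<in> Basis" for x i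
      proof -
        have "open ?V" by (intro open_Int open_ball open_Collect_less continuous_intros)
        have 1: "((\<lambda>x. W (r x) i) has_derivative (\<lambda>h. H i (r x) (h - (2 * (h \<bullet> j)) *\<^sub>R j))) (at x)"
          using diff_chain_at[OF dr H] VU[OF that(1)] i by (simp add: o_def)
        have 2: "((\<lambda>y. W y i) has_derivative H i x) (at x)" using H VU[OF that(1)] i by blast
        have "((\<lambda>y. (1/2) * (W y i - \<sigma> i * W (r y) i)
          - (m * (2 * ((y - p) \<bullet> i) + n * ((i \<bullet> j) * (d - 2 * ((y - p) \<bullet> j))))
             + c * ((i \<bullet> j) * (d - 2 * ((y - p) \<bullet> j))))) has_derivative H' i x) (at x)"
          unfolding H'_def
          by (auto intro!: derivative_eq_intros 1 2 simp: fun_eq_iff algebra_simps inner_commute)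
        then show ?thesis
        proof (rule has_derivative_transform_within_open[OF _ \<open>open ?V\<close> that(1)])
          fix y assume "y \<in> ?V"
          then have "linear (W (r y))" using W VU has_derivative_linear by blast
          then have "W (r y) (\<sigma> i *\<^sub>R i) = \<sigma> i * W (r y) i" by (simp add: linear_cmul)
          then show "(1/2) * (W y i - \<sigma> i * W (r y) i)
            - (m * (2 * ((y - p) \<bullet> i) + n * ((i \<bullet> j) * (d - 2 * ((y - p) \<bullet> j))))
               + c * ((i \<bullet> j) * (d - 2 * ((y - p) \<bullet> j)))) = G y i"
            by (simp add: G_def \<sigma>[OF i])
        qed
      qed
      show "0 < (\<Sum>i\<in>Basis. H' i x i)" if x: "x \<in> ?V" for x
      proof -
        have "H' i x i = H i x i / 2 - H i (r x) i / 2 - (2 * m - (2 * n * m + 2 * c) * (if i = j then 1 else 0))"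
          if i: "i \<in> Basis" for i
        proof -
          have "linear (H i (r x))" using H VU[OF x] i has_derivative_linear by blast
          then have "\<sigma> i * H i (r x) (\<sigma> i *\<^sub>R i) = H i (r x) i"
            by (simp add: linear_cmul mult.assoc[symmetric] \<sigma>2)
          then show ?thesis using i j unfolding H'_def \<sigma>[OF i] by (simp add: inner_Basis field_simps)
        qed
        then have "(\<Sum>i\<in>Basis. H' i x i) = (\<Sum>i\<in>Basis. H i x i) / 2 - (\<Sum>i\<in>Basis. H i (r x) i) / 2
            - (2 * n * m - (2 * n * m + 2 * c))"
          using j by (simp add: sum_subtractf sum_divide_distrib sum.distrib sum_distrib_left[symmetric] n_def)
        moreover have "\<bar>\<Sum>i\<in>Basis. H i x i\<bar> \<le> N" "\<bar>\<Sum>i\<in>Basis. H i (r x) i\<bar> \<le> N"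
          using N rin VU[OF x] by blast+
        ultimately show ?thesis using \<open>N' > N\<close> mc by (simp add: abs_le_iff)
      qed
    qed (fact that)
    \<comment> \<open>\<open>k\<close> is minus \<open>g\<close> along the normal through
      \<open>p\<close>. It vanishes at 0 and is nonnegative just after, so its derivative at 0,
      which contains \<open>- W p j\<close>, cannot be negative.\<close>
    define k where "k t = m * (t * t + n * (t * (d - t))) + c * (t * (d - t))
        - (w (p + t *\<^sub>R j) - w (p - t *\<^sub>R j)) / 2" for t
    have kge: "k t \<ge> 0" if "0 \<le> t" "t \<le> d" for t
    proof -
      have "r (p + t *\<^sub>R j) = p - t *\<^sub>R j" using j scaleR_left_distrib[of t t j]
        by (simp add: r_def algebra_simps)
      moreover have "p + t *\<^sub>R j \<in> ?K" using that j by (simp add: dist_norm)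
      ultimately show ?thesis
        using le0[of "p + t *\<^sub>R j"] j by (simp add: g_def \<psi>_def k_def)
    qed
    have "p \<in> U" using \<open>cball p d \<subseteq> U\<close> \<open>d > 0\<close> by auto
    have w1: "((\<lambda>t. w (p + t *\<^sub>R j)) has_real_derivative W p j) (at 0)"
      using has_real_derivative_line[of w "W p" p 0 j] W \<open>p \<in> U\<close> by simp
    have w2: "((\<lambda>t. w (p - t *\<^sub>R j)) has_real_derivative - W p j) (at 0)"
      using DERIV_mirror[of "\<lambda>t. w (p + t *\<^sub>R j)" "W p j" 0] w1 by simp
    have "(k has_real_derivative m * (n * d) + c * d - W p j) (at 0)"
      unfolding k_def by (auto intro!: derivative_eq_intros w1 w2 simp: algebra_simps)
    moreover have "k 0 = 0" by (simp add: k_def)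
    ultimately have "\<not> m * (n * d) + c * d - W p j < 0"
    proof (intro notI)
      assume *: "(k has_real_derivative m * (n * d) + c * d - W p j) (at 0)"
        "m * (n * d) + c * d - W p j < 0" "k 0 = 0"
      obtain e' where e': "e' > 0" "\<And>h. 0 < h \<Longrightarrow> h < e' \<Longrightarrow> k (0 + h) < k 0"
        using DERIV_neg_dec_right[OF *(1,2)] by auto
      have "0 < min e' d / 2" "min e' d / 2 < e'" "min e' d / 2 \<le> d"
        using e'(1) \<open>d > 0\<close> by (auto simp: min_def)
      then show False
        using e'(2)[of "min e' d / 2"] kge[of "min e' d / 2"] *(3) by auto
    qed
    then have "W p j \<le> (M / d\<^sup>2) * (n * d) + N' / 2 * d" by (simp add: m_def c_def)
    also have "\<dots> = n * M / d + N * d / 2 + e"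
      using \<open>d > 0\<close> by (simp add: N'_def power2_eq_square field_simps)
    finally show ?thesis .
  qed
  then show ?thesis unfolding n_def by (rule field_le_epsilon)
qed

text \<open>At 0 the difference quotient is at most \<open>h\<^sup>2\<close>. With exponent 3 the
  derivative is again continuous; \<open>bump_potential\<close> and the cutoffs are built from this
  function.\<close>

lemma has_real_derivative_max0_power3:
  "((\<lambda>t::real. (max 0 t) ^ 3) has_real_derivative 3 * (max 0 t)\<^sup>2) (at t)"
proof -
  consider "t > 0" | "t < 0" | "t = 0" by linarith
  then show ?thesis
  proof cases
    case 1
    have "((\<lambda>t. t ^ 3) has_real_derivative 3 * (max 0 t)\<^sup>2) (at t)"
      using 1 by (auto intro!: derivative_eq_intros)
    then show ?thesis
      by (rule has_field_derivative_transform_within_open[of _ _ _ "{0<..}"]) (use 1 in auto)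
  next
    case 2
    have "((\<lambda>t. 0) has_real_derivative 3 * (max 0 t)\<^sup>2) (at t)"
      using 2 by simp
    then show ?thesis
      by (rule has_field_derivative_transform_within_open[of _ _ _ "{..<0}"]) (use 2 in auto)
  next
    case 3
    have "((\<lambda>h::real. (max 0 h) ^ 3 / h) \<longlongrightarrow> 0) (at 0)"
    proof (rule Lim_null_comparison)
      show "\<forall>\<^sub>F h::real in at 0. norm ((max 0 h) ^ 3 / h) \<le> h\<^sup>2"
        by (rule always_eventually) (auto simp: max_def power3_eq_cube power2_eq_square)
      have "((\<lambda>h::real. h\<^sup>2) \<longlongrightarrow> 0\<^sup>2) (at 0)" by (intro tendsto_intros)
      then show "((\<lambda>h::real. h\<^sup>2) \<longlongrightarrow> 0) (at 0)" by simp
    qed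
    then show ?thesis using 3 by (simp add: DERIV_def)
  qed
qed

section \<open>An explicit bump function and the averages it defines\<close>

definition bump :: "'a::euclidean_space \<Rightarrow> real" where
  "bump y = (max 0 (1 - y \<bullet> y))\<^sup>2"

text \<open>The divisor 6 cancels the 3 of the cube and the 2 of the square in the gradient.\<close>

definition bump_potential :: "'a::euclidean_space \<Rightarrow> real" where
  "bump_potential y = (max 0 (1 - y \<bullet> y)) ^ 3 / 6"

lemma has_derivative_bump_potential:
  "(bump_potential has_derivative (\<lambda>h. - bump y * (y \<bullet> h))) (at y)"
proof -
  have "((\<lambda>y. 1 - y \<bullet> y) has_derivative (\<lambda>h. - 2 * (y \<bullet> h))) (at y)"
    by (auto intro!: derivative_eq_intros simp: inner_commute)
  from has_derivative_compose[OF this has_real_derivative_max0_power3[unfolded has_field_derivative_def]]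
  have "((\<lambda>y. (max 0 (1 - y \<bullet> y)) ^ 3) has_derivative (\<lambda>h. 3 * (max 0 (1 - y \<bullet> y))\<^sup>2 * (- 2 * (y \<bullet> h)))) (at y)"
    by simp
  from has_derivative_mult_right[OF this, of "1 / 6"] show ?thesis
    by (simp add: bump_potential_def[abs_def] bump_def algebra_simps)
qed

lemma continuous_on_bump: "continuous_on S bump"
  unfolding bump_def by (intro continuous_intros)

lemma continuous_on_bump_potential: "continuous_on S bump_potential"
  unfolding bump_potential_def by (intro continuous_intros) simp

lemma norm_le_DIM:
  assumes "y \<in> cbox (- One) (One :: 'a::euclidean_space)"
  shows "norm y \<le> real DIM('a)"
proof -
  have "norm y \<le> (\<Sum>i\<in>Basis. \<bar>y \<bullet> i\<bar>)" by (rule norm_le_l1)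
  also have "\<dots> \<le> (\<Sum>i\<in>(Basis :: 'a set). 1)"
    using assms by (intro sum_mono) (auto simp: mem_box abs_le_iff minus_le_iff)
  finally show ?thesis by simp
qed

text \<open>Since \<open>bump_potential\<close> has gradient \<open>- bump y *\<^sub>R y\<close>, differentiating the average of \<open>g\<close> against \<open>bump\<close> in the
  radius produces the Laplacian of \<open>g\<close>.\<close>

lemma mean_value_inequality:
  fixes g :: "'a::euclidean_space \<Rightarrow> real"
  assumes "open U" "r > 0" "A \<ge> 0" and sub: "cball x (real DIM('a) * r) \<subseteq> U"
    and G: "\<And>x. x \<in> U \<Longrightarrow> (g has_derivative G x) (at x)"
    and H: "\<And>x i. x \<in> U \<Longrightarrow> i \<in> Basis \<Longrightarrow> ((\<lambda>y. G y i) has_derivative H i x) (at x)"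
    and contH: "\<And>i. i \<in> Basis \<Longrightarrow> continuous_on U (\<lambda>x. H i x i)"
    and lap: "\<And>x. x \<in> U \<Longrightarrow> (\<Sum>i\<in>Basis. H i x i) \<ge> - A"
  shows "g x * integral (cbox (- One) One) (bump :: 'a \<Rightarrow> real)
    \<le> integral (cbox (- One) One) (\<lambda>y. g (x + r *\<^sub>R y) * bump y)
      + A * r\<^sup>2 * integral (cbox (- One) One) (bump_potential :: 'a \<Rightarrow> real)"
proof -
  \<comment> \<open>\<open>bump\<close> lives on the unit ball; a box containing it is used because
    the differentiation under the integral is carried out over boxes. Points of the box have norm at
    most the dimension, whence the radius in \<open>sub\<close>.\<close>
  let ?C = "cbox (- One) One :: 'a set"
  have inU: "x + t *\<^sub>R y \<in> U" if "0 \<le> t" "t \<le> r" "y \<in> ?C" for t y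
  proof -
    have "\<bar>t\<bar> * norm y \<le> r * real DIM('a)"
      using that norm_le_DIM[OF that(3)] by (intro mult_mono) auto
    then have "x + t *\<^sub>R y \<in> cball x (real DIM('a) * r)" by (simp add: dist_norm mult.commute)
    then show ?thesis using sub by blast
  qed
  have contg: "continuous_on U g"
    using G has_derivative_continuous by (blast intro: continuous_at_imp_continuous_on)
  have contG: "continuous_on U (\<lambda>x. G x i)" if "i \<in> Basis" for i
    by (intro continuous_at_imp_continuous_on ballI has_derivative_continuous[OF H[OF _ that]])
  have Gsum: "G z y = (\<Sum>i\<in>Basis. (y \<bullet> i) * G z i)" if "z \<in> U" for z y
  proof -
    have "linear (G z)" using G[OF that] has_derivative_linear by blast
    then have "G z (\<Sum>i\<in>Basis. (y \<bullet> i) *\<^sub>R i) = (\<Sum>i\<in>Basis. (y \<bullet> i) * G z i)"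
      by (simp add: linear_sum linear_cmul)
    then show ?thesis by (simp add: euclidean_representation)
  qed
  have cont_line: "continuous_on ?C (\<lambda>y. F (x + t *\<^sub>R y))"
    if "continuous_on U F" "0 \<le> t" "t \<le> r" for F :: "'a \<Rightarrow> real" and t
    by (rule continuous_on_compose2[OF that(1)]) (use inU that in \<open>auto intro!: continuous_intros\<close>)
  \<comment> \<open>\<open>I 0\<close> is \<open>g x\<close> times the mass of \<open>bump\<close>
    and \<open>I r\<close> is the integral in the claim, so what is missing is a lower bound for
    \<open>I'\<close> on \<open>0 < t < r\<close>.\<close>
  define I where "I t = integral ?C (\<lambda>y. g (x + t *\<^sub>R y) * bump y)" for t
  define I' where "I' t = integral ?C (\<lambda>y. G (x + t *\<^sub>R y) y * bump y)" for t
  have cG: "continuous_on ?C (\<lambda>y. G (x + t *\<^sub>R y) y * bump y)" if "0 \<le> t" "t \<le> r" for t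
  proof -
    have "continuous_on ?C (\<lambda>y. (\<Sum>i\<in>Basis. (y \<bullet> i) * G (x + t *\<^sub>R y) i) * bump y)"
      using that by (intro continuous_intros continuous_on_bump cont_line contG)
    then show ?thesis
    proof (rule continuous_on_eq)
      fix y assume "y \<in> ?C"
      then show "(\<Sum>i\<in>Basis. (y \<bullet> i) * G (x + t *\<^sub>R y) i) * bump y = G (x + t *\<^sub>R y) y * bump y"
        using Gsum[of "x + t *\<^sub>R y" y] inU that by simp
    qed
  qed
  have f1: "((\<lambda>t. g (x + t *\<^sub>R y) * bump y) has_real_derivative G (x + t *\<^sub>R y) y * bump y) (at t within {0..r})"
    if "t \<in> {0..r}" "y \<in> ?C" for t y
  proof -
    have "(g has_derivative G (x + t *\<^sub>R y)) (at (x + t *\<^sub>R y))"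
      using that by (intro G inU) auto
    from has_real_derivative_line[OF this] show ?thesis
      by (rule DERIV_cmult_right[OF has_field_derivative_at_within])
  qed
  have f2: "(\<lambda>y. g (x + t *\<^sub>R y) * bump y) integrable_on ?C" if "t \<in> {0..r}" for t
    using that by (intro integrable_continuous continuous_on_mult continuous_on_bump cont_line[OF contg]) auto
  have cGi: "continuous_on ({0..r} \<times> ?C) (\<lambda>p. G (x + fst p *\<^sub>R snd p) i)" if "i \<in> Basis" for i
  proof (rule continuous_on_compose2[OF contG[OF that]])
    show "continuous_on ({0..r} \<times> ?C) (\<lambda>p. x + fst p *\<^sub>R snd p)" by (intro continuous_intros)
  qed (auto intro: inU)
  have cb: "continuous_on ({0..r} \<times> ?C) (\<lambda>p. bump (snd p))"
    by (rule continuous_on_compose2[OF continuous_on_bump[of UNIV]]) (auto intro!: continuous_intros)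
  have f3: "continuous_on ({0..r} \<times> ?C) (\<lambda>(t, y). G (x + t *\<^sub>R y) y * bump y)"
  proof (rule continuous_on_eq)
    show "continuous_on ({0..r} \<times> ?C) (\<lambda>p. (\<Sum>i\<in>Basis. (snd p \<bullet> i) * G (x + fst p *\<^sub>R snd p) i) * bump (snd p))"
      by (intro continuous_on_mult continuous_on_sum continuous_on_inner continuous_on_snd continuous_on_id continuous_on_const cGi cb)
    fix p assume "p \<in> {0..r} \<times> ?C"
    then show "(\<Sum>i\<in>Basis. (snd p \<bullet> i) * G (x + fst p *\<^sub>R snd p) i) * bump (snd p)
        = (\<lambda>(t, y). G (x + t *\<^sub>R y) y * bump y) p"
      using Gsum[of "x + fst p *\<^sub>R snd p" "snd p"] inU[of "fst p" "snd p"] by (auto simp: case_prod_unfold)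
  qed
  have dI: "(I has_real_derivative I' t) (at t within {0..r})" if t: "t \<in> {0..r}" for t
    unfolding I_def I'_def
    by (rule leibniz_rule_field_derivative[OF f1 f2 f3 t convex_real_interval(5)])
  have I': "I' t \<ge> - (A * r) * integral ?C bump_potential" if t: "0 < t" "t < r" for t
  proof -
    \<comment> \<open>Integration by parts: the field is the gradient of \<open>g\<close> at the
      scaled point times \<open>bump_potential\<close>. Its divergence has integral zero, which
      trades \<open>I' t\<close> for \<open>t\<close> times the integral of the Laplacian against
      \<open>bump_potential\<close>.\<close>
    define W where "W i y = G (x + t *\<^sub>R y) i * bump_potential y" for i y
    define W' where "W' i y h = G (x + t *\<^sub>R y) i * (- bump y * (y \<bullet> h)) + H i (x + t *\<^sub>R y) (t *\<^sub>R h) * bump_potential y"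
      for i y h
    define Ut where "Ut = (\<lambda>y. x + t *\<^sub>R y) -` U"
    have "open Ut" unfolding Ut_def using \<open>open U\<close> by (intro open_vimage continuous_intros)
    have W'i: "W' i y i = - (y \<bullet> i) * G (x + t *\<^sub>R y) i * bump y + t * H i (x + t *\<^sub>R y) i * bump_potential y"
      if "y \<in> Ut" "i \<in> Basis" for i y
      using linear_cmul[OF has_derivative_linear[OF H], of "x + t *\<^sub>R y" i t i] that
      by (simp add: W'_def Ut_def algebra_simps)
    have ct: "continuous_on Ut (\<lambda>y. F (x + t *\<^sub>R y))" if "continuous_on U F" for F :: "'a \<Rightarrow> real"
      by (rule continuous_on_compose2[OF that]) (auto simp: Ut_def intro!: continuous_intros)
    have "set_lebesgue_integral lborel ?C (\<lambda>y. \<Sum>i\<in>Basis. W' i y i) = 0"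
    proof (rule set_integral_divergence_zero[OF \<open>open Ut\<close> compact_cbox, where W = W and W' = W'])
      show "?C \<subseteq> Ut" using inU t by (auto simp: Ut_def)
      show "W i y = 0" if y: "y \<notin> ?C" for i y
      proof -
        obtain k where "k \<in> Basis" "\<not> (- 1 \<le> y \<bullet> k \<and> y \<bullet> k \<le> 1)"
          using y by (auto simp: mem_box)
        then have "norm y > 1" using Basis_le_norm[of k y] by linarith
        then have "y \<bullet> y > 1" using one_less_power[of "norm y" 2] by (simp add: dot_square_norm)
        then show ?thesis by (simp add: W_def bump_potential_def)
      qed
      show "(W i has_derivative W' i y) (at y)" if "i \<in> Basis" "y \<in> Ut" for i y
      proof -
        have "((\<lambda>y. x + t *\<^sub>R y) has_derivative (\<lambda>h. t *\<^sub>R h)) (at y)"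
          by (auto intro!: derivative_eq_intros)
        from diff_chain_at[OF this H[of _ i]] that
        have "((\<lambda>y. G (x + t *\<^sub>R y) i) has_derivative (\<lambda>h. H i (x + t *\<^sub>R y) (t *\<^sub>R h))) (at y)"
          by (simp add: o_def Ut_def)
        from has_derivative_mult[OF this has_derivative_bump_potential] show ?thesis
          unfolding W_def W'_def by simp
      qed
      show "continuous_on Ut (\<lambda>y. W' i y i)" if "i \<in> Basis" for i
      proof -
        have "continuous_on Ut (\<lambda>y. - (y \<bullet> i) * G (x + t *\<^sub>R y) i * bump y + t * H i (x + t *\<^sub>R y) i * bump_potential y)"
          by (intro continuous_intros continuous_on_bump continuous_on_bump_potential ct contG contH that)
        then show ?thesis
          by (rule continuous_on_eq) (simp add: W'i[OF _ that])
      qed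
    qed
    also have "set_lebesgue_integral lborel ?C (\<lambda>y. \<Sum>i\<in>Basis. W' i y i)
        = set_lebesgue_integral lborel ?C (\<lambda>y. t * (\<Sum>i\<in>Basis. H i (x + t *\<^sub>R y) i) * bump_potential y - G (x + t *\<^sub>R y) y * bump y)"
    proof (rule set_lebesgue_integral_cong)
      show "\<forall>y. y \<in> ?C \<longrightarrow> (\<Sum>i\<in>Basis. W' i y i) = t * (\<Sum>i\<in>Basis. H i (x + t *\<^sub>R y) i) * bump_potential y - G (x + t *\<^sub>R y) y * bump y"
      proof (intro allI impI)
        fix y assume "y \<in> ?C"
        then have y: "y \<in> Ut" "x + t *\<^sub>R y \<in> U" using inU t by (auto simp: Ut_def)
        show "(\<Sum>i\<in>Basis. W' i y i) = t * (\<Sum>i\<in>Basis. H i (x + t *\<^sub>R y) i) * bump_potential y - G (x + t *\<^sub>R y) y * bump y"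
          using y by (simp add: W'i Gsum[of "x + t *\<^sub>R y" y] sum.distrib sum_subtractf sum_distrib_left sum_distrib_right sum_negf algebra_simps)
      qed
    qed simp
    also have "\<dots> = integral ?C (\<lambda>y. t * (\<Sum>i\<in>Basis. H i (x + t *\<^sub>R y) i) * bump_potential y - G (x + t *\<^sub>R y) y * bump y)"
    proof (rule set_borel_integral_eq_integral)
      show "set_integrable lborel ?C (\<lambda>y. t * (\<Sum>i\<in>Basis. H i (x + t *\<^sub>R y) i) * bump_potential y - G (x + t *\<^sub>R y) y * bump y)"
        unfolding set_integrable_def using t
        by (intro borel_integrable_compact compact_cbox continuous_intros cG cont_line contH continuous_on_bump_potential) auto
    qed
    also have "\<dots> = integral ?C (\<lambda>y. t * (\<Sum>i\<in>Basis. H i (x + t *\<^sub>R y) i) * bump_potential y) - I' t"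
      unfolding I'_def using t
      by (intro Henstock_Kurzweil_Integration.integral_diff integrable_continuous continuous_intros cG cont_line contH continuous_on_bump_potential) auto
    finally have "I' t = integral ?C (\<lambda>y. t * (\<Sum>i\<in>Basis. H i (x + t *\<^sub>R y) i) * bump_potential y)" by simp
    also have "\<dots> \<ge> integral ?C (\<lambda>y. - (A * r) * bump_potential y)"
    proof (rule integral_le)
      show "(\<lambda>y. - (A * r) * bump_potential y) integrable_on ?C"
        by (intro integrable_continuous continuous_intros continuous_on_bump_potential)
      show "(\<lambda>y. t * (\<Sum>i\<in>Basis. H i (x + t *\<^sub>R y) i) * bump_potential y) integrable_on ?C"
        using t by (intro integrable_continuous continuous_intros cont_line contH continuous_on_bump_potential) auto
      fix y assume y: "y \<in> ?C"
      have "- (A * r) \<le> t * (- A)" using t \<open>A \<ge> 0\<close> by (simp add: mult.commute mult_left_mono)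
      also have "\<dots> \<le> t * (\<Sum>i\<in>Basis. H i (x + t *\<^sub>R y) i)"
        using t lap[OF inU[of t y]] y by (intro mult_left_mono) auto
      finally show "- (A * r) * bump_potential y \<le> t * (\<Sum>i\<in>Basis. H i (x + t *\<^sub>R y) i) * bump_potential y"
        by (intro mult_right_mono) (simp_all add: bump_potential_def)
    qed
    finally show ?thesis by (simp only: integral_mult_right)
  qed
  have cI: "continuous_on {0..r} I"
    using DERIV_continuous_on[OF dI] .
  have dI': "(I has_real_derivative I' t) (at t)" if "0 < t" "t < r" for t
    using dI[of t] that by (simp add: at_within_Icc_at)
  have "I differentiable (at t)" if "0 < t" "t < r" for t
    using dI'[OF that] by (auto simp: real_differentiable_def)
  from MVT[OF \<open>r > 0\<close> cI this] obtain l t where "0 < t" "t < r"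
    "(I has_real_derivative l) (at t)" "I r - I 0 = (r - 0) * l"
    by blast
  then have t: "0 < t" "t < r" "I r - I 0 = (r - 0) * I' t"
    using DERIV_unique[OF dI'] by auto
  have "I r - I 0 \<ge> r * (- (A * r) * integral ?C bump_potential)"
    using mult_left_mono[OF I'[OF t(1,2)], of r] \<open>r > 0\<close> t(3) by simp
  moreover have "I 0 = g x * integral ?C bump" by (simp add: I_def)
  ultimately show ?thesis by (simp add: I_def power2_eq_square algebra_simps)
qed

section \<open>The potential\<close>

lemma smooth_onD:
  fixes f :: "'a::euclidean_space \<Rightarrow> 'b::real_normed_vector"
  assumes "smooth_on f S"
  shows smooth_on_has_derivative:
      "x \<in> S \<Longrightarrow> (f has_derivative frechet_derivative f (at x)) (at x)"
    and smooth_on_has_second_derivative: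
      "x \<in> S \<Longrightarrow> ((\<lambda>y. frechet_derivative f (at y) v) has_derivative second_deriv f x v) (at x)"
    and smooth_on_continuous: "continuous_on S f"
    and smooth_on_continuous_derivative: "continuous_on S (\<lambda>x. frechet_derivative f (at x) v)"
    and smooth_on_continuous_second_derivative: "continuous_on S (\<lambda>x. second_deriv f x v w)"
proof -
  have C: "Ck_on (Suc (Suc 0)) f S" using assms by (simp add: smooth_on_def)
  then show 1: "(f has_derivative frechet_derivative f (at x)) (at x)" if "x \<in> S" for x
    using that by (simp add: frechet_derivative_works[symmetric])
  show 2: "((\<lambda>y. frechet_derivative f (at y) v) has_derivative second_deriv f x v) (at x)" if "x \<in> S" for x v
  proof -
    have "second_deriv f x v = frechet_derivative (\<lambda>y. frechet_derivative f (at y) v) (at x)"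
      by (simp add: fun_eq_iff second_deriv_def)
    then show ?thesis using C that by (simp add: frechet_derivative_works[symmetric])
  qed
  show "continuous_on S f"
    by (intro continuous_at_imp_continuous_on ballI has_derivative_continuous[OF 1])
  show "continuous_on S (\<lambda>x. frechet_derivative f (at x) v)"
    by (intro continuous_at_imp_continuous_on ballI has_derivative_continuous[OF 2])
  show "continuous_on S (\<lambda>x. second_deriv f x v w)"
    using C by (simp add: second_deriv_def)
qed

lemma has_derivative_sum_Basis:
  assumes "(f has_derivative F) (at x)"
  shows "F h = (\<Sum>i\<in>Basis. (h \<bullet> i) *\<^sub>R F i)"
proof -
  have "linear F" using assms by (rule has_derivative_linear)
  then have "F (\<Sum>i\<in>Basis. (h \<bullet> i) *\<^sub>R i) = (\<Sum>i\<in>Basis. (h \<bullet> i) *\<^sub>R F i)"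
    by (simp add: linear_sum linear_cmul)
  then show ?thesis by (simp only: euclidean_representation)
qed

lemma frechet_derivative_eq_grad:
  assumes "smooth_on V S" "y \<in> S"
  shows "frechet_derivative V (at y) h = grad V y \<bullet> h"
  using has_derivative_sum_Basis[OF smooth_on_has_derivative[OF assms], of h]
  unfolding grad_def inner_sum_left by (simp add: inner_commute mult.commute)

lemma continuous_on_grad: "smooth_on V S \<Longrightarrow> continuous_on S (grad V)"
  unfolding grad_def by (intro continuous_intros smooth_on_continuous_derivative)

lemma admissible_potential_nonneg:
  assumes "admissible_potential V" shows "V y \<ge> 0"
proof -
  have "(INF y. V y) \<le> V y"
    using assms by (intro cINF_lower) (auto simp: admissible_potential_def)
  then show ?thesis using assms by (simp add: admissible_potential_def)
qed

lemma admissible_potential_smooth: "admissible_potential V \<Longrightarrow> smooth_on V UNIV"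
  by (simp add: admissible_potential_def)

text \<open>Linearity in \<open>w\<close> is that of a derivative; linearity in \<open>v\<close>
  comes from uniqueness of the derivative, applied to the directional derivative written in
  coordinates. This reduces continuity of the Hessian form, in the point and in the direction, to
  finitely many entries.\<close>

lemma second_deriv_expand:
  fixes V :: "'a::euclidean_space \<Rightarrow> real"
  assumes "smooth_on V UNIV"
  shows "second_deriv V y v w = (\<Sum>i\<in>Basis. \<Sum>j\<in>Basis. (v \<bullet> i) * (w \<bullet> j) * second_deriv V y i j)"
proof -
  note d2 = smooth_on_has_second_derivative[OF assms UNIV_I]
  have "frechet_derivative V (at x) v = (\<Sum>i\<in>Basis. (v \<bullet> i) * frechet_derivative V (at x) i)" for x
    using has_derivative_sum_Basis[OF smooth_on_has_derivative[OF assms UNIV_I], of x v] by simp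
  then have "((\<lambda>x. \<Sum>i\<in>Basis. (v \<bullet> i) * frechet_derivative V (at x) i) has_derivative
      second_deriv V y v) (at y)"
    using d2[where v = v] by simp
  moreover have "((\<lambda>x. \<Sum>i\<in>Basis. (v \<bullet> i) * frechet_derivative V (at x) i) has_derivative
      (\<lambda>h. \<Sum>i\<in>Basis. (v \<bullet> i) * second_deriv V y i h)) (at y)"
    by (intro has_derivative_sum has_derivative_mult_right d2)
  ultimately have "second_deriv V y v = (\<lambda>h. \<Sum>i\<in>Basis. (v \<bullet> i) * second_deriv V y i h)"
    by (rule has_derivative_unique)
  moreover have "second_deriv V y i w = (\<Sum>j\<in>Basis. (w \<bullet> j) * second_deriv V y i j)" for i
    using has_derivative_sum_Basis[OF d2[where v = i and x = y], of w] by simp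
  ultimately show ?thesis by (simp add: sum_distrib_left mult.assoc)
qed

text \<open>A constant absorbs the compact ball on which the radial condition says nothing, leaving
  a condition valid for every \<open>y\<close>.\<close>

lemma admissible_potential_radial_lower_bound:
  assumes "admissible_potential V"
  obtains \<alpha> C where "\<alpha> > 0" "C \<ge> 0" "\<And>y. y \<bullet> grad V y \<ge> \<alpha> * (norm y)\<^sup>2 - C"
proof -
  obtain \<alpha> R where aR: "\<alpha> > 0" "R > 0" "\<And>y. norm y > R \<Longrightarrow> y \<bullet> grad V y \<ge> \<alpha> * (norm y)\<^sup>2"
    using assms unfolding admissible_potential_def by blast
  have "continuous_on (cball 0 R) (\<lambda>y. y \<bullet> grad V y - \<alpha> * (norm y)\<^sup>2)"
    by (intro continuous_intros continuous_on_subset[OF continuous_on_grad[OF admissible_potential_smooth[OF assms]]]) auto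
  from compact_continuous_image[OF this compact_cball]
  have "bounded ((\<lambda>y. y \<bullet> grad V y - \<alpha> * (norm y)\<^sup>2) ` cball 0 R)"
    by (rule compact_imp_bounded)
  then obtain B where B: "B > 0" "\<And>y. y \<in> cball 0 R \<Longrightarrow> \<bar>y \<bullet> grad V y - \<alpha> * (norm y)\<^sup>2\<bar> \<le> B"
    by (auto simp: bounded_pos)
  have "y \<bullet> grad V y \<ge> \<alpha> * (norm y)\<^sup>2 - B" for y
    using B(2)[of y] aR(3)[of y] B(1) by (cases "norm y > R") (auto simp: abs_le_iff)
  then show thesis using that[of \<alpha> B] aR(1) B(1) by simp
qed

text \<open>For \<open>norm y > 2 * R\<close> the radial condition holds along the whole segment
  from \<open>(1/2) *\<^sub>R y\<close> to \<open>y\<close>, and the mean value theorem there gives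
  \<open>V y \<ge> \<alpha> / 4 * (norm y)\<^sup>2\<close>. In this form the energy controls the
  mean square of a solution.\<close>

lemma admissible_potential_quadratic_growth:
  assumes "admissible_potential V"
  obtains K where "K > 0" "\<And>y. (norm y)\<^sup>2 \<le> K * (V y + 1)"
proof -
  obtain \<alpha> R where aR: "\<alpha> > 0" "R > 0" "\<And>y. norm y > R \<Longrightarrow> y \<bullet> grad V y \<ge> \<alpha> * (norm y)\<^sup>2"
    using assms unfolding admissible_potential_def by blast
  note sm = admissible_potential_smooth[OF assms]
  note nonneg = admissible_potential_nonneg[OF assms]
  have far: "\<alpha> / 4 * (norm y)\<^sup>2 \<le> V y" if y: "norm y > 2 * R" for y
  proof -
    have "((\<lambda>t. V (0 + t *\<^sub>R y)) has_real_derivative grad V (0 + t *\<^sub>R y) \<bullet> y) (at t)" for t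
      using has_real_derivative_line[OF smooth_on_has_derivative[OF sm UNIV_I], where x = 0 and t = t and v = y]
      by (simp add: frechet_derivative_eq_grad[OF sm])
    then obtain z where z: "1/2 < z" "z < 1" "V (0 + 1 *\<^sub>R y) - V (0 + (1/2) *\<^sub>R y) = (1 - 1/2) * (grad V (0 + z *\<^sub>R y) \<bullet> y)"
      using MVT2[of "1/2" 1 "\<lambda>t. V (0 + t *\<^sub>R y)" "\<lambda>t. grad V (0 + t *\<^sub>R y) \<bullet> y"] by auto
    have "1/2 * norm y < z * norm y" using z y aR by (intro mult_strict_right_mono) auto
    then have "norm (z *\<^sub>R y) > R" using y z by simp
    then have "(z *\<^sub>R y) \<bullet> grad V (z *\<^sub>R y) \<ge> \<alpha> * (norm (z *\<^sub>R y))\<^sup>2" by (rule aR)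
    then have "z * (y \<bullet> grad V (z *\<^sub>R y)) \<ge> z * (\<alpha> * z * (norm y)\<^sup>2)"
      using z by (simp add: power_mult_distrib power2_eq_square algebra_simps)
    then have "y \<bullet> grad V (z *\<^sub>R y) \<ge> \<alpha> * z * (norm y)\<^sup>2" using z by (simp add: mult_le_cancel_left_pos)
    moreover have "\<alpha> * z * (norm y)\<^sup>2 \<ge> \<alpha> * (1/2) * (norm y)\<^sup>2"
      using z aR by (intro mult_right_mono mult_left_mono) auto
    ultimately show ?thesis using z(3) nonneg[of "(1/2) *\<^sub>R y"] by (simp add: inner_commute)
  qed
  define K where "K = 4 / \<alpha> + 4 * R\<^sup>2"
  have "(norm y)\<^sup>2 \<le> K * (V y + 1)" for y
  proof (cases "norm y > 2 * R")
    case True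
    have "(norm y)\<^sup>2 \<le> 4 / \<alpha> * V y" using far[OF True] aR(1) by (simp add: field_simps)
    also have "\<dots> \<le> K * (V y + 1)"
      using aR nonneg[of y] by (intro mult_mono) (auto simp: K_def)
    finally show ?thesis .
  next
    case False
    then have "(norm y)\<^sup>2 \<le> (2 * R)\<^sup>2" by (intro power_mono) auto
    also have "\<dots> \<le> K * 1" using aR by (simp add: K_def power_mult_distrib)
    also have "\<dots> \<le> K * (V y + 1)" using aR nonneg[of y] by (intro mult_left_mono) (auto simp: K_def)
    finally show ?thesis .
  qed
  then show thesis using that[of K] aR by (simp add: K_def add_pos_pos)
qed

text \<open>Positive definiteness at \<open>s\<close> persists as nonnegativity of the Hessian on a
  small ball. On a segment from \<open>s\<close> to \<open>y\<close> the derivative of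
  \<open>V\<close> therefore does not decrease, and it starts from zero because \<open>s\<close> is
  a minimum.\<close>

lemma admissible_potential_monotone_near_well:
  fixes V :: "'a::euclidean_space \<Rightarrow> real"
  assumes V: "admissible_potential V" and "V s = 0"
  obtains \<mu> where "\<mu> > 0" "\<And>y. y \<in> ball s \<mu> \<Longrightarrow> grad V y \<bullet> (y - s) \<ge> 0"
proof -
  note sm = admissible_potential_smooth[OF V]
  have pd: "second_deriv V s v v > 0" if "v \<noteq> 0" for v
    using V \<open>V s = 0\<close> that by (auto simp: admissible_potential_def hessian_pos_def_def)
  have "(\<lambda>v. second_deriv V s v v) = (\<lambda>v. \<Sum>i\<in>Basis. \<Sum>j\<in>Basis. (v \<bullet> i) * (v \<bullet> j) * second_deriv V s i j)"
    by (intro ext second_deriv_expand[OF sm])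
  moreover have "continuous_on (sphere 0 1) (\<lambda>v. \<Sum>i\<in>Basis. \<Sum>j\<in>Basis. (v \<bullet> i) * (v \<bullet> j) * second_deriv V s i j)"
    by (intro continuous_intros)
  ultimately have "continuous_on (sphere 0 1) (\<lambda>v. second_deriv V s v v)" by metis
  from continuous_attains_inf[OF compact_sphere _ this]
  obtain v0 where v0: "v0 \<in> sphere 0 1" "\<And>v. v \<in> sphere 0 1 \<Longrightarrow> second_deriv V s v0 v0 \<le> second_deriv V s v v"
    by fastforce
  \<comment> \<open>The least value of the Hessian form at \<open>s\<close> on the unit sphere. The
    function \<open>d\<close> below bounds the change of the form on unit vectors between
    \<open>s\<close> and \<open>y\<close>.\<close>
  define l where "l = second_deriv V s v0 v0"
  have "l > 0" using v0(1) unfolding l_def by (intro pd) auto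
  define d where "d y = (\<Sum>i\<in>Basis. \<Sum>j\<in>Basis. \<bar>second_deriv V y i j - second_deriv V s i j\<bar>)" for y
  have "continuous_on UNIV d"
    unfolding d_def by (intro continuous_intros smooth_on_continuous_second_derivative[OF sm])
  then have "open (d -` {..<l})" by (intro open_vimage) auto
  moreover have "s \<in> d -` {..<l}" using \<open>l > 0\<close> by (simp add: d_def)
  ultimately obtain \<mu> where \<mu>: "\<mu> > 0" "ball s \<mu> \<subseteq> d -` {..<l}"
    using open_contains_ball by blast
  have unit: "second_deriv V y v v \<ge> 0" if "y \<in> ball s \<mu>" "norm v = 1" for y v
  proof -
    have "second_deriv V s v v - second_deriv V y v v
        = (\<Sum>i\<in>Basis. \<Sum>j\<in>Basis. (v \<bullet> i) * (v \<bullet> j) * (second_deriv V s i j - second_deriv V y i j))"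
      using second_deriv_expand[OF sm, of s v v] second_deriv_expand[OF sm, of y v v]
      by (simp add: sum_subtractf algebra_simps)
    also have "\<dots> \<le> d y"
      unfolding d_def
    proof (intro sum_mono)
      fix i j :: 'a assume ij: "i \<in> Basis" "j \<in> Basis"
      have "\<bar>v \<bullet> i\<bar> * \<bar>v \<bullet> j\<bar> \<le> 1 * 1"
        using Basis_le_norm[OF ij(1), of v] Basis_le_norm[OF ij(2), of v] that(2) by (intro mult_mono) auto
      then have "\<bar>(v \<bullet> i) * (v \<bullet> j) * (second_deriv V s i j - second_deriv V y i j)\<bar>
          \<le> 1 * \<bar>second_deriv V s i j - second_deriv V y i j\<bar>"
        unfolding abs_mult by (intro mult_right_mono) auto
      from order_trans[OF abs_ge_self this]
      show "(v \<bullet> i) * (v \<bullet> j) * (second_deriv V s i j - second_deriv V y i j)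
          \<le> \<bar>second_deriv V y i j - second_deriv V s i j\<bar>"
        unfolding mult_1 by (subst abs_minus_commute)
    qed
    also have "d y < l" using that(1) \<mu>(2) by auto
    finally show ?thesis using v0(2)[of v] that(2) by (simp add: l_def)
  qed
  have hess: "second_deriv V y v v \<ge> 0" if y: "y \<in> ball s \<mu>" for y v
  proof (cases "v = 0")
    case True then show ?thesis using second_deriv_expand[OF sm, of y v v] by simp
  next
    case False
    define w where "w = v /\<^sub>R norm v"
    have v: "v = norm v *\<^sub>R w" using False by (simp add: w_def)
    have "second_deriv V y (norm v *\<^sub>R w) (norm v *\<^sub>R w)
        = (\<Sum>i\<in>Basis. \<Sum>j\<in>Basis. ((norm v *\<^sub>R w) \<bullet> i) * ((norm v *\<^sub>R w) \<bullet> j) * second_deriv V y i j)"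
      by (rule second_deriv_expand[OF sm])
    also have "\<dots> = (norm v)\<^sup>2 * (\<Sum>i\<in>Basis. \<Sum>j\<in>Basis. (w \<bullet> i) * (w \<bullet> j) * second_deriv V y i j)"
      by (simp add: sum_distrib_left power2_eq_square algebra_simps)
    also have "(\<Sum>i\<in>Basis. \<Sum>j\<in>Basis. (w \<bullet> i) * (w \<bullet> j) * second_deriv V y i j) = second_deriv V y w w"
      by (rule second_deriv_expand[OF sm, symmetric])
    finally have "second_deriv V y v v = (norm v)\<^sup>2 * second_deriv V y w w"
      unfolding v[symmetric] .
    then show ?thesis using unit[OF y, of w] False by (simp add: w_def)
  qed
  have "grad V y \<bullet> (y - s) \<ge> 0" if y: "y \<in> ball s \<mu>" for y
  proof -
    let ?v = "y - s"
    define h where "h t = frechet_derivative V (at (s + t *\<^sub>R ?v)) ?v" for t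
    have dV: "((\<lambda>t. V (s + t *\<^sub>R ?v)) has_real_derivative h t) (at t)" for t
      unfolding h_def by (rule has_real_derivative_line[OF smooth_on_has_derivative[OF sm UNIV_I]])
    have "h 0 = 0"
      using DERIV_local_min[OF dV[of 0], of 1] admissible_potential_nonneg[OF V] \<open>V s = 0\<close> by simp
    have "(h has_real_derivative second_deriv V (s + t *\<^sub>R ?v) ?v ?v) (at t)" for t
      unfolding h_def
      by (rule has_real_derivative_line[where g = "\<lambda>z. frechet_derivative V (at z) ?v"])
        (rule smooth_on_has_second_derivative[OF sm UNIV_I])
    then obtain z where z: "0 < z" "z < 1" "h 1 - h 0 = (1 - 0) * second_deriv V (s + z *\<^sub>R ?v) ?v ?v"
      using MVT2[of 0 1 h "\<lambda>t. second_deriv V (s + t *\<^sub>R ?v) ?v ?v"] by auto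
    have "z * norm ?v \<le> 1 * norm ?v" using z by (intro mult_right_mono) auto
    then have "s + z *\<^sub>R ?v \<in> ball s \<mu>" using y z by (simp add: dist_norm norm_minus_commute)
    then have "h 1 \<ge> 0" using hess z(3) \<open>h 0 = 0\<close> by simp
    then show ?thesis by (simp add: h_def frechet_derivative_eq_grad[OF sm])
  qed
  then show thesis using that \<mu>(1) by blast
qed

text \<open>Bounded points outside the open balls of radius \<open>\<mu>\<close> about the wells
  form a compact set without zeros of \<open>V\<close>, so the minimum there is positive.\<close>

lemma admissible_potential_bound_away_from_wells:
  assumes V: "admissible_potential V" and "\<mu> > 0"
  obtains c where "c > 0" "\<And>y. norm y \<le> K \<Longrightarrow> (\<And>s. V s = 0 \<Longrightarrow> dist s y \<ge> \<mu>) \<Longrightarrow> V y \<ge> c"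
proof -
  note sm = admissible_potential_smooth[OF V]
  define T where "T = cball 0 K \<inter> (- (\<Union>s\<in>{s. V s = 0}. ball s \<mu>))"
  have "compact T" unfolding T_def
    by (intro compact_Int_closed compact_cball closed_Compl open_UN) auto
  have cV: "continuous_on T V"
    using smooth_on_continuous[OF sm] continuous_on_subset by blast
  have T: "y \<in> T \<longleftrightarrow> norm y \<le> K \<and> (\<forall>s. V s = 0 \<longrightarrow> dist s y \<ge> \<mu>)" for y
    by (auto simp: T_def not_less)
  show thesis
  proof (cases "T = {}")
    case True then show ?thesis using that[of 1] T by auto
  next
    case False
    then obtain z where z: "z \<in> T" "\<And>y. y \<in> T \<Longrightarrow> V z \<le> V y"
      using continuous_attains_inf[OF \<open>compact T\<close> _ cV] by blast
    have "V z \<noteq> 0" using z(1) T[of z] \<open>\<mu> > 0\<close> by force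
    then have "V z > 0" using admissible_potential_nonneg[OF V, of z] by simp
    then show ?thesis using that[of "V z"] z(2) T by blast
  qed
qed

section \<open>Interior estimates\<close>

text \<open>What the estimates use of a single term of the sequence. Separating it from the limit
  setting allows constants to be quantified before \<open>\<Omega>\<close>,
  \<open>\<epsilon>\<close> and \<open>u\<close>.\<close>

definition solves_AC :: "('b::euclidean_space \<Rightarrow> real) \<Rightarrow> (real^2) set \<Rightarrow> real \<Rightarrow> (real^2 \<Rightarrow> 'b) \<Rightarrow> bool" where
  "solves_AC V \<Omega> \<epsilon> u \<longleftrightarrow> open \<Omega> \<and> \<epsilon> > 0 \<and> smooth_on u \<Omega> \<and>
     (\<forall>x\<in>\<Omega>. laplacian u x = (1 / \<epsilon>\<^sup>2) *\<^sub>R grad V (u x))"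

definition energy_le ::
  "('b::euclidean_space \<Rightarrow> real) \<Rightarrow> (real^2) set \<Rightarrow> real \<Rightarrow> (real^2 \<Rightarrow> 'b) \<Rightarrow> real \<Rightarrow> bool" where
  "energy_le V \<Omega> \<epsilon> u M \<longleftrightarrow>
     (\<integral>\<^sup>+x\<in>\<Omega>. ennreal (energy_density V \<epsilon> u x) \<partial>lborel) \<le> ennreal M"

lemma solves_ACD:
  assumes "solves_AC V \<Omega> \<epsilon> u"
  shows "open \<Omega>" "\<epsilon> > 0" "smooth_on u \<Omega>"
    "\<And>x. x \<in> \<Omega> \<Longrightarrow> laplacian u x = (1 / \<epsilon>\<^sup>2) *\<^sub>R grad V (u x)"
  using assms by (auto simp: solves_AC_def)

lemma energy_density_parts:
  assumes "admissible_potential V" "\<epsilon> > 0"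
  shows "energy_density V \<epsilon> u x \<ge> 0" "V (u x) / \<epsilon> \<le> energy_density V \<epsilon> u x"
    "\<epsilon> * grad_norm_sq u x \<le> 2 * energy_density V \<epsilon> u x"
proof -
  have "grad_norm_sq u x \<ge> 0" by (simp add: grad_norm_sq_def sum_nonneg)
  then show "energy_density V \<epsilon> u x \<ge> 0" "V (u x) / \<epsilon> \<le> energy_density V \<epsilon> u x"
    "\<epsilon> * grad_norm_sq u x \<le> 2 * energy_density V \<epsilon> u x"
    using assms admissible_potential_nonneg[OF assms(1), of "u x"] by (auto simp: energy_density_def)
qed

lemma continuous_on_potential_solution:
  assumes "admissible_potential V" "smooth_on u \<Omega>"
  shows "continuous_on \<Omega> (\<lambda>x. V (u x))"
  using continuous_on_compose2[OF smooth_on_continuous[OF admissible_potential_smooth[OF assms(1)]]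
      smooth_on_continuous[OF assms(2)]] by auto

lemma continuous_on_energy_density:
  assumes "admissible_potential V" "smooth_on u \<Omega>"
  shows "continuous_on \<Omega> (energy_density V \<epsilon> u)"
  unfolding energy_density_def[abs_def] grad_norm_sq_def
  by (intro continuous_on_add continuous_on_mult_left continuous_on_divide continuous_on_sum continuous_on_power
      continuous_on_norm continuous_on_const continuous_on_potential_solution[OF assms]
      smooth_on_continuous_derivative[OF assms(2)]) simp

lemma set_integral_energy_le:
  assumes V: "admissible_potential V" and u: "solves_AC V \<Omega> \<epsilon> u" and M: "energy_le V \<Omega> \<epsilon> u M" "M \<ge> 0"
    and K: "compact K" "K \<subseteq> \<Omega>"
  shows "set_integrable lborel K (energy_density V \<epsilon> u)"
    "set_lebesgue_integral lborel K (energy_density V \<epsilon> u) \<le> M"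
proof -
  note ud = solves_ACD[OF u]
  show int: "set_integrable lborel K (energy_density V \<epsilon> u)"
    unfolding set_integrable_def
    by (intro borel_integrable_compact K continuous_on_subset[OF continuous_on_energy_density[OF V ud(3)] K(2)])
  have nn: "energy_density V \<epsilon> u x \<ge> 0" for x using energy_density_parts[OF V ud(2)] by blast
  have "ennreal (set_lebesgue_integral lborel K (energy_density V \<epsilon> u))
      = (\<integral>\<^sup>+x\<in>K. ennreal (energy_density V \<epsilon> u x) \<partial>lborel)"
  proof -
    have "(\<integral>\<^sup>+x. ennreal (indicator K x *\<^sub>R energy_density V \<epsilon> u x) \<partial>lborel)
        = ennreal (integral\<^sup>L lborel (\<lambda>x. indicator K x *\<^sub>R energy_density V \<epsilon> u x))"
      using int nn by (intro nn_integral_eq_integral) (auto simp: set_integrable_def)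
    moreover have "ennreal (indicator K x *\<^sub>R energy_density V \<epsilon> u x) = ennreal (energy_density V \<epsilon> u x) * indicator K x" for x
      by (simp split: split_indicator)
    ultimately show ?thesis by (simp add: set_lebesgue_integral_def)
  qed
  also have "\<dots> \<le> (\<integral>\<^sup>+x\<in>\<Omega>. ennreal (energy_density V \<epsilon> u x) \<partial>lborel)"
    using K(2) by (intro nn_integral_mono) (auto simp: indicator_def)
  also have "\<dots> \<le> ennreal M" using M by (simp add: energy_le_def)
  finally show "set_lebesgue_integral lborel K (energy_density V \<epsilon> u) \<le> M"
    using M(2) by (simp add: ennreal_le_iff)
qed

text \<open>Provides the derivatives of the squared norm in the shape that the maximum principle and
  the mean value inequality take.\<close>

lemma laplacian_norm_square:
  assumes "smooth_on u \<Omega>"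
  defines "G \<equiv> \<lambda>x h. 2 * (u x \<bullet> frechet_derivative u (at x) h)"
    and "H \<equiv> \<lambda>i x h. 2 * (frechet_derivative u (at x) h \<bullet> frechet_derivative u (at x) i + u x \<bullet> second_deriv u x i h)"
  shows "x \<in> \<Omega> \<Longrightarrow> ((\<lambda>x. u x \<bullet> u x) has_derivative G x) (at x)"
    and "x \<in> \<Omega> \<Longrightarrow> ((\<lambda>y. G y i) has_derivative H i x) (at x)"
    and "continuous_on \<Omega> (\<lambda>x. H i x i)"
    and "(\<Sum>i\<in>Basis. H i x i) = 2 * grad_norm_sq u x + 2 * (u x \<bullet> laplacian u x)"
proof -
  note du = smooth_on_has_derivative[OF assms(1)] smooth_on_has_second_derivative[OF assms(1)]
  show "((\<lambda>x. u x \<bullet> u x) has_derivative G x) (at x)" if "x \<in> \<Omega>"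
    using has_derivative_inner[OF du(1)[OF that] du(1)[OF that]]
    by (simp add: G_def inner_commute)
  show "((\<lambda>y. G y i) has_derivative H i x) (at x)" if "x \<in> \<Omega>"
    using has_derivative_mult_right[OF has_derivative_inner[OF du(1)[OF that] du(2)[OF that, of i]], of 2]
    by (simp add: G_def H_def add.commute)
  show "continuous_on \<Omega> (\<lambda>x. H i x i)"
    unfolding H_def
    by (intro continuous_intros smooth_on_continuous_derivative smooth_on_continuous_second_derivative
        smooth_on_continuous assms)
  show "(\<Sum>i\<in>Basis. H i x i) = 2 * grad_norm_sq u x + 2 * (u x \<bullet> laplacian u x)"
    by (simp add: H_def grad_norm_sq_def laplacian_def sum.distrib sum_distrib_left inner_sum_right
        power2_norm_eq_inner distrib_left)
qed

text \<open>The equation turns the Laplacian into the radial derivative of the potential, and the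
  gradient term has a favourable sign.\<close>

lemma laplacian_norm_square_ge:
  assumes u: "solves_AC V \<Omega> \<epsilon> u" and x: "x \<in> \<Omega>"
    and rad: "\<And>y. y \<bullet> grad V y \<ge> \<alpha> * (norm y)\<^sup>2 - C"
  shows "2 * grad_norm_sq u x + 2 * (u x \<bullet> laplacian u x) \<ge> 2 / \<epsilon>\<^sup>2 * (\<alpha> * (u x \<bullet> u x) - C)"
proof -
  have "2 / \<epsilon>\<^sup>2 * (\<alpha> * (u x \<bullet> u x) - C) \<le> 2 / \<epsilon>\<^sup>2 * (u x \<bullet> grad V (u x))"
    using rad[of "u x"] by (intro mult_left_mono) (auto simp: power2_norm_eq_inner)
  also have "\<dots> = 2 * (u x \<bullet> laplacian u x)" using solves_ACD(4)[OF u x] by simp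
  also have "\<dots> \<le> 2 * grad_norm_sq u x + 2 * (u x \<bullet> laplacian u x)"
    by (simp add: grad_norm_sq_def sum_nonneg)
  finally show ?thesis .
qed

lemma integral_bump_pos: "integral (cbox (- One) One) (bump :: 'a::euclidean_space \<Rightarrow> real) > 0"
proof -
  have "integral (cbox (- One) One) (bump :: 'a \<Rightarrow> real) \<ge> 0"
    by (intro Henstock_Kurzweil_Integration.integral_nonneg integrable_continuous continuous_on_bump) (simp add: bump_def)
  moreover have "integral (cbox (- One) One) (bump :: 'a \<Rightarrow> real) \<noteq> 0"
  proof
    assume "integral (cbox (- One) One) (bump :: 'a \<Rightarrow> real) = 0"
    then have "bump (0 :: 'a) = 0"
      by (subst (asm) integral_cbox_eq_0_iff[OF continuous_on_bump])
        (auto simp: bump_def mem_box box_ne_empty dest: bspec[of _ _ 0])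
    then show False by (simp add: bump_def)
  qed
  ultimately show ?thesis by simp
qed

text \<open>The mean value inequality is applied to the squared norm at radius
  \<open>\<epsilon>\<close>. Its Laplacian is at least
  \<open>- (2 * C / \<epsilon>\<^sup>2)\<close>, so the error term is of order one. The average of
  the squared norm is controlled by that of \<open>V (u x)\<close>; the integral of the latter is at
  most \<open>\<epsilon> * M\<close>, and the change of scale in the plane divides it by
  \<open>\<epsilon>\<^sup>2\<close>.\<close>

lemma crude_sup_bound:
  fixes V :: "'b::euclidean_space \<Rightarrow> real"
  assumes V: "admissible_potential V" and "M \<ge> 0"
  obtains B where "B > 0"
    "\<And>\<Omega> \<epsilon> u x. solves_AC V \<Omega> \<epsilon> u \<Longrightarrow> \<epsilon> \<le> 1 \<Longrightarrow> energy_le V \<Omega> \<epsilon> u M \<Longrightarrow> cball x (2 * \<epsilon>) \<subseteq> \<Omega> \<Longrightarrow>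
       u x \<bullet> u x \<le> B / \<epsilon>"
proof -
  obtain \<alpha> C where aC: "\<alpha> > 0" "C \<ge> 0" "\<And>y. y \<bullet> grad V y \<ge> \<alpha> * (norm y)\<^sup>2 - C"
    using admissible_potential_radial_lower_bound[OF V] by blast
  obtain K where K: "K > 0" "\<And>y. (norm y)\<^sup>2 \<le> K * (V y + 1)"
    using admissible_potential_quadratic_growth[OF V] by blast
  let ?Q = "cbox (- One) One :: (real^2) set"
  define c1 where "c1 = integral ?Q bump"
  define c2 where "c2 = integral ?Q bump_potential"
  have c1: "c1 > 0" unfolding c1_def by (rule integral_bump_pos)
  have c2: "c2 \<ge> 0" unfolding c2_def
    by (intro Henstock_Kurzweil_Integration.integral_nonneg integrable_continuous continuous_on_bump_potential) (simp add: bump_potential_def)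
  define q where "q = measure lborel ?Q"
  have q: "q \<ge> 0" unfolding q_def by (rule measure_nonneg)
  \<comment> \<open>The energy contribution, the constant of the growth bound integrated over the
    box, and the error of the mean value inequality. The last two are of order one and are put over
    \<open>\<epsilon>\<close> by \<open>\<epsilon> \<le> 1\<close>; the 1 keeps \<open>B\<close>
    positive.\<close>
  define B where "B = (K * M + K * q + 2 * C * c2 + 1) / c1"
  have "B > 0" unfolding B_def using K c1 c2 aC q \<open>M \<ge> 0\<close>
    by (intro divide_pos_pos add_nonneg_pos add_nonneg_nonneg mult_nonneg_nonneg) auto
  moreover have "u x \<bullet> u x \<le> B / \<epsilon>"
    if u: "solves_AC V \<Omega> \<epsilon> u" and e1: "\<epsilon> \<le> 1" and E: "energy_le V \<Omega> \<epsilon> u M" and sub: "cball x (2 * \<epsilon>) \<subseteq> \<Omega>"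
    for \<Omega> \<epsilon> u x
  proof -
    note ud = solves_ACD[OF u]
    note L = laplacian_norm_square[OF ud(3)]
    have inO: "x + \<epsilon> *\<^sub>R y \<in> \<Omega>" if "y \<in> ?Q" for y
    proof -
      have "norm (\<epsilon> *\<^sub>R y) \<le> \<epsilon> * 2"
        using norm_le_DIM[OF that] ud(2) by (simp add: mult_left_mono)
      then have "x + \<epsilon> *\<^sub>R y \<in> cball x (2 * \<epsilon>)" by (simp add: dist_norm)
      then show ?thesis using sub by blast
    qed
    have cu: "continuous_on ?Q (\<lambda>y. u (x + \<epsilon> *\<^sub>R y))"
      by (rule continuous_on_compose2[OF smooth_on_continuous[OF ud(3)]]) (auto intro!: continuous_intros inO)
    have cVu: "continuous_on ?Q (\<lambda>y. V (u (x + \<epsilon> *\<^sub>R y)))"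
      by (rule continuous_on_compose2[OF smooth_on_continuous[OF admissible_potential_smooth[OF V]] cu]) auto
    have "(u x \<bullet> u x) * c1 \<le> integral ?Q (\<lambda>y. (u (x + \<epsilon> *\<^sub>R y) \<bullet> u (x + \<epsilon> *\<^sub>R y)) * bump y) + (2 * C / \<epsilon>\<^sup>2) * \<epsilon>\<^sup>2 * c2"
      unfolding c1_def c2_def
    proof (rule mean_value_inequality[OF ud(1,2) _ _ L(1) L(2) L(3)])
      show "cball x (real DIM(real^2) * \<epsilon>) \<subseteq> \<Omega>" using sub by simp
      show "0 \<le> 2 * C / \<epsilon>\<^sup>2" using aC by simp
      fix z assume "z \<in> \<Omega>"
      have "- (2 * C / \<epsilon>\<^sup>2) \<le> 2 / \<epsilon>\<^sup>2 * (\<alpha> * (u z \<bullet> u z) - C)"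
        using aC ud(2) by (simp add: field_simps)
      also have "\<dots> \<le> 2 * grad_norm_sq u z + 2 * (u z \<bullet> laplacian u z)"
        by (rule laplacian_norm_square_ge[OF u \<open>z \<in> \<Omega>\<close> aC(3)])
      finally show "- (2 * C / \<epsilon>\<^sup>2) \<le> (\<Sum>i\<in>Basis. 2 * (frechet_derivative u (at z) i \<bullet> frechet_derivative u (at z) i + u z \<bullet> second_deriv u z i i))"
        unfolding L(4) .
    qed
    also have "(2 * C / \<epsilon>\<^sup>2) * \<epsilon>\<^sup>2 * c2 = 2 * C * c2" using ud(2) by simp
    also have "integral ?Q (\<lambda>y. (u (x + \<epsilon> *\<^sub>R y) \<bullet> u (x + \<epsilon> *\<^sub>R y)) * bump y)
        \<le> integral ?Q (\<lambda>y. K * (V (u (x + \<epsilon> *\<^sub>R y)) + 1))"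
    proof (rule integral_le)
      show "(\<lambda>y. (u (x + \<epsilon> *\<^sub>R y) \<bullet> u (x + \<epsilon> *\<^sub>R y)) * bump y) integrable_on ?Q"
        by (intro integrable_continuous continuous_intros cu continuous_on_bump)
      show "(\<lambda>y. K * (V (u (x + \<epsilon> *\<^sub>R y)) + 1)) integrable_on ?Q"
        by (intro integrable_continuous continuous_intros cVu)
      fix y assume "y \<in> ?Q"
      have "bump y \<le> 1" using power_le_one[of "max 0 (1 - y \<bullet> y)" 2] by (simp add: bump_def)
      then have "(u (x + \<epsilon> *\<^sub>R y) \<bullet> u (x + \<epsilon> *\<^sub>R y)) * bump y \<le> (u (x + \<epsilon> *\<^sub>R y) \<bullet> u (x + \<epsilon> *\<^sub>R y)) * 1"
        by (intro mult_left_mono) auto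
      also have "\<dots> \<le> K * (V (u (x + \<epsilon> *\<^sub>R y)) + 1)" using K(2) by (simp add: power2_norm_eq_inner)
      finally show "(u (x + \<epsilon> *\<^sub>R y) \<bullet> u (x + \<epsilon> *\<^sub>R y)) * bump y \<le> K * (V (u (x + \<epsilon> *\<^sub>R y)) + 1)" .
    qed
    also have "integral ?Q (\<lambda>y. K * (V (u (x + \<epsilon> *\<^sub>R y)) + 1)) = K * integral ?Q (\<lambda>y. V (u (x + \<epsilon> *\<^sub>R y))) + K * q"
      using cVu unfolding q_def by (simp add: Henstock_Kurzweil_Integration.integral_add integrable_continuous distrib_left continuous_intros)
    also have "integral ?Q (\<lambda>y. V (u (x + \<epsilon> *\<^sub>R y))) \<le> M / \<epsilon>"
    proof -
      define T where "T = (\<lambda>y. x + \<epsilon> *\<^sub>R y) ` ?Q"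
      have T: "compact T" "T \<subseteq> \<Omega>" unfolding T_def
        using inO by (auto intro!: compact_continuous_image continuous_intros)
      have intT: "set_integrable lborel T (\<lambda>z. V (u z))" unfolding set_integrable_def
        by (intro borel_integrable_compact T continuous_on_subset[OF continuous_on_potential_solution[OF V ud(3)] T(2)])
      have Tind: "indicator T (x + \<epsilon> *\<^sub>R y) = (indicator ?Q y :: real)" for y
        using ud(2) by (auto simp: T_def indicator_def)
      have "integral ?Q (\<lambda>y. V (u (x + \<epsilon> *\<^sub>R y))) = set_lebesgue_integral lborel ?Q (\<lambda>y. V (u (x + \<epsilon> *\<^sub>R y)))"
        by (rule set_borel_integral_eq_integral(2)[symmetric])
          (unfold set_integrable_def, intro borel_integrable_compact compact_cbox cVu)
      also have "\<dots> = integral\<^sup>L lborel (\<lambda>y. indicator T (x + \<epsilon> *\<^sub>R y) *\<^sub>R V (u (x + \<epsilon> *\<^sub>R y)))"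
        by (simp add: set_lebesgue_integral_def Tind)
      also have "\<dots> = (1 / \<epsilon>\<^sup>2) * set_lebesgue_integral lborel T (\<lambda>z. V (u z))"
      proof -
        define h where "h z = indicator T z *\<^sub>R V (u z)" for z
        have h: "h \<in> borel_measurable borel"
          using intT by (auto simp: set_integrable_def h_def[abs_def] dest: borel_measurable_integrable)
        have "integral\<^sup>L lborel h = integral\<^sup>L (density (distr lborel borel (\<lambda>y. x + \<epsilon> *\<^sub>R y)) (\<lambda>_. \<bar>\<epsilon>\<bar> ^ DIM(real^2))) h"
          using lborel_affine[of \<epsilon> x] ud(2) by simp
        also have "\<dots> = \<epsilon>\<^sup>2 * integral\<^sup>L lborel (\<lambda>y. h (x + \<epsilon> *\<^sub>R y))"
          using h ud(2) by (simp add: integral_density integral_distr)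
        finally show ?thesis using ud(2) by (simp add: set_lebesgue_integral_def h_def[abs_def])
      qed
      also have "set_lebesgue_integral lborel T (\<lambda>z. V (u z)) \<le> \<epsilon> * set_lebesgue_integral lborel T (energy_density V \<epsilon> u)"
      proof -
        have "set_lebesgue_integral lborel T (\<lambda>z. V (u z)) \<le> set_lebesgue_integral lborel T (\<lambda>z. \<epsilon> * energy_density V \<epsilon> u z)"
          using set_integral_energy_le[OF V u E \<open>M \<ge> 0\<close> T] intT energy_density_parts(2)[OF V ud(2), of u] ud(2)
          by (intro set_integral_mono) (auto simp: field_simps)
        then show ?thesis by simp
      qed
      also have "set_lebesgue_integral lborel T (energy_density V \<epsilon> u) \<le> M"
        by (rule set_integral_energy_le[OF V u E \<open>M \<ge> 0\<close> T])
      finally show ?thesis using ud(2) by (simp add: power2_eq_square field_simps)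
    qed
    finally have "(u x \<bullet> u x) * c1 \<le> K * (M / \<epsilon>) + K * q + 2 * C * c2"
      using K(1) by simp
    also have "\<dots> \<le> (K * M + K * q + 2 * C * c2 + 1) / \<epsilon>"
    proof -
      have "K * q + 2 * C * c2 \<le> (K * q + 2 * C * c2 + 1) / \<epsilon>"
      proof -
        have "(K * q + 2 * C * c2) * \<epsilon> \<le> (K * q + 2 * C * c2) * 1"
          using K c2 aC e1 q by (intro mult_left_mono add_nonneg_nonneg mult_nonneg_nonneg) auto
        then show ?thesis using ud(2) by (simp add: field_simps)
      qed
      then show ?thesis using ud(2) by (simp add: add_divide_distrib)
    qed
    finally show ?thesis using c1 ud(2) by (simp add: B_def field_simps)
  qed
  ultimately show thesis using that by blast
qed

text \<open>The square \<open>f\<close> of the norm of a solution has Laplacian at least \<open>2 / \<epsilon>\<^sup>2 * (\<alpha> * f - C)\<close>, and against this a quadratic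
  barrier reaching the crude bound \<open>B / \<epsilon>\<close> on the boundary wins for small \<open>\<epsilon>\<close>.\<close>

lemma sup_bound:
  fixes V :: "'b::euclidean_space \<Rightarrow> real"
  assumes V: "admissible_potential V" and "M \<ge> 0"
  obtains L where "L > 0"
    "\<And>\<rho>. \<rho> > 0 \<Longrightarrow> \<exists>e0>0. \<forall>\<Omega> \<epsilon> u x. solves_AC V \<Omega> \<epsilon> u \<and> \<epsilon> < e0 \<and> energy_le V \<Omega> \<epsilon> u M \<and> cball x (2 * \<rho>) \<subseteq> \<Omega> \<longrightarrow>
       norm (u x) \<le> L"
proof -
  obtain \<alpha> C where aC: "\<alpha> > 0" "C \<ge> 0" "\<And>y. y \<bullet> grad V y \<ge> \<alpha> * (norm y)\<^sup>2 - C"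
    using admissible_potential_radial_lower_bound[OF V] by blast
  obtain B where B: "B > 0"
    "\<And>\<Omega> \<epsilon> u x. solves_AC V \<Omega> \<epsilon> u \<Longrightarrow> \<epsilon> \<le> 1 \<Longrightarrow> energy_le V \<Omega> \<epsilon> u M \<Longrightarrow> cball x (2 * \<epsilon>) \<subseteq> \<Omega> \<Longrightarrow>
       u x \<bullet> u x \<le> B / \<epsilon>"
    using crude_sup_bound[OF V \<open>M \<ge> 0\<close>] by blast
  \<comment> \<open>Above the level \<open>L'\<close> the Laplacian of the squared norm exceeds
    \<open>2 / \<epsilon>\<^sup>2 * \<alpha>\<close>, because
    \<open>\<alpha> * L' - C = \<alpha>\<close>.\<close>
  define L' where "L' = C / \<alpha> + 1"
  have "L' > 0" using aC by (simp add: L'_def add_nonneg_pos)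
  \<comment> \<open>Of the three upper bounds on \<open>\<epsilon>\<close>, \<open>1\<close> and
    \<open>\<rho> / 2\<close> make the crude bound available on \<open>cball x0 \<rho>\<close>; the
    third keeps the Laplacian \<open>4 * k\<close> of the barrier below the level just
    described.\<close>
  have "norm (u x) \<le> sqrt L'"
    if "\<rho> > 0" and u: "solves_AC V \<Omega> \<epsilon> u" and e: "\<epsilon> < min (min 1 (\<rho> / 2)) (\<alpha> * \<rho>\<^sup>2 / (2 * B))"
      and E: "energy_le V \<Omega> \<epsilon> u M" and sub: "cball x0 (2 * \<rho>) \<subseteq> \<Omega>" and "x = x0"
    for \<rho> \<Omega> \<epsilon> u x x0
  proof -
    note ud = solves_ACD[OF u]
    note Lp = laplacian_norm_square[OF ud(3)]
    define k where "k = B / (\<epsilon> * \<rho>\<^sup>2)"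
    have k: "k * \<rho>\<^sup>2 = B / \<epsilon>" using \<open>\<rho> > 0\<close> by (simp add: k_def)
    define g where "g x = u x \<bullet> u x - (L' + k * ((x - x0) \<bullet> (x - x0)))" for x
    define G where "G x h = 2 * (u x \<bullet> frechet_derivative u (at x) h) - k * (2 * ((x - x0) \<bullet> h))" for x h
    define H where "H i x h = 2 * (frechet_derivative u (at x) h \<bullet> frechet_derivative u (at x) i + u x \<bullet> second_deriv u x i h)
        - k * (2 * (h \<bullet> i))" for i x h
    have inO: "cball x0 \<rho> \<subseteq> \<Omega>" using sub \<open>\<rho> > 0\<close> by (auto simp: subset_iff)
    have crude: "u y \<bullet> u y \<le> B / \<epsilon>" if "y \<in> cball x0 \<rho>" for y
    proof (rule B(2)[OF u _ E])
      show "\<epsilon> \<le> 1" using e by simp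
      show "cball y (2 * \<epsilon>) \<subseteq> \<Omega>"
      proof
        fix z assume "z \<in> cball y (2 * \<epsilon>)"
        then have "dist x0 z \<le> 2 * \<rho>" using that e dist_triangle[of x0 z y] by simp
        then show "z \<in> \<Omega>" using sub by auto
      qed
    qed
    have "g x0 \<le> 0"
    proof (rule strict_subsolution_nonpos[of "cball x0 \<rho>" "ball x0 \<rho>" g G H])
      show "continuous_on (cball x0 \<rho>) g" unfolding g_def
        by (intro continuous_intros continuous_on_subset[OF smooth_on_continuous[OF ud(3)] inO])
      show "g x \<le> 0" if "x \<in> cball x0 \<rho> - ball x0 \<rho>" for x
      proof -
        have "norm (x - x0) = \<rho>" using that by (auto simp: dist_norm norm_minus_commute)
        then have "(x - x0) \<bullet> (x - x0) = \<rho>\<^sup>2" by (metis power2_norm_eq_inner)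
        then show ?thesis using crude[of x] that k \<open>L' > 0\<close> by (simp add: g_def)
      qed
      show "(g has_derivative G x) (at x)" if "x \<in> ball x0 \<rho>" for x
      proof -
        have "x \<in> \<Omega>" using that inO by auto
        have "((\<lambda>x. L' + k * ((x - x0) \<bullet> (x - x0))) has_derivative (\<lambda>h. k * (2 * ((x - x0) \<bullet> h)))) (at x)"
          by (auto intro!: derivative_eq_intros simp: inner_commute algebra_simps)
        from has_derivative_diff[OF Lp(1)[OF \<open>x \<in> \<Omega>\<close>] this] show ?thesis
          unfolding g_def G_def .
      qed
      show "((\<lambda>y. G y i) has_derivative H i x) (at x)" if "x \<in> ball x0 \<rho>" for x i
      proof -
        have "x \<in> \<Omega>" using that inO by auto
        have "((\<lambda>x. k * (2 * ((x - x0) \<bullet> i))) has_derivative (\<lambda>h. k * (2 * (h \<bullet> i)))) (at x)"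
          by (auto intro!: derivative_eq_intros)
        from has_derivative_diff[OF Lp(2)[OF \<open>x \<in> \<Omega>\<close>] this] show ?thesis
          unfolding G_def H_def .
      qed
      show "(\<Sum>i\<in>Basis. H i x i) > 0" if x: "x \<in> ball x0 \<rho>" and "g x > 0" for x
      proof -
        have "x \<in> \<Omega>" using x inO by auto
        have "k * ((x - x0) \<bullet> (x - x0)) \<ge> 0" using B(1) ud(2) by (simp add: k_def)
        then have "u x \<bullet> u x > L'" using \<open>g x > 0\<close> by (simp add: g_def)
        then have "\<alpha> * (u x \<bullet> u x) - C > \<alpha>" using aC by (simp add: L'_def field_simps)
        then have "2 / \<epsilon>\<^sup>2 * \<alpha> < 2 / \<epsilon>\<^sup>2 * (\<alpha> * (u x \<bullet> u x) - C)"
          using ud(2) by (intro mult_strict_left_mono) auto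
        also have "\<dots> \<le> 2 * grad_norm_sq u x + 2 * (u x \<bullet> laplacian u x)"
          by (rule laplacian_norm_square_ge[OF u \<open>x \<in> \<Omega>\<close> aC(3)])
        also have "\<dots> = (\<Sum>i\<in>Basis. H i x i) + 4 * k"
          unfolding Lp(4)[symmetric] H_def by (simp add: sum_subtractf)
        finally have "2 / \<epsilon>\<^sup>2 * \<alpha> < (\<Sum>i\<in>Basis. H i x i) + 4 * k" .
        moreover have "4 * k \<le> 2 / \<epsilon>\<^sup>2 * \<alpha>"
        proof -
          have "\<epsilon> * (2 * B) < \<alpha> * \<rho>\<^sup>2" using e B(1) by (simp add: field_simps)
          then have "4 * B * \<epsilon> \<le> 2 * \<alpha> * \<rho>\<^sup>2" by (simp add: mult.commute mult.left_commute)
          then have "4 * B * \<epsilon> / (\<epsilon>\<^sup>2 * \<rho>\<^sup>2) \<le> 2 * \<alpha> * \<rho>\<^sup>2 / (\<epsilon>\<^sup>2 * \<rho>\<^sup>2)" by (intro divide_right_mono) auto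
          then show ?thesis using ud(2) \<open>\<rho> > 0\<close> by (simp add: k_def power2_eq_square)
        qed
        ultimately show ?thesis by simp
      qed
    qed (use \<open>\<rho> > 0\<close> in auto)
    then have "u x0 \<bullet> u x0 \<le> L'" by (simp add: g_def)
    then show ?thesis using \<open>x = x0\<close> by (simp add: norm_eq_sqrt_inner)
  qed
  then have "\<exists>e0>0. \<forall>\<Omega> \<epsilon> u x. solves_AC V \<Omega> \<epsilon> u \<and> \<epsilon> < e0 \<and> energy_le V \<Omega> \<epsilon> u M \<and> cball x (2 * \<rho>) \<subseteq> \<Omega> \<longrightarrow>
       norm (u x) \<le> sqrt L'" if "\<rho> > 0" for \<rho>
    using that aC(1) B(1) by (intro exI[of _ "min (min 1 (\<rho> / 2)) (\<alpha> * \<rho>\<^sup>2 / (2 * B))"]) auto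
  then show thesis using that[of "sqrt L'"] \<open>L' > 0\<close> by auto
qed

text \<open>The half-ball estimate at radius \<open>\<epsilon>\<close>, applied to the scalar
  component of \<open>u\<close> along the derivative in question. The equation makes the Laplacian
  of order \<open>1 / \<epsilon>\<^sup>2\<close>, so both terms of the estimate scale like
  \<open>1 / \<epsilon>\<close>.\<close>

lemma gradient_bound_of_sup_bound:
  assumes u: "solves_AC V \<Omega> \<epsilon> u" and sub: "cball x \<epsilon> \<subseteq> \<Omega>" and j: "j \<in> Basis"
    and L: "\<And>z. z \<in> cball x \<epsilon> \<Longrightarrow> norm (u z) \<le> L"
    and N: "\<And>y. norm y \<le> L \<Longrightarrow> norm (grad V y) \<le> N"
  shows "norm (frechet_derivative u (at x) j) \<le> (2 * L + N / 2) / \<epsilon>"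
proof -
  note ud = solves_ACD[OF u]
  define v where "v = frechet_derivative u (at x) j"
  \<comment> \<open>If \<open>v = 0\<close>, division by the zero norm gives \<open>b = 0\<close>,
    so \<open>norm b \<le> 1\<close> holds in every case.\<close>
  define b where "b = v /\<^sub>R norm v"
  have "norm (u x) \<le> L" using L[of x] ud(2) by simp
  then have "L \<ge> 0" using norm_ge_zero[of "u x"] by linarith
  have "norm (grad V 0) \<le> N" using N[of 0] \<open>L \<ge> 0\<close> by simp
  then have "N \<ge> 0" using norm_ge_zero[of "grad V 0"] by linarith
  have "norm b \<le> 1" by (cases "v = 0") (auto simp: b_def)
  have "frechet_derivative u (at x) j \<bullet> b \<le> real DIM(real^2) * L / \<epsilon> + N / \<epsilon>\<^sup>2 * \<epsilon> / 2"
  proof (rule gradient_estimate_half_ball[OF ud(1) sub ud(2) \<open>L \<ge> 0\<close> j, where w = "\<lambda>x. u x \<bullet> b"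
        and W = "\<lambda>x h. frechet_derivative u (at x) h \<bullet> b" and H = "\<lambda>i x h. second_deriv u x i h \<bullet> b"])
    show "((\<lambda>x. u x \<bullet> b) has_derivative (\<lambda>h. frechet_derivative u (at z) h \<bullet> b)) (at z)" if "z \<in> \<Omega>" for z
      by (intro has_derivative_inner_left smooth_on_has_derivative[OF ud(3) that])
    show "((\<lambda>y. frechet_derivative u (at y) i \<bullet> b) has_derivative (\<lambda>h. second_deriv u z i h \<bullet> b)) (at z)" if "z \<in> \<Omega>" for z i
      by (intro has_derivative_inner_left smooth_on_has_second_derivative[OF ud(3) that])
    show "\<bar>u z \<bullet> b\<bar> \<le> L" if "z \<in> cball x \<epsilon>" for z
    proof -
      have "\<bar>u z \<bullet> b\<bar> \<le> norm (u z) * norm b" by (rule Cauchy_Schwarz_ineq2)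
      also have "\<dots> \<le> L * 1" using L[OF that] \<open>norm b \<le> 1\<close> \<open>L \<ge> 0\<close> by (intro mult_mono) auto
      finally show ?thesis by simp
    qed
    show "\<bar>\<Sum>i\<in>Basis. second_deriv u z i i \<bullet> b\<bar> \<le> N / \<epsilon>\<^sup>2" if z: "z \<in> cball x \<epsilon>" for z
    proof -
      have "(\<Sum>i\<in>Basis. second_deriv u z i i \<bullet> b) = (grad V (u z) \<bullet> b) / \<epsilon>\<^sup>2"
        using ud(4)[of z] sub z by (auto simp: laplacian_def inner_sum_left[symmetric])
      moreover have "\<bar>grad V (u z) \<bullet> b\<bar> \<le> N * 1"
        using N[OF L[OF z]] \<open>norm b \<le> 1\<close> \<open>N \<ge> 0\<close>
        by (intro order_trans[OF Cauchy_Schwarz_ineq2] mult_mono) auto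
      ultimately show ?thesis using ud(2) by (simp add: divide_right_mono)
    qed
  qed
  moreover have "v \<bullet> b = norm v"
    by (cases "v = 0") (auto simp: b_def power2_norm_eq_inner[symmetric] power2_eq_square)
  ultimately show ?thesis using ud(2) by (simp add: v_def power2_eq_square field_simps)
qed

text \<open>The radius \<open>3 * \<rho>\<close> leaves room for the sup bound, which asks for
  \<open>2 * \<rho>\<close>, at every point of \<open>cball x \<epsilon>\<close> with
  \<open>\<epsilon> < \<rho>\<close>; on that small disc the gradient bound then applies.\<close>

lemma interior_estimates:
  fixes V :: "'b::euclidean_space \<Rightarrow> real"
  assumes V: "admissible_potential V" and "M \<ge> 0" "\<rho> > 0"
  obtains L G e0 where "L > 0" "G > 0" "e0 > 0"
    "\<And>\<Omega> \<epsilon> u x. solves_AC V \<Omega> \<epsilon> u \<Longrightarrow> \<epsilon> < e0 \<Longrightarrow> energy_le V \<Omega> \<epsilon> u M \<Longrightarrow> cball x (3 * \<rho>) \<subseteq> \<Omega> \<Longrightarrow>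
       norm (u x) \<le> L \<and> grad_norm_sq u x \<le> (G / \<epsilon>)\<^sup>2"
proof -
  obtain L where L: "L > 0" "\<exists>e0>0. \<forall>\<Omega> \<epsilon> u x. solves_AC V \<Omega> \<epsilon> u \<and> \<epsilon> < e0 \<and> energy_le V \<Omega> \<epsilon> u M \<and> cball x (2 * \<rho>) \<subseteq> \<Omega> \<longrightarrow>
       norm (u x) \<le> L"
    using sup_bound[OF V \<open>M \<ge> 0\<close>] \<open>\<rho> > 0\<close> by metis
  then obtain e0 where e0: "e0 > 0" "\<And>\<Omega> \<epsilon> u x. solves_AC V \<Omega> \<epsilon> u \<Longrightarrow> \<epsilon> < e0 \<Longrightarrow> energy_le V \<Omega> \<epsilon> u M \<Longrightarrow> cball x (2 * \<rho>) \<subseteq> \<Omega> \<Longrightarrow>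
       norm (u x) \<le> L" by blast
  have "bounded (grad V ` cball 0 L)"
    by (intro compact_imp_bounded compact_continuous_image compact_cball
        continuous_on_subset[OF continuous_on_grad[OF admissible_potential_smooth[OF V]]]) auto
  then obtain N where N: "N > 0" "\<And>y. norm y \<le> L \<Longrightarrow> norm (grad V y) \<le> N"
    by (auto simp: bounded_pos)
  \<comment> \<open>The plane contributes two squares with the same bound; their sum is at most four
    times that bound, hence the factor 2 inside the square.\<close>
  define G where "G = 2 * (2 * L + N / 2)"
  have "norm (u x) \<le> L \<and> grad_norm_sq u x \<le> (G / \<epsilon>)\<^sup>2"
    if u: "solves_AC V \<Omega> \<epsilon> u" and e: "\<epsilon> < min e0 \<rho>" and E: "energy_le V \<Omega> \<epsilon> u M" and sub: "cball x (3 * \<rho>) \<subseteq> \<Omega>"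
    for \<Omega> \<epsilon> u x
  proof
    note ud = solves_ACD[OF u]
    have near: "norm (u z) \<le> L" if "z \<in> cball x \<epsilon>" for z
    proof (rule e0(2)[OF u _ E])
      show "cball z (2 * \<rho>) \<subseteq> \<Omega>"
      proof
        fix y assume "y \<in> cball z (2 * \<rho>)"
        then have "dist x y \<le> 3 * \<rho>" using that e dist_triangle[of x y z] by simp
        then show "y \<in> \<Omega>" using sub by auto
      qed
    qed (use e in simp)
    then show "norm (u x) \<le> L" using ud(2) by simp
    have "cball x \<epsilon> \<subseteq> \<Omega>" using sub e \<open>\<rho> > 0\<close> by (auto simp: subset_iff)
    then have "norm (frechet_derivative u (at x) j) \<le> (2 * L + N / 2) / \<epsilon>" if "j \<in> Basis" for j
      using gradient_bound_of_sup_bound[OF u _ that near N(2)] by blast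
    then have "grad_norm_sq u x \<le> (\<Sum>i\<in>(Basis :: (real^2) set). ((2 * L + N / 2) / \<epsilon>)\<^sup>2)"
      unfolding grad_norm_sq_def by (intro sum_mono power_mono) auto
    also have "\<dots> \<le> 4 * ((2 * L + N / 2) / \<epsilon>)\<^sup>2" by simp
    also have "\<dots> = (G / \<epsilon>)\<^sup>2" unfolding G_def power_divide power_mult_distrib by simp
    finally show "grad_norm_sq u x \<le> (G / \<epsilon>)\<^sup>2" .
  qed
  then show thesis
    using that[of L G "min e0 \<rho>"] L(1) N(1) e0(1) \<open>\<rho> > 0\<close> by (auto simp: G_def)
qed

section \<open>The Pohozaev inequality\<close>

text \<open>A continuously differentiable transition from 0 on \<open>t \<le> 0\<close> to 1 on
  \<open>t \<ge> 1\<close>. The inner cube smooths the left end and the outer cube the right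
  end.\<close>

definition step :: "real \<Rightarrow> real" where
  "step t = 1 - (max 0 (1 - (max 0 t) ^ 3)) ^ 3"

definition step_deriv :: "real \<Rightarrow> real" where
  "step_deriv t = 9 * (max 0 (1 - (max 0 t) ^ 3))\<^sup>2 * (max 0 t)\<^sup>2"

lemma has_real_derivative_step: "(step has_real_derivative step_deriv t) (at t)"
proof -
  have 1: "((\<lambda>t. 1 - (max 0 t) ^ 3) has_real_derivative - (3 * (max 0 t)\<^sup>2)) (at t)"
    using DERIV_diff[OF DERIV_const has_real_derivative_max0_power3, of 1] by simp
  have "((\<lambda>t. (max 0 (1 - (max 0 t) ^ 3)) ^ 3) has_real_derivative
      3 * (max 0 (1 - (max 0 t) ^ 3))\<^sup>2 * (- (3 * (max 0 t)\<^sup>2))) (at t)"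
    using DERIV_chain2[OF has_real_derivative_max0_power3 1] .
  from DERIV_diff[OF DERIV_const this, of 1] show ?thesis
    unfolding step_def[abs_def] step_deriv_def by (simp add: mult.assoc)
qed

lemma continuous_on_step_deriv: "continuous_on S step_deriv"
  unfolding step_deriv_def[abs_def] by (intro continuous_intros)

lemma step_bounds:
  "0 \<le> step t" "step t \<le> 1" "t \<ge> 1 \<Longrightarrow> step t = 1" "t \<le> 0 \<Longrightarrow> step t = 0"
  "0 \<le> step_deriv t" "step_deriv t \<le> 9" "t \<ge> 1 \<or> t \<le> 0 \<Longrightarrow> step_deriv t = 0"
proof -
  have *: "max 0 (1 - (max 0 t) ^ 3) = 0" if "t \<ge> 1" for t :: real
    using one_le_power[OF that, of 3] that by simp
  have le1: "max 0 (1 - (max 0 t) ^ 3) \<le> 1" by simp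
  show "0 \<le> step t" unfolding step_def using power_le_one[OF _ le1, of 3] by simp
  show "step t \<le> 1" unfolding step_def by simp
  show "t \<ge> 1 \<Longrightarrow> step t = 1" by (simp only: step_def *) simp
  show "t \<le> 0 \<Longrightarrow> step t = 0" by (simp add: step_def)
  show "0 \<le> step_deriv t" by (simp add: step_deriv_def)
  show 0: "t \<ge> 1 \<or> t \<le> 0 \<Longrightarrow> step_deriv t = 0"
    using * by (auto simp: step_deriv_def)
  show "step_deriv t \<le> 9"
  proof (cases "t \<ge> 1")
    case True then show ?thesis using 0 by simp
  next
    case False
    then have "(max 0 (1 - (max 0 t) ^ 3))\<^sup>2 * (max 0 t)\<^sup>2 \<le> 1 * 1"
      by (intro mult_mono power_le_one) auto
    then show ?thesis by (simp add: step_deriv_def)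
  qed
qed

text \<open>A function of the squared distance, so that it is differentiable at the centre and its
  gradient needs no division by the norm.\<close>

definition cutoff :: "real \<Rightarrow> real \<Rightarrow> 'a::euclidean_space \<Rightarrow> 'a \<Rightarrow> real" where
  "cutoff a b p x = step ((b\<^sup>2 - (x - p) \<bullet> (x - p)) / (b\<^sup>2 - a\<^sup>2))"

text \<open>Normalised so that the gradient of \<open>cutoff a b p\<close> is
  \<open>- cutoff_slope a b p x *\<^sub>R (x - p)\<close>; the factor 2 comes from the squared
  distance.\<close>

definition cutoff_slope :: "real \<Rightarrow> real \<Rightarrow> 'a::euclidean_space \<Rightarrow> 'a \<Rightarrow> real" where
  "cutoff_slope a b p x = step_deriv ((b\<^sup>2 - (x - p) \<bullet> (x - p)) / (b\<^sup>2 - a\<^sup>2)) * (2 / (b\<^sup>2 - a\<^sup>2))"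

lemma has_derivative_cutoff:
  "(cutoff a b p has_derivative (\<lambda>h. - cutoff_slope a b p x * ((x - p) \<bullet> h))) (at x)"
proof -
  let ?d = "b\<^sup>2 - a\<^sup>2"
  have "((\<lambda>x. (1 / ?d) * (b\<^sup>2 - (x - p) \<bullet> (x - p))) has_derivative (\<lambda>h. (1 / ?d) * (- 2 * ((x - p) \<bullet> h)))) (at x)"
    by (intro has_derivative_mult_right) (auto intro!: derivative_eq_intros simp: inner_commute)
  then have "((\<lambda>x. (b\<^sup>2 - (x - p) \<bullet> (x - p)) / ?d) has_derivative (\<lambda>h. - 2 * ((x - p) \<bullet> h) / ?d)) (at x)"
    by simp
  from has_derivative_compose[OF this has_real_derivative_step[unfolded has_field_derivative_def]]
  show ?thesis unfolding cutoff_def[abs_def] cutoff_slope_def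
    by (auto elim!: has_derivative_eq_rhs simp: fun_eq_iff)
qed

lemma continuous_on_cutoff: "continuous_on S (cutoff a b p)"
  by (intro continuous_at_imp_continuous_on ballI has_derivative_continuous[OF has_derivative_cutoff])

lemma continuous_on_cutoff_slope: "continuous_on S (cutoff_slope a b p)"
proof -
  have "continuous_on S (\<lambda>x. (1 / (b\<^sup>2 - a\<^sup>2)) * (b\<^sup>2 - (x - p) \<bullet> (x - p)))"
    by (intro continuous_intros)
  then have "continuous_on S (\<lambda>x. (b\<^sup>2 - (x - p) \<bullet> (x - p)) / (b\<^sup>2 - a\<^sup>2))" by simp
  from continuous_on_compose2[OF continuous_on_step_deriv[of UNIV] this subset_UNIV] show ?thesis
    unfolding cutoff_slope_def[abs_def] by (intro continuous_on_mult_right)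
qed

lemma cutoff_bounds:
  assumes "0 < a" "a < b"
  shows "0 \<le> cutoff a b p x" "cutoff a b p x \<le> 1"
    "dist p x \<le> a \<Longrightarrow> cutoff a b p x = 1" "dist p x \<ge> b \<Longrightarrow> cutoff a b p x = 0"
    "0 \<le> cutoff_slope a b p x" "cutoff_slope a b p x \<le> 18 / (b\<^sup>2 - a\<^sup>2)"
    "dist p x \<le> a \<or> dist p x \<ge> b \<Longrightarrow> cutoff_slope a b p x = 0"
proof -
  have d: "b\<^sup>2 - a\<^sup>2 > 0" using assms by (simp add: power_strict_mono)
  have n: "(x - p) \<bullet> (x - p) = (dist p x)\<^sup>2"
    by (metis dist_commute dist_norm power2_norm_eq_inner)
  have 1: "(b\<^sup>2 - (x - p) \<bullet> (x - p)) / (b\<^sup>2 - a\<^sup>2) \<ge> 1" if "dist p x \<le> a"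
    using power_mono[OF that, of 2] d by (simp add: n)
  have 2: "(b\<^sup>2 - (x - p) \<bullet> (x - p)) / (b\<^sup>2 - a\<^sup>2) \<le> 0" if "dist p x \<ge> b"
    using power_mono[OF that, of 2] d assms by (simp add: n divide_le_0_iff)
  show "0 \<le> cutoff a b p x" "cutoff a b p x \<le> 1" by (simp_all add: cutoff_def step_bounds)
  show "cutoff a b p x = 1" if "dist p x \<le> a"
    unfolding cutoff_def by (rule step_bounds(3)[OF 1[OF that]])
  show "cutoff a b p x = 0" if "dist p x \<ge> b"
    unfolding cutoff_def by (rule step_bounds(4)[OF 2[OF that]])
  show "0 \<le> cutoff_slope a b p x" using d by (simp add: cutoff_slope_def step_bounds)
  have "cutoff_slope a b p x \<le> 9 * (2 / (b\<^sup>2 - a\<^sup>2))"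
    unfolding cutoff_slope_def using d by (intro mult_right_mono step_bounds) auto
  then show "cutoff_slope a b p x \<le> 18 / (b\<^sup>2 - a\<^sup>2)" by simp
  show "cutoff_slope a b p x = 0" if "dist p x \<le> a \<or> dist p x \<ge> b"
    unfolding cutoff_slope_def using that 1 2 by (auto simp: step_bounds(7))
qed

lemma set_integrable_continuous_compact:
  fixes f :: "'a::euclidean_space \<Rightarrow> real"
  assumes "continuous_on U f" "compact K" "K \<subseteq> U"
  shows "set_integrable lborel K f"
  unfolding set_integrable_def
  by (intro borel_integrable_compact assms continuous_on_subset[OF assms(1,3)])

section \<open>The stress-energy tensor and its divergence\<close>

lemma second_deriv_commute:
  fixes u :: "'a::euclidean_space \<Rightarrow> 'b::euclidean_space"
  assumes "smooth_on u \<Omega>" "open \<Omega>" "x \<in> \<Omega>"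
  shows "second_deriv u x v w = second_deriv u x w v"
  by (rule second_directional_derivatives_commute[OF assms(2,3), where f = u])
    (use smooth_onD[OF assms(1)] in auto)

lemma has_derivative_energy_density:
  assumes V: "admissible_potential V" and u: "smooth_on u \<Omega>" and x: "x \<in> \<Omega>"
  shows "(energy_density V \<epsilon> u has_derivative
    (\<lambda>h. \<epsilon> * (\<Sum>k\<in>Basis. frechet_derivative u (at x) k \<bullet> second_deriv u x k h)
      + (1 / \<epsilon>) * (grad V (u x) \<bullet> frechet_derivative u (at x) h))) (at x)"
proof -
  note sm = admissible_potential_smooth[OF V]
  have e: "energy_density V \<epsilon> u = (\<lambda>x. \<epsilon> * ((1 / 2) * (\<Sum>k\<in>Basis. frechet_derivative u (at x) k \<bullet> frechet_derivative u (at x) k))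
      + (1 / \<epsilon>) * V (u x))"
    by (simp add: fun_eq_iff energy_density_def grad_norm_sq_def power2_norm_eq_inner)
  have 1: "((\<lambda>x. V (u x)) has_derivative (\<lambda>h. grad V (u x) \<bullet> frechet_derivative u (at x) h)) (at x)"
    using has_derivative_compose[OF smooth_on_has_derivative[OF u x] smooth_on_has_derivative[OF sm UNIV_I]]
    by (simp add: frechet_derivative_eq_grad[OF sm UNIV_I])
  note 2 = smooth_on_has_second_derivative[OF u x]
  have "((\<lambda>x. \<epsilon> * ((1 / 2) * (\<Sum>k\<in>Basis. frechet_derivative u (at x) k \<bullet> frechet_derivative u (at x) k))
      + (1 / \<epsilon>) * V (u x)) has_derivative
     (\<lambda>h. \<epsilon> * ((1 / 2) * (\<Sum>k\<in>Basis. frechet_derivative u (at x) k \<bullet> second_deriv u x k h + second_deriv u x k h \<bullet> frechet_derivative u (at x) k))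
      + (1 / \<epsilon>) * (grad V (u x) \<bullet> frechet_derivative u (at x) h))) (at x)"
    by (intro has_derivative_add has_derivative_mult_right has_derivative_sum has_derivative_inner 1 2)
  moreover have "(1 / 2) * (\<Sum>k\<in>Basis. frechet_derivative u (at x) k \<bullet> second_deriv u x k h + second_deriv u x k h \<bullet> frechet_derivative u (at x) k)
     = (\<Sum>k\<in>Basis. frechet_derivative u (at x) k \<bullet> second_deriv u x k h)" for h
    by (simp add: inner_commute sum_distrib_left)
  ultimately show ?thesis unfolding e by simp
qed

text \<open>Component \<open>i\<close> of the stress-energy tensor (energy density times identity,
  minus \<open>\<epsilon>\<close> times the Gram matrix of the partial derivatives) applied to the
  radial field \<open>x - p\<close>.\<close>

definition stress :: "('b::euclidean_space \<Rightarrow> real) \<Rightarrow> real \<Rightarrow> (real^2 \<Rightarrow> 'b) \<Rightarrow> real^2 \<Rightarrow> real^2 \<Rightarrow> real^2 \<Rightarrow> real" where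
  "stress V \<epsilon> u p i x = ((x - p) \<bullet> i) * energy_density V \<epsilon> u x
     - \<epsilon> * (\<Sum>k\<in>Basis. ((x - p) \<bullet> k) * (frechet_derivative u (at x) i \<bullet> frechet_derivative u (at x) k))"

definition stress_deriv :: "('b::euclidean_space \<Rightarrow> real) \<Rightarrow> real \<Rightarrow> (real^2 \<Rightarrow> 'b) \<Rightarrow> real^2 \<Rightarrow> real^2 \<Rightarrow> real^2 \<Rightarrow> real^2 \<Rightarrow> real" where
  "stress_deriv V \<epsilon> u p i x h =
     ((x - p) \<bullet> i) * (\<epsilon> * (\<Sum>k\<in>Basis. frechet_derivative u (at x) k \<bullet> second_deriv u x k h)
        + (1 / \<epsilon>) * (grad V (u x) \<bullet> frechet_derivative u (at x) h))
     + (h \<bullet> i) * energy_density V \<epsilon> u x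
     - \<epsilon> * (\<Sum>k\<in>Basis. ((x - p) \<bullet> k) *
           (frechet_derivative u (at x) i \<bullet> second_deriv u x k h + second_deriv u x i h \<bullet> frechet_derivative u (at x) k)
         + (h \<bullet> k) * (frechet_derivative u (at x) i \<bullet> frechet_derivative u (at x) k))"

lemma has_derivative_stress:
  assumes V: "admissible_potential V" and u: "smooth_on u \<Omega>" and x: "x \<in> \<Omega>"
  shows "(stress V \<epsilon> u p i has_derivative stress_deriv V \<epsilon> u p i x) (at x)"
proof -
  have y: "((\<lambda>x. (x - p) \<bullet> k) has_derivative (\<lambda>h. h \<bullet> k)) (at x)" for k
    by (auto intro!: derivative_eq_intros)
  note d2 = smooth_on_has_second_derivative[OF u x]
  show ?thesis unfolding stress_def[abs_def] stress_deriv_def[abs_def]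
    by (intro has_derivative_diff has_derivative_mult_right has_derivative_sum
        has_derivative_mult[OF y has_derivative_energy_density[OF V u x]]
        has_derivative_mult[OF y has_derivative_inner[OF d2 d2]])
qed

lemma continuous_on_stress_deriv:
  assumes V: "admissible_potential V" and u: "smooth_on u \<Omega>"
  shows "continuous_on \<Omega> (\<lambda>x. stress_deriv V \<epsilon> u p i x h)"
proof -
  have "continuous_on \<Omega> (\<lambda>x. grad V (u x))"
    by (rule continuous_on_compose2[OF continuous_on_grad[OF admissible_potential_smooth[OF V]] smooth_on_continuous[OF u]]) auto
  note c = this smooth_on_continuous_second_derivative[OF u] smooth_on_continuous_derivative[OF u]
     continuous_on_energy_density[OF V u]
  show ?thesis unfolding stress_deriv_def
    by (intro continuous_on_add continuous_on_diff continuous_on_mult continuous_on_sum continuous_on_inner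
      continuous_on_const continuous_on_id c)
qed

text \<open>This is where the dimension two enters: the trace of the stress-energy tensor is the potential term alone.\<close>

lemma stress_divergence:
  assumes u: "solves_AC V \<Omega> \<epsilon> u" and x: "x \<in> \<Omega>"
  shows "(\<Sum>i\<in>Basis. stress_deriv V \<epsilon> u p i x i) = 2 * (V (u x) / \<epsilon>)"
proof -
  note ud = solves_ACD[OF u]
  let ?y = "x - p"
  let ?d = "frechet_derivative u (at x)"
  let ?s = "second_deriv u x"
  \<comment> \<open>Symmetry of second derivatives; \<open>B\<close> is where the equation enters.
    Together they cancel every term in which \<open>x - p\<close> is undifferentiated, since the
    stress-energy tensor is divergence free, and its trace remains.\<close>
  have A: "(\<Sum>i\<in>Basis. (?y \<bullet> i) * (\<Sum>k\<in>Basis. ?d k \<bullet> ?s k i)) = (\<Sum>i\<in>Basis. \<Sum>k\<in>Basis. (?y \<bullet> k) * (?d i \<bullet> ?s k i))"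
  proof -
    have "(\<Sum>i\<in>Basis. (?y \<bullet> i) * (\<Sum>k\<in>Basis. ?d k \<bullet> ?s k i)) = (\<Sum>i\<in>Basis. \<Sum>k\<in>Basis. (?y \<bullet> i) * (?d k \<bullet> ?s i k))"
      by (simp add: sum_distrib_left second_deriv_commute[OF ud(3,1) x, of _ i for i])
    also have "\<dots> = (\<Sum>k\<in>Basis. \<Sum>i\<in>Basis. (?y \<bullet> i) * (?d k \<bullet> ?s i k))" by (rule sum.swap)
    finally show ?thesis .
  qed
  have B: "(\<Sum>i\<in>Basis. \<Sum>k\<in>Basis. (?y \<bullet> k) * (?s i i \<bullet> ?d k)) = (1 / \<epsilon>\<^sup>2) * (\<Sum>k\<in>Basis. (?y \<bullet> k) * (grad V (u x) \<bullet> ?d k))"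
  proof -
    have "(\<Sum>i\<in>Basis. \<Sum>k\<in>Basis. (?y \<bullet> k) * (?s i i \<bullet> ?d k)) = (\<Sum>k\<in>Basis. (?y \<bullet> k) * (laplacian u x \<bullet> ?d k))"
      by (subst sum.swap) (simp add: laplacian_def inner_sum_left sum_distrib_left)
    then show ?thesis by (simp add: ud(4)[OF x] sum_distrib_left mult.left_commute)
  qed
  have C: "(\<Sum>i\<in>Basis. \<Sum>k\<in>Basis. (i \<bullet> k) * (?d i \<bullet> ?d k)) = grad_norm_sq u x"
  proof -
    have "(\<Sum>k\<in>Basis. (i \<bullet> k) * (?d i \<bullet> ?d k)) = (norm (?d i))\<^sup>2" if "i \<in> Basis" for i
      using that by (simp add: inner_Basis if_distrib[of "\<lambda>c. c * _"] power2_norm_eq_inner cong: if_cong)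
    then show ?thesis by (simp add: grad_norm_sq_def)
  qed
  have "(\<Sum>i\<in>Basis. stress_deriv V \<epsilon> u p i x i)
      = \<epsilon> * (\<Sum>i\<in>Basis. (?y \<bullet> i) * (\<Sum>k\<in>Basis. ?d k \<bullet> ?s k i))
        + (1 / \<epsilon>) * (\<Sum>i\<in>Basis. (?y \<bullet> i) * (grad V (u x) \<bullet> ?d i))
        + 2 * energy_density V \<epsilon> u x
        - \<epsilon> * ((\<Sum>i\<in>Basis. \<Sum>k\<in>Basis. (?y \<bullet> k) * (?d i \<bullet> ?s k i)) + (\<Sum>i\<in>Basis. \<Sum>k\<in>Basis. (?y \<bullet> k) * (?s i i \<bullet> ?d k))
             + (\<Sum>i\<in>Basis. \<Sum>k\<in>Basis. (i \<bullet> k) * (?d i \<bullet> ?d k)))"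
    unfolding stress_deriv_def distrib_left sum.distrib sum_subtractf
    by (simp add: sum_distrib_left mult.left_commute algebra_simps sum_subtractf diff_divide_distrib)
  also have "\<dots> = 2 * energy_density V \<epsilon> u x - \<epsilon> * grad_norm_sq u x"
    unfolding A B C using ud(2) by (simp add: power2_eq_square field_simps)
  also have "\<dots> = 2 * (V (u x) / \<epsilon>)" by (simp add: energy_density_def)
  finally show ?thesis .
qed

text \<open>The divergence of \<open>cutoff\<close> times \<open>stress\<close> has integral zero.
  It equals the weighted trace minus the slope times the radial component of \<open>stress\<close>;
  that component is the squared distance times the energy density minus \<open>\<epsilon>\<close>
  times the square of a radial derivative, and is thus at most \<open>b\<^sup>2\<close> times the
  energy density.\<close>

lemma pohozaev_inequality:
  assumes V: "admissible_potential V" and u: "solves_AC V \<Omega> \<epsilon> u"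
    and ab: "0 < a" "a < b" and sub: "cball p b \<subseteq> \<Omega>"
  shows "2 * set_lebesgue_integral lborel (cball p b) (\<lambda>x. cutoff a b p x * (V (u x) / \<epsilon>))
    \<le> b\<^sup>2 * set_lebesgue_integral lborel (cball p b) (\<lambda>x. cutoff_slope a b p x * energy_density V \<epsilon> u x)"
proof -
  note ud = solves_ACD[OF u]
  let ?e = "energy_density V \<epsilon> u" and ?K = "cball p b"
  define W where "W i x = cutoff a b p x * stress V \<epsilon> u p i x" for i x
  define W' where "W' i x h = cutoff a b p x * stress_deriv V \<epsilon> u p i x h
      + (- cutoff_slope a b p x * ((x - p) \<bullet> h)) * stress V \<epsilon> u p i x" for i x h
  have cs: "continuous_on \<Omega> (stress V \<epsilon> u p i)" for i
    by (intro continuous_at_imp_continuous_on ballI has_derivative_continuous[OF has_derivative_stress[OF V ud(3)]])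
  have zero: "set_lebesgue_integral lborel ?K (\<lambda>x. \<Sum>i\<in>Basis. W' i x i) = 0"
  proof (rule set_integral_divergence_zero[OF ud(1) compact_cball sub, where W = W and W' = W'])
    show "W i x = 0" if "x \<notin> ?K" for i x
      using that cutoff_bounds(4)[OF ab, of p x] by (simp add: W_def)
    show "(W i has_derivative W' i x) (at x)" if "x \<in> \<Omega>" for i x
      unfolding W_def[abs_def] W'_def[abs_def]
      by (intro has_derivative_mult has_derivative_cutoff has_derivative_stress[OF V ud(3) that])
    show "continuous_on \<Omega> (\<lambda>x. W' i x i)" for i
      unfolding W'_def
      by (intro continuous_on_add continuous_on_mult continuous_on_minus continuous_on_inner continuous_on_diff
        continuous_on_const continuous_on_id continuous_on_cutoff continuous_on_cutoff_slope
        continuous_on_stress_deriv[OF V ud(3)] cs)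
  qed
  have pt: "2 * (cutoff a b p x * (V (u x) / \<epsilon>)) - b\<^sup>2 * (cutoff_slope a b p x * ?e x) \<le> (\<Sum>i\<in>Basis. W' i x i)"
    if x: "x \<in> ?K" for x
  proof -
    let ?d = "frechet_derivative u (at x)"
    have "x \<in> \<Omega>" using x sub by blast
    have S: "(\<Sum>i\<in>Basis. ((x - p) \<bullet> i) * stress V \<epsilon> u p i x)
        = ((x - p) \<bullet> (x - p)) * ?e x - \<epsilon> * ((\<Sum>i\<in>Basis. ((x - p) \<bullet> i) *\<^sub>R ?d i) \<bullet> (\<Sum>k\<in>Basis. ((x - p) \<bullet> k) *\<^sub>R ?d k))"
    proof -
      define Z where "Z = (\<Sum>k\<in>Basis. ((x - p) \<bullet> k) *\<^sub>R ?d k)"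
      have dZ: "v \<bullet> Z = (\<Sum>k\<in>Basis. ((x - p) \<bullet> k) * (v \<bullet> ?d k))" for v
        by (simp add: Z_def inner_sum_right)
      have "(\<Sum>i\<in>Basis. ((x - p) \<bullet> i) * stress V \<epsilon> u p i x)
          = (\<Sum>i\<in>Basis. ((x - p) \<bullet> i) * ((x - p) \<bullet> i)) * ?e x - \<epsilon> * (\<Sum>i\<in>Basis. ((x - p) \<bullet> i) * (?d i \<bullet> Z))"
        by (simp add: stress_def dZ right_diff_distrib sum_subtractf sum_distrib_left sum_distrib_right
            mult.assoc mult.left_commute)
      also have "(\<Sum>i\<in>Basis. ((x - p) \<bullet> i) * ((x - p) \<bullet> i)) = (x - p) \<bullet> (x - p)"
        by (rule euclidean_inner[symmetric])
      also have "(\<Sum>i\<in>Basis. ((x - p) \<bullet> i) * (?d i \<bullet> Z)) = Z \<bullet> Z"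
        unfolding dZ[of Z] by (simp add: inner_commute)
      finally show ?thesis by (simp add: Z_def)
    qed
    have n: "(x - p) \<bullet> (x - p) \<le> b\<^sup>2"
    proof -
      have "norm (x - p) \<le> b" using x by (simp add: dist_norm norm_minus_commute)
      from power_mono[OF this, of 2] show ?thesis by (simp add: power2_norm_eq_inner)
    qed
    have "(\<Sum>i\<in>Basis. ((x - p) \<bullet> i) * stress V \<epsilon> u p i x) \<le> ((x - p) \<bullet> (x - p)) * ?e x"
      unfolding S using ud(2) by simp
    also have "\<dots> \<le> b\<^sup>2 * ?e x"
      using n energy_density_parts(1)[OF V ud(2)] by (intro mult_right_mono)
    finally have "cutoff_slope a b p x * (\<Sum>i\<in>Basis. ((x - p) \<bullet> i) * stress V \<epsilon> u p i x) \<le> cutoff_slope a b p x * (b\<^sup>2 * ?e x)"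
      using cutoff_bounds(5)[OF ab] by (intro mult_left_mono)
    moreover have "(\<Sum>i\<in>Basis. W' i x i) = cutoff a b p x * (\<Sum>i\<in>Basis. stress_deriv V \<epsilon> u p i x i)
        - cutoff_slope a b p x * (\<Sum>i\<in>Basis. ((x - p) \<bullet> i) * stress V \<epsilon> u p i x)"
      by (simp add: W'_def sum.distrib sum_subtractf sum_distrib_left sum_negf mult.assoc)
    ultimately show ?thesis
      unfolding stress_divergence[OF u \<open>x \<in> \<Omega>\<close>] by (simp add: mult.left_commute)
  qed
  have i1: "set_integrable lborel ?K (\<lambda>x. cutoff a b p x * (V (u x) / \<epsilon>))"
    using ud(2) by (intro set_integrable_continuous_compact[OF _ compact_cball sub] continuous_on_mult continuous_on_cutoff
        continuous_on_divide continuous_on_const continuous_on_potential_solution[OF V ud(3)]) auto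
  have i2: "set_integrable lborel ?K (\<lambda>x. cutoff_slope a b p x * ?e x)"
    by (intro set_integrable_continuous_compact[OF _ compact_cball sub] continuous_on_mult continuous_on_cutoff_slope
        continuous_on_energy_density[OF V ud(3)])
  have i3: "set_integrable lborel ?K (\<lambda>x. \<Sum>i\<in>Basis. W' i x i)"
    unfolding W'_def
    by (intro set_integrable_continuous_compact[OF _ compact_cball sub] continuous_on_sum
        continuous_on_add continuous_on_mult continuous_on_minus continuous_on_inner continuous_on_diff
        continuous_on_const continuous_on_id continuous_on_cutoff continuous_on_cutoff_slope
        continuous_on_stress_deriv[OF V ud(3)] cs)
  have "set_lebesgue_integral lborel ?K (\<lambda>x. 2 * (cutoff a b p x * (V (u x) / \<epsilon>)) - b\<^sup>2 * (cutoff_slope a b p x * ?e x))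
      \<le> set_lebesgue_integral lborel ?K (\<lambda>x. \<Sum>i\<in>Basis. W' i x i)"
    by (rule set_integral_mono) (use i1 i2 i3 pt in \<open>auto intro!: set_integral_diff set_integrable_mult_right\<close>)
  then show ?thesis
    unfolding zero set_integral_diff(2)[OF set_integrable_mult_right[OF i1] set_integrable_mult_right[OF i2]]
    by (simp only: set_integral_mult_right diff_le_0_iff_le)
qed

section \<open>Gradient energy near the wells\<close>

text \<open>Finiteness of the set of wells yields one radius for all of them. The separation by
  \<open>2 * \<mu>\<close> keeps values within \<open>\<mu>\<close> of one well at distance at least
  \<open>\<mu>\<close> from the others.\<close>

lemma admissible_potential_well_radius:
  fixes V :: "'a::euclidean_space \<Rightarrow> real"
  assumes V: "admissible_potential V"
  obtains \<mu> where "\<mu> > 0"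
    "\<And>s y. V s = 0 \<Longrightarrow> dist s y < \<mu> \<Longrightarrow> grad V y \<bullet> (y - s) \<ge> 0"
    "\<And>s s'. V s = 0 \<Longrightarrow> V s' = 0 \<Longrightarrow> s \<noteq> s' \<Longrightarrow> dist s s' \<ge> 2 * \<mu>"
proof -
  let ?Z = "{s. V s = 0}"
  have fin: "finite ?Z" using V by (simp add: admissible_potential_def)
  have "\<exists>\<mu>>0. (\<forall>y. dist s y < \<mu> \<longrightarrow> grad V y \<bullet> (y - s) \<ge> 0) \<and> (\<forall>s'\<in>?Z. s' \<noteq> s \<longrightarrow> dist s s' \<ge> 2 * \<mu>)" if s: "s \<in> ?Z" for s
  proof -
    obtain m where m: "m > 0" "\<And>y. y \<in> ball s m \<Longrightarrow> grad V y \<bullet> (y - s) \<ge> 0"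
      using admissible_potential_monotone_near_well[OF V, of s] s by blast
    obtain d where d: "d > 0" "\<forall>x\<in>?Z. x \<noteq> s \<longrightarrow> d \<le> dist s x"
      using finite_set_avoid[OF fin, of s] by blast
    have "\<forall>s'\<in>?Z. s' \<noteq> s \<longrightarrow> dist s s' \<ge> 2 * min m (d / 2)"
    proof (intro ballI impI)
      fix s' assume "s' \<in> ?Z" "s' \<noteq> s"
      then have "d \<le> dist s s'" using d(2) by blast
      then show "dist s s' \<ge> 2 * min m (d / 2)" by (simp add: min_def)
    qed
    then show ?thesis using m d(1) by (intro exI[of _ "min m (d / 2)"]) (auto simp: mem_ball)
  qed
  then have "\<forall>s\<in>?Z. \<exists>\<mu>. \<mu> > 0 \<and> (\<forall>y. dist s y < \<mu> \<longrightarrow> grad V y \<bullet> (y - s) \<ge> 0) \<and> (\<forall>s'\<in>?Z. s' \<noteq> s \<longrightarrow> dist s s' \<ge> 2 * \<mu>)"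
    by blast
  from bchoice[OF this] obtain \<mu> where *: "\<forall>s\<in>?Z. \<mu> s > 0 \<and> (\<forall>y. dist s y < \<mu> s \<longrightarrow> grad V y \<bullet> (y - s) \<ge> 0)
      \<and> (\<forall>s'\<in>?Z. s' \<noteq> s \<longrightarrow> dist s s' \<ge> 2 * \<mu> s)"
    by blast
  then have \<mu>: "\<And>s. s \<in> ?Z \<Longrightarrow> \<mu> s > 0"
    "\<And>s y. s \<in> ?Z \<Longrightarrow> dist s y < \<mu> s \<Longrightarrow> grad V y \<bullet> (y - s) \<ge> 0"
    "\<And>s s'. s \<in> ?Z \<Longrightarrow> s' \<in> ?Z \<Longrightarrow> s' \<noteq> s \<Longrightarrow> dist s s' \<ge> 2 * \<mu> s" by blast+
  define m where "m = Min (insert 1 (\<mu> ` ?Z))"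
  have "m > 0" using fin \<mu>(1) by (simp add: m_def)
  have m: "m \<le> \<mu> s" if "s \<in> ?Z" for s using fin that by (auto simp: m_def intro: Min_le)
  show thesis
  proof (rule that[OF \<open>m > 0\<close>])
    show "grad V y \<bullet> (y - s) \<ge> 0" if "V s = 0" "dist s y < m" for s y
      using \<mu>(2)[of s y] m[of s] that by auto
    show "dist s s' \<ge> 2 * m" if "V s = 0" "V s' = 0" "s \<noteq> s'" for s s'
      using \<mu>(3)[of s s'] m[of s] that by auto
  qed
qed

text \<open>Testing the equation against the truncated field \<open>y \<mapsto> cutoff (\<mu>/2) \<mu> s y *\<^sub>R (y - s)\<close> in the target.\<close>

lemma truncated_field_identity:
  fixes u :: "real^2 \<Rightarrow> 'b::euclidean_space" and s :: 'b
  assumes V: "admissible_potential V" and u: "solves_AC V \<Omega> \<epsilon> u"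
    and ab: "0 < a" "a < b" and sub: "cball p b \<subseteq> \<Omega>" and \<mu>: "0 < \<mu>"
  defines "\<phi> \<equiv> cutoff a b p" and "\<xi> \<equiv> cutoff_slope a b p"
    and "\<tau> \<equiv> \<lambda>x. cutoff (\<mu> / 2) \<mu> s (u x)" and "\<zeta> \<equiv> \<lambda>x. cutoff_slope (\<mu> / 2) \<mu> s (u x)"
    and "D \<equiv> \<lambda>i x. frechet_derivative u (at x) i"
  defines "R \<equiv> \<lambda>x. \<epsilon> * (\<xi> x * \<tau> x * (\<Sum>i\<in>Basis. ((x - p) \<bullet> i) * (D i x \<bullet> (u x - s))))
      + \<epsilon> * (\<phi> x * \<zeta> x * (\<Sum>i\<in>Basis. ((u x - s) \<bullet> D i x)\<^sup>2))
      - (1 / \<epsilon>) * (\<phi> x * \<tau> x * (grad V (u x) \<bullet> (u x - s)))"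
  shows "continuous_on \<Omega> R"
    and "continuous_on \<Omega> (\<lambda>x. \<phi> x * (\<tau> x * (\<epsilon> * grad_norm_sq u x)))"
    and "set_lebesgue_integral lborel (cball p b) (\<lambda>x. \<phi> x * (\<tau> x * (\<epsilon> * grad_norm_sq u x)))
      = set_lebesgue_integral lborel (cball p b) R"
proof -
  note ud = solves_ACD[OF u]
  let ?K = "cball p b"
  \<comment> \<open>The derivative of \<open>u\<close> paired with the truncated field and localised
    by \<open>\<phi>\<close>. In its divergence the product \<open>D i x \<bullet> D i x\<close>
    produces the gradient energy, while the equation and the derivatives of the two cutoffs produce
    the three terms of \<open>R\<close>.\<close>
  define W where "W i x = \<phi> x * (\<tau> x * (D i x \<bullet> (u x - s)))" for i x
  define W' where "W' i x h = \<phi> x * (\<tau> x * (D i x \<bullet> D h x + second_deriv u x i h \<bullet> (u x - s))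
        + (- \<zeta> x * ((u x - s) \<bullet> D h x)) * (D i x \<bullet> (u x - s)))
      + (- \<xi> x * ((x - p) \<bullet> h)) * (\<tau> x * (D i x \<bullet> (u x - s)))" for i x h
  note cu = smooth_on_continuous[OF ud(3)] smooth_on_continuous_derivative[OF ud(3)]
    smooth_on_continuous_second_derivative[OF ud(3)]
  have c\<phi>: "continuous_on \<Omega> \<phi>" "continuous_on \<Omega> \<xi>"
    unfolding \<phi>_def \<xi>_def by (rule continuous_on_cutoff continuous_on_cutoff_slope)+
  have c\<tau>: "continuous_on \<Omega> \<tau>" "continuous_on \<Omega> \<zeta>" unfolding \<tau>_def \<zeta>_def
    by (rule continuous_on_compose2[OF continuous_on_cutoff[of UNIV] cu(1) subset_UNIV]
        continuous_on_compose2[OF continuous_on_cutoff_slope[of UNIV] cu(1) subset_UNIV])+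
  have cg: "continuous_on \<Omega> (\<lambda>x. grad V (u x))"
    by (rule continuous_on_compose2[OF continuous_on_grad[OF admissible_potential_smooth[OF V]] cu(1)]) auto
  have cD: "continuous_on \<Omega> (\<lambda>x. D i x)" for i unfolding D_def by (rule cu)
  show cR: "continuous_on \<Omega> R"
    unfolding R_def
    by (intro continuous_on_add continuous_on_diff continuous_on_mult continuous_on_sum continuous_on_inner
      continuous_on_power continuous_on_const continuous_on_id c\<phi> c\<tau> cg cD cu)
  show cL: "continuous_on \<Omega> (\<lambda>x. \<phi> x * (\<tau> x * (\<epsilon> * grad_norm_sq u x)))"
    unfolding grad_norm_sq_def
    by (intro continuous_on_mult continuous_on_sum continuous_on_power continuous_on_norm continuous_on_const c\<phi> c\<tau> cu)
  have cW': "continuous_on \<Omega> (\<lambda>x. W' i x i)" for i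
    unfolding W'_def
    by (intro continuous_on_add continuous_on_diff continuous_on_mult continuous_on_minus continuous_on_inner
      continuous_on_const continuous_on_id c\<phi> c\<tau> cD cu)
  have zero: "set_lebesgue_integral lborel ?K (\<lambda>x. \<Sum>i\<in>Basis. W' i x i) = 0"
  proof (rule set_integral_divergence_zero[OF ud(1) compact_cball sub, where W = W and W' = W'])
    show "W i x = 0" if "x \<notin> ?K" for i x
      using that cutoff_bounds(4)[OF ab, of p x] by (simp add: W_def \<phi>_def)
    show "(W i has_derivative W' i x) (at x)" if "x \<in> \<Omega>" for i x
    proof -
      note du = smooth_on_has_derivative[OF ud(3) that] smooth_on_has_second_derivative[OF ud(3) that]
      have 1: "(\<tau> has_derivative (\<lambda>h. - \<zeta> x * ((u x - s) \<bullet> D h x))) (at x)"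
        unfolding \<tau>_def \<zeta>_def D_def by (rule has_derivative_compose[OF du(1) has_derivative_cutoff])
      have 2: "((\<lambda>x. u x - s) has_derivative (\<lambda>h. D h x)) (at x)"
        using has_derivative_diff[OF du(1) has_derivative_const] by (simp add: D_def)
      have 3: "((\<lambda>x. D i x) has_derivative second_deriv u x i) (at x)" unfolding D_def by (rule du)
      show ?thesis unfolding W_def[abs_def] W'_def[abs_def]
        by (rule has_derivative_mult[OF has_derivative_cutoff[of a b p x, folded \<phi>_def \<xi>_def]
            has_derivative_mult[OF 1 has_derivative_inner[OF 3 2]]])
    qed
    show "continuous_on \<Omega> (\<lambda>x. W' i x i)" for i by (rule cW')
  qed
  have pt: "\<epsilon> * (\<Sum>i\<in>Basis. W' i x i) = \<phi> x * (\<tau> x * (\<epsilon> * grad_norm_sq u x)) - R x" if x: "x \<in> ?K" for x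
  proof -
    have "x \<in> \<Omega>" using x sub by blast
    have lap: "(\<Sum>i\<in>Basis. second_deriv u x i i \<bullet> (u x - s)) = (1 / \<epsilon>\<^sup>2) * (grad V (u x) \<bullet> (u x - s))"
      using ud(4)[OF \<open>x \<in> \<Omega>\<close>] by (simp add: laplacian_def inner_sum_left[symmetric])
    have grd: "(\<Sum>i\<in>Basis. D i x \<bullet> D i x) = grad_norm_sq u x"
      by (simp add: D_def grad_norm_sq_def power2_norm_eq_inner)
    have cm: "(u x - s) \<bullet> D i x = D i x \<bullet> (u x - s)" for i by (rule inner_commute)
    have "(\<Sum>i\<in>Basis. W' i x i) = \<phi> x * (\<tau> x * (grad_norm_sq u x + (1 / \<epsilon>\<^sup>2) * (grad V (u x) \<bullet> (u x - s))))
        - \<phi> x * \<zeta> x * (\<Sum>i\<in>Basis. ((u x - s) \<bullet> D i x)\<^sup>2)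
        - \<xi> x * \<tau> x * (\<Sum>i\<in>Basis. ((x - p) \<bullet> i) * (D i x \<bullet> (u x - s)))"
      unfolding W'_def lap[symmetric] grd[symmetric]
      by (simp add: sum.distrib sum_subtractf sum_distrib_left sum_negf power2_eq_square cm
          distrib_left right_diff_distrib mult.assoc mult.left_commute)
    then show ?thesis unfolding R_def using ud(2) by (simp add: power2_eq_square field_simps)
  qed
  have "set_lebesgue_integral lborel ?K (\<lambda>x. \<phi> x * (\<tau> x * (\<epsilon> * grad_norm_sq u x)) - R x)
      = set_lebesgue_integral lborel ?K (\<lambda>x. \<epsilon> * (\<Sum>i\<in>Basis. W' i x i))"
    by (rule set_lebesgue_integral_cong) (use pt in auto)
  then show "set_lebesgue_integral lborel ?K (\<lambda>x. \<phi> x * (\<tau> x * (\<epsilon> * grad_norm_sq u x))) = set_lebesgue_integral lborel ?K R"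
    using zero set_integrable_continuous_compact[OF cL compact_cball sub] set_integrable_continuous_compact[OF cR compact_cball sub]
    by (simp add: set_integral_diff)
qed

text \<open>The three terms of \<open>R\<close> are treated separately. The one with
  \<open>\<xi>\<close> is of lower order in \<open>\<epsilon>\<close>. The one with
  \<open>\<zeta>\<close> lives where the distance of \<open>u x\<close> to \<open>s\<close> is
  between \<open>\<mu> / 2\<close> and \<open>\<mu>\<close>; there \<open>V (u x) \<ge> c\<close>
  and \<open>\<epsilon> * grad_norm_sq u x\<close> is at most \<open>G\<^sup>2 / \<epsilon>\<close>,
  hence a multiple of the potential energy. The one with \<open>grad V\<close> has a sign by
  monotonicity near the well.\<close>

lemma truncated_field_bound:
  fixes u :: "real^2 \<Rightarrow> 'b::euclidean_space"
  assumes V: "admissible_potential V" and u: "solves_AC V \<Omega> \<epsilon> u" and "\<epsilon> \<le> 1"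
    and ab: "0 < a" "a < b" and sub: "cball p b \<subseteq> \<Omega>" and \<mu>: "0 < \<mu>"
    and s: "V s = 0" "\<And>y. dist s y < \<mu> \<Longrightarrow> grad V y \<bullet> (y - s) \<ge> 0"
    and c: "c > 0" "\<And>x. x \<in> cball p b \<Longrightarrow> \<mu> / 2 \<le> dist s (u x) \<Longrightarrow> dist s (u x) \<le> \<mu> \<Longrightarrow> V (u x) \<ge> c"
    and G: "\<And>x. x \<in> cball p b \<Longrightarrow> grad_norm_sq u x \<le> (G / \<epsilon>)\<^sup>2"
  shows "set_lebesgue_integral lborel (cball p b) (\<lambda>x. cutoff a b p x * (cutoff (\<mu> / 2) \<mu> s (u x) * (\<epsilon> * grad_norm_sq u x)))
    \<le> 18 / (\<mu>\<^sup>2 - (\<mu> / 2)\<^sup>2) * \<mu>\<^sup>2 * G\<^sup>2 / c * set_lebesgue_integral lborel (cball p b) (\<lambda>x. cutoff a b p x * (V (u x) / \<epsilon>))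
      + 18 / (b\<^sup>2 - a\<^sup>2) * b * \<mu> * sqrt \<epsilon> * set_lebesgue_integral lborel (cball p b) (\<lambda>x. 2 + 2 * energy_density V \<epsilon> u x)"
proof -
  note ud = solves_ACD[OF u]
  let ?K = "cball p b" and ?D = "\<lambda>i x. frechet_derivative u (at x) i"
  define \<phi> where "\<phi> = cutoff a b p"
  define \<xi> where "\<xi> = cutoff_slope a b p"
  define \<tau> where "\<tau> = (\<lambda>x. cutoff (\<mu> / 2) \<mu> s (u x))"
  define \<zeta> where "\<zeta> = (\<lambda>x. cutoff_slope (\<mu> / 2) \<mu> s (u x))"
  define A where "A = 18 / (\<mu>\<^sup>2 - (\<mu> / 2)\<^sup>2) * \<mu>\<^sup>2 * G\<^sup>2 / c"
  define B where "B = 18 / (b\<^sup>2 - a\<^sup>2) * b * \<mu>"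
  define R where "R x = \<epsilon> * (\<xi> x * \<tau> x * (\<Sum>i\<in>Basis. ((x - p) \<bullet> i) * (?D i x \<bullet> (u x - s))))
      + \<epsilon> * (\<phi> x * \<zeta> x * (\<Sum>i\<in>Basis. ((u x - s) \<bullet> ?D i x)\<^sup>2))
      - (1 / \<epsilon>) * (\<phi> x * \<tau> x * (grad V (u x) \<bullet> (u x - s)))" for x
  have cR: "continuous_on \<Omega> R"
    unfolding R_def[abs_def] \<phi>_def \<xi>_def \<tau>_def \<zeta>_def
    by (rule truncated_field_identity(1)[OF V u ab sub \<mu>])
  have IR: "set_lebesgue_integral lborel ?K (\<lambda>x. \<phi> x * (\<tau> x * (\<epsilon> * grad_norm_sq u x))) = set_lebesgue_integral lborel ?K R"
    unfolding R_def[abs_def] \<phi>_def \<xi>_def \<tau>_def \<zeta>_def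
    by (rule truncated_field_identity(3)[OF V u ab sub \<mu>])
  have \<mu>2: "0 < \<mu> / 2" "\<mu> / 2 < \<mu>" using \<mu> by auto
  note b\<phi> = cutoff_bounds[OF ab, of p, folded \<phi>_def \<xi>_def]
  have b\<tau>: "0 \<le> \<tau> x" "\<tau> x \<le> 1" "dist s (u x) \<ge> \<mu> \<Longrightarrow> \<tau> x = 0" "0 \<le> \<zeta> x" "\<zeta> x \<le> 18 / (\<mu>\<^sup>2 - (\<mu> / 2)\<^sup>2)"
    "dist s (u x) \<le> \<mu> / 2 \<or> dist s (u x) \<ge> \<mu> \<Longrightarrow> \<zeta> x = 0" for x
    unfolding \<tau>_def \<zeta>_def by (fact cutoff_bounds[OF \<mu>2])+
  have pt: "R x \<le> A * (\<phi> x * (V (u x) / \<epsilon>)) + B * sqrt \<epsilon> * (2 + 2 * energy_density V \<epsilon> u x)" if x: "x \<in> ?K" for x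
  proof -
    note en = energy_density_parts[OF V ud(2), of u x]
    have gn: "grad_norm_sq u x \<ge> 0" by (simp add: grad_norm_sq_def sum_nonneg)
    have "\<epsilon> * (\<xi> x * \<tau> x * (\<Sum>i\<in>Basis. ((x - p) \<bullet> i) * (?D i x \<bullet> (u x - s)))) \<le> B * sqrt \<epsilon> * (2 + 2 * energy_density V \<epsilon> u x)"
    proof (cases "dist s (u x) \<ge> \<mu>")
      case True
      then show ?thesis using b\<tau>(3)[OF True] en(1) ab \<mu> ud(2)
        by (auto simp: B_def intro!: mult_nonneg_nonneg divide_nonneg_nonneg power_mono)
    next
      case False
      then have us: "norm (u x - s) \<le> \<mu>" by (simp add: dist_norm norm_minus_commute)
      have xp: "norm (x - p) \<le> b" using x by (simp add: dist_norm norm_minus_commute)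
      \<comment> \<open>Origin of the factor \<open>sqrt \<epsilon>\<close>: one factor
        \<open>sqrt \<epsilon>\<close> is kept and the other joins the derivative to form
        \<open>t\<close>, which is at most \<open>1 + t\<^sup>2\<close>, and
        \<open>t\<^sup>2\<close> is part of the energy.\<close>
      have tm: "\<epsilon> * (((x - p) \<bullet> i) * (?D i x \<bullet> (u x - s))) \<le> b * \<mu> * sqrt \<epsilon> * (1 + \<epsilon> * (norm (?D i x))\<^sup>2)" if i: "i \<in> Basis" for i
      proof -
        have "((x - p) \<bullet> i) * (?D i x \<bullet> (u x - s)) \<le> \<bar>(x - p) \<bullet> i\<bar> * \<bar>?D i x \<bullet> (u x - s)\<bar>"
          by (metis abs_ge_self abs_mult)
        also have "\<dots> \<le> b * (norm (?D i x) * \<mu>)"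
        proof (rule mult_mono)
          show "\<bar>(x - p) \<bullet> i\<bar> \<le> b" using Basis_le_norm[OF i, of "x - p"] xp by linarith
          have "\<bar>?D i x \<bullet> (u x - s)\<bar> \<le> norm (?D i x) * norm (u x - s)" by (rule Cauchy_Schwarz_ineq2)
          also have "\<dots> \<le> norm (?D i x) * \<mu>" using us by (intro mult_left_mono) auto
          finally show "\<bar>?D i x \<bullet> (u x - s)\<bar> \<le> norm (?D i x) * \<mu>" .
        qed (use ab in auto)
        finally have "\<epsilon> * (((x - p) \<bullet> i) * (?D i x \<bullet> (u x - s))) \<le> \<epsilon> * (b * (norm (?D i x) * \<mu>))"
          using ud(2) by (intro mult_left_mono) auto
        also have "\<dots> = b * \<mu> * sqrt \<epsilon> * (sqrt \<epsilon> * norm (?D i x))"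
          using ud(2) by (simp add: mult.assoc mult.left_commute)
        also have "\<dots> \<le> b * \<mu> * sqrt \<epsilon> * (1 + \<epsilon> * (norm (?D i x))\<^sup>2)"
        proof (intro mult_left_mono)
          define t where "t = sqrt \<epsilon> * norm (?D i x)"
          have "t\<^sup>2 = \<epsilon> * (norm (?D i x))\<^sup>2" using ud(2) by (simp add: t_def power_mult_distrib)
          moreover have "0 \<le> (t - 1)\<^sup>2 + 1 + t\<^sup>2" by simp
          then have "t \<le> 1 + t\<^sup>2" by (simp add: power2_diff)
          ultimately show "sqrt \<epsilon> * norm (?D i x) \<le> 1 + \<epsilon> * (norm (?D i x))\<^sup>2"
            by (simp add: t_def)
        qed (use ab \<mu> ud(2) in auto)
        finally show ?thesis .
      qed
      have "\<epsilon> * (\<Sum>i\<in>Basis. ((x - p) \<bullet> i) * (?D i x \<bullet> (u x - s))) \<le> (\<Sum>i\<in>(Basis :: (real^2) set). b * \<mu> * sqrt \<epsilon> * (1 + \<epsilon> * (norm (?D i x))\<^sup>2))"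
        unfolding sum_distrib_left by (intro sum_mono tm)
      also have "\<dots> = b * \<mu> * sqrt \<epsilon> * (2 + \<epsilon> * grad_norm_sq u x)"
        by (simp add: sum_distrib_left[symmetric] sum.distrib grad_norm_sq_def)
      finally have "\<xi> x * \<tau> x * (\<epsilon> * (\<Sum>i\<in>Basis. ((x - p) \<bullet> i) * (?D i x \<bullet> (u x - s)))) \<le> \<xi> x * \<tau> x * (b * \<mu> * sqrt \<epsilon> * (2 + \<epsilon> * grad_norm_sq u x))"
        using b\<phi>(5) b\<tau>(1) by (intro mult_left_mono) auto
      also have "\<dots> \<le> (18 / (b\<^sup>2 - a\<^sup>2) * 1) * (b * \<mu> * sqrt \<epsilon> * (2 + 2 * energy_density V \<epsilon> u x))"
      proof (rule mult_mono)
        show "\<xi> x * \<tau> x \<le> 18 / (b\<^sup>2 - a\<^sup>2) * 1"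
          by (intro mult_mono b\<phi> b\<tau> order_trans[OF b\<phi>(5) b\<phi>(6)])
        show "b * \<mu> * sqrt \<epsilon> * (2 + \<epsilon> * grad_norm_sq u x) \<le> b * \<mu> * sqrt \<epsilon> * (2 + 2 * energy_density V \<epsilon> u x)"
          using en(3) ab \<mu> ud(2) by (intro mult_left_mono) auto
        show "0 \<le> 18 / (b\<^sup>2 - a\<^sup>2) * 1" using order_trans[OF b\<phi>(5) b\<phi>(6)] by simp
        show "0 \<le> b * \<mu> * sqrt \<epsilon> * (2 + \<epsilon> * grad_norm_sq u x)" using ab \<mu> ud(2) gn by simp
      qed
      finally show ?thesis by (simp add: B_def mult.assoc mult.left_commute)
    qed
    moreover have "\<epsilon> * (\<phi> x * \<zeta> x * (\<Sum>i\<in>Basis. ((u x - s) \<bullet> ?D i x)\<^sup>2)) \<le> A * (\<phi> x * (V (u x) / \<epsilon>))"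
    proof (cases "dist s (u x) \<le> \<mu> / 2 \<or> dist s (u x) \<ge> \<mu>")
      case True
      then show ?thesis using b\<tau>(6)[OF True] b\<phi>(1)[of x] admissible_potential_nonneg[OF V, of "u x"] ud(2) c(1) \<mu>2
        by (auto simp: A_def intro!: mult_nonneg_nonneg divide_nonneg_nonneg power_mono)
    next
      case False
      then have us: "norm (u x - s) \<le> \<mu>" and Vc: "V (u x) \<ge> c"
        using c(2)[OF x] by (auto simp: dist_norm norm_minus_commute)
      have "(\<Sum>i\<in>Basis. ((u x - s) \<bullet> ?D i x)\<^sup>2) \<le> (\<Sum>i\<in>(Basis :: (real^2) set). \<mu>\<^sup>2 * (norm (?D i x))\<^sup>2)"
      proof (intro sum_mono)
        fix i
        have "((u x - s) \<bullet> ?D i x)\<^sup>2 \<le> (norm (u x - s) * norm (?D i x))\<^sup>2"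
          using Cauchy_Schwarz_ineq2[of "u x - s" "?D i x"] by (metis abs_ge_zero power2_abs power_mono)
        also have "\<dots> \<le> (\<mu> * norm (?D i x))\<^sup>2" using us by (intro power_mono mult_right_mono) auto
        finally show "((u x - s) \<bullet> ?D i x)\<^sup>2 \<le> \<mu>\<^sup>2 * (norm (?D i x))\<^sup>2" by (simp add: power_mult_distrib)
      qed
      also have "\<dots> = \<mu>\<^sup>2 * grad_norm_sq u x" by (simp add: grad_norm_sq_def sum_distrib_left)
      also have "\<dots> \<le> \<mu>\<^sup>2 * (G / \<epsilon>)\<^sup>2" using G[OF x] by (intro mult_left_mono) auto
      also have "\<dots> \<le> \<mu>\<^sup>2 * (G / \<epsilon>)\<^sup>2 * (V (u x) / c)"
        using Vc c(1) mult_left_mono[of 1 "V (u x) / c" "\<mu>\<^sup>2 * (G / \<epsilon>)\<^sup>2"] by simp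
      finally have "\<phi> x * \<zeta> x * (\<Sum>i\<in>Basis. ((u x - s) \<bullet> ?D i x)\<^sup>2) \<le> \<phi> x * (18 / (\<mu>\<^sup>2 - (\<mu> / 2)\<^sup>2)) * (\<mu>\<^sup>2 * (G / \<epsilon>)\<^sup>2 * (V (u x) / c))"
        using b\<phi>(1) b\<tau>(4,5) by (intro mult_mono sum_nonneg mult_nonneg_nonneg order_trans[OF b\<tau>(4) b\<tau>(5)]) auto
      then have "\<epsilon> * (\<phi> x * \<zeta> x * (\<Sum>i\<in>Basis. ((u x - s) \<bullet> ?D i x)\<^sup>2)) \<le> \<epsilon> * (\<phi> x * (18 / (\<mu>\<^sup>2 - (\<mu> / 2)\<^sup>2)) * (\<mu>\<^sup>2 * (G / \<epsilon>)\<^sup>2 * (V (u x) / c)))"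
        using ud(2) by (intro mult_left_mono) auto
      also have "\<dots> = A * (\<phi> x * (V (u x) / \<epsilon>))"
        using ud(2) by (simp add: A_def power2_eq_square ac_simps)
      finally show ?thesis .
    qed
    moreover have "0 \<le> (1 / \<epsilon>) * (\<phi> x * \<tau> x * (grad V (u x) \<bullet> (u x - s)))"
    proof (cases "dist s (u x) < \<mu>")
      case True
      then show ?thesis using s(2) b\<phi>(1) b\<tau>(1) ud(2) by (intro mult_nonneg_nonneg) auto
    next
      case False
      then show ?thesis using b\<tau>(3) by simp
    qed
    ultimately show ?thesis by (simp add: R_def)
  qed
  have i1: "set_integrable lborel ?K (\<lambda>x. \<phi> x * (V (u x) / \<epsilon>))"
    unfolding \<phi>_def
    using ud(2) by (intro set_integrable_continuous_compact[OF _ compact_cball sub] continuous_on_mult continuous_on_cutoff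
        continuous_on_divide continuous_on_const continuous_on_potential_solution[OF V ud(3)]) auto
  have i2: "set_integrable lborel ?K (\<lambda>x. 2 + 2 * energy_density V \<epsilon> u x)"
    by (intro set_integrable_continuous_compact[OF _ compact_cball sub] continuous_on_mult continuous_on_add
        continuous_on_const continuous_on_energy_density[OF V ud(3)])
  have "set_lebesgue_integral lborel ?K R
      \<le> set_lebesgue_integral lborel ?K (\<lambda>x. A * (\<phi> x * (V (u x) / \<epsilon>)) + B * sqrt \<epsilon> * (2 + 2 * energy_density V \<epsilon> u x))"
  proof (rule set_integral_mono)
    show "set_integrable lborel ?K R" by (rule set_integrable_continuous_compact[OF cR compact_cball sub])
    show "set_integrable lborel ?K (\<lambda>x. A * (\<phi> x * (V (u x) / \<epsilon>)) + B * sqrt \<epsilon> * (2 + 2 * energy_density V \<epsilon> u x))"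
      by (rule set_integral_add(1)[OF set_integrable_mult_right[OF i1] set_integrable_mult_right[OF i2]])
  qed (rule pt)
  also have "\<dots> = A * set_lebesgue_integral lborel ?K (\<lambda>x. \<phi> x * (V (u x) / \<epsilon>))
      + B * sqrt \<epsilon> * set_lebesgue_integral lborel ?K (\<lambda>x. 2 + 2 * energy_density V \<epsilon> u x)"
    by (simp only: set_integral_add(2)[OF set_integrable_mult_right[OF i1] set_integrable_mult_right[OF i2]] set_integral_mult_right)
  finally show ?thesis unfolding IR[symmetric] by (simp only: A_def B_def \<phi>_def \<tau>_def)
qed

text \<open>The truncated bounds are summed over the wells, and the region away from all wells is
  added. \<open>A\<close> and \<open>B\<close> are chosen before \<open>\<Omega>\<close>,
  \<open>\<epsilon>\<close> and \<open>u\<close>, so that the inequality holds along the whole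
  sequence with the same constants.\<close>

lemma energy_le_potential:
  fixes V :: "'b::euclidean_space \<Rightarrow> real" and p :: "real^2"
  assumes V: "admissible_potential V" and M: "M \<ge> 0" and ab: "0 < a" "a < b"
  obtains A B where "A \<ge> 0" "B \<ge> 0"
    "\<And>\<Omega> \<epsilon> u. solves_AC V \<Omega> \<epsilon> u \<Longrightarrow> \<epsilon> \<le> 1 \<Longrightarrow> energy_le V \<Omega> \<epsilon> u M \<Longrightarrow> cball p b \<subseteq> \<Omega> \<Longrightarrow>
      (\<And>x. x \<in> cball p b \<Longrightarrow> norm (u x) \<le> L \<and> grad_norm_sq u x \<le> (G / \<epsilon>)\<^sup>2) \<Longrightarrow>
      set_lebesgue_integral lborel (cball p b) (\<lambda>x. cutoff a b p x * energy_density V \<epsilon> u x)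
        \<le> A * set_lebesgue_integral lborel (cball p b) (\<lambda>x. cutoff a b p x * (V (u x) / \<epsilon>)) + B * sqrt \<epsilon>"
proof -
  let ?K = "cball p b" and ?Z = "{s. V s = 0}"
  have fin: "finite ?Z" using V by (simp add: admissible_potential_def)
  obtain \<mu> where \<mu>: "\<mu> > 0"
    "\<And>s y. V s = 0 \<Longrightarrow> dist s y < \<mu> \<Longrightarrow> grad V y \<bullet> (y - s) \<ge> 0"
    "\<And>s s'. V s = 0 \<Longrightarrow> V s' = 0 \<Longrightarrow> s \<noteq> s' \<Longrightarrow> dist s s' \<ge> 2 * \<mu>"
    using admissible_potential_well_radius[OF V] by blast
  obtain c where c: "c > 0" "\<And>y. norm y \<le> L \<Longrightarrow> (\<And>s. V s = 0 \<Longrightarrow> dist s y \<ge> \<mu> / 2) \<Longrightarrow> V y \<ge> c"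
    using admissible_potential_bound_away_from_wells[OF V, of "\<mu> / 2"] \<mu>(1) by (metis half_gt_zero)
  define q where "q = real (card ?Z)"
  define A0 where "A0 = 18 / (\<mu>\<^sup>2 - (\<mu> / 2)\<^sup>2) * \<mu>\<^sup>2 * G\<^sup>2 / c"
  define B0 where "B0 = 18 / (b\<^sup>2 - a\<^sup>2) * b * \<mu>"
  define m where "m = 2 * measure lborel ?K + 2 * M"
  have A0: "A0 \<ge> 0" unfolding A0_def using c(1) \<mu>(1)
    by (intro mult_nonneg_nonneg divide_nonneg_nonneg) (auto simp: power_divide)
  have B0: "B0 \<ge> 0" unfolding B0_def using ab \<mu>(1)
    by (intro mult_nonneg_nonneg divide_nonneg_nonneg) (auto intro!: power_mono)
  have m: "m \<ge> 0" using M by (simp add: m_def)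
  have q: "q \<ge> 0" by (simp add: q_def)
  \<comment> \<open>\<open>1 / 2\<close> is the factor of the gradient term in the energy density
    and \<open>q\<close> counts the wells. \<open>1 + G\<^sup>2 / (2 * c)\<close> collects the
    potential itself and the gradient energy where \<open>u\<close> is away from all wells.\<close>
  define A where "A = 1 / 2 * q * A0 + (1 + G\<^sup>2 / (2 * c))"
  define B where "B = 1 / 2 * q * B0 * m"
  show thesis
  proof (rule that[of A B])
    show "A \<ge> 0" unfolding A_def using A0 q c(1) by (intro add_nonneg_nonneg mult_nonneg_nonneg) auto
    show "B \<ge> 0" unfolding B_def using B0 q m by (intro mult_nonneg_nonneg) auto
    fix \<Omega> \<epsilon> and u :: "real^2 \<Rightarrow> 'b"
    assume u: "solves_AC V \<Omega> \<epsilon> u" and e1: "\<epsilon> \<le> 1" and E: "energy_le V \<Omega> \<epsilon> u M" and sub: "?K \<subseteq> \<Omega>"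
      and est: "\<And>x. x \<in> ?K \<Longrightarrow> norm (u x) \<le> L \<and> grad_norm_sq u x \<le> (G / \<epsilon>)\<^sup>2"
    note ud = solves_ACD[OF u]
    define \<phi> where "\<phi> = cutoff a b p"
    note b\<phi> = cutoff_bounds[OF ab, of p, folded \<phi>_def]
    define \<tau> where "\<tau> s x = cutoff (\<mu> / 2) \<mu> s (u x)" for s x
    have \<mu>2: "0 < \<mu> / 2" "\<mu> / 2 < \<mu>" using \<mu>(1) by auto
    define P where "P = set_lebesgue_integral lborel ?K (\<lambda>x. \<phi> x * (V (u x) / \<epsilon>))"
    define T where "T s = set_lebesgue_integral lborel ?K (\<lambda>x. \<phi> x * (\<tau> s x * (\<epsilon> * grad_norm_sq u x)))" for s
    note inte = set_integral_energy_le[OF V u E M compact_cball sub]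
    have one: "set_integrable lborel ?K (\<lambda>x. 2 :: real)"
      by (rule set_integrable_continuous_compact[OF continuous_on_const[of UNIV] compact_cball]) auto
    have "set_lebesgue_integral lborel ?K (\<lambda>x. 2 + 2 * energy_density V \<epsilon> u x)
        = 2 * measure lborel ?K + 2 * set_lebesgue_integral lborel ?K (energy_density V \<epsilon> u)"
      unfolding set_integral_add(2)[OF one set_integrable_mult_right[OF inte(1)]] set_integral_mult_right
      by (simp add: set_lebesgue_integral_def)
    also have "\<dots> \<le> m" using inte(2) by (simp add: m_def)
    finally have mb: "set_lebesgue_integral lborel ?K (\<lambda>x. 2 + 2 * energy_density V \<epsilon> u x) \<le> m" .
    have T: "T s \<le> A0 * P + B0 * sqrt \<epsilon> * m" if s: "s \<in> ?Z" for s
    proof -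
      have "T s \<le> A0 * P + B0 * sqrt \<epsilon> * set_lebesgue_integral lborel ?K (\<lambda>x. 2 + 2 * energy_density V \<epsilon> u x)"
        unfolding T_def A0_def B0_def P_def \<phi>_def \<tau>_def
      proof (rule truncated_field_bound[OF V u e1 ab sub \<mu>(1) _ _ c(1)])
        show "V s = 0" using s by simp
        show "grad V y \<bullet> (y - s) \<ge> 0" if "dist s y < \<mu>" for y using \<mu>(2) s that by blast
        show "grad_norm_sq u x \<le> (G / \<epsilon>)\<^sup>2" if "x \<in> ?K" for x using est[OF that] by blast
        \<comment> \<open>The separation of the wells enters here: a value near \<open>s\<close>,
          but not within \<open>\<mu> / 2\<close> of it, is not that close to any other well
          either.\<close>
        show "V (u x) \<ge> c" if x: "x \<in> ?K" and d: "\<mu> / 2 \<le> dist s (u x)" "dist s (u x) \<le> \<mu>" for x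
        proof (rule c(2))
          show "norm (u x) \<le> L" using est[OF x] by blast
          fix s' assume "V s' = 0"
          show "\<mu> / 2 \<le> dist s' (u x)"
          proof (cases "s' = s")
            case False
            then have "2 * \<mu> \<le> dist s s'" using \<mu>(3) s \<open>V s' = 0\<close> by auto
            moreover have "dist s s' \<le> dist s (u x) + dist s' (u x)" by (rule dist_triangle2)
            ultimately show ?thesis using d \<mu>(1) by linarith
          qed (use d in simp)
        qed
      qed
      also have "\<dots> \<le> A0 * P + B0 * sqrt \<epsilon> * m"
        using mb B0 ud(2) by (intro add_left_mono mult_left_mono) auto
      finally show ?thesis .
    qed
    have c\<tau>: "continuous_on \<Omega> (\<tau> s)" for s unfolding \<tau>_def[abs_def]
      by (rule continuous_on_compose2[OF continuous_on_cutoff[of UNIV] smooth_on_continuous[OF ud(3)] subset_UNIV])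
    have iT: "set_integrable lborel ?K (\<lambda>x. \<phi> x * (\<tau> s x * (\<epsilon> * grad_norm_sq u x)))" for s
      unfolding grad_norm_sq_def \<phi>_def
      by (intro set_integrable_continuous_compact[OF _ compact_cball sub] continuous_on_mult continuous_on_sum
          continuous_on_power continuous_on_norm continuous_on_const continuous_on_cutoff c\<tau> smooth_on_continuous_derivative[OF ud(3)])
    have iP: "set_integrable lborel ?K (\<lambda>x. \<phi> x * (V (u x) / \<epsilon>))"
      unfolding \<phi>_def
      using ud(2) by (intro set_integrable_continuous_compact[OF _ compact_cball sub] continuous_on_mult continuous_on_cutoff
          continuous_on_divide continuous_on_const continuous_on_potential_solution[OF V ud(3)]) auto
    have iE: "set_integrable lborel ?K (\<lambda>x. \<phi> x * energy_density V \<epsilon> u x)"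
      unfolding \<phi>_def
      by (intro set_integrable_continuous_compact[OF _ compact_cball sub] continuous_on_mult continuous_on_cutoff
          continuous_on_energy_density[OF V ud(3)])
    have iS: "set_integrable lborel ?K (\<lambda>x. \<Sum>s\<in>?Z. \<phi> x * (\<tau> s x * (\<epsilon> * grad_norm_sq u x)))"
      using iT unfolding set_integrable_def scaleR_sum_right by (intro Bochner_Integration.integrable_sum)
    have ST: "set_lebesgue_integral lborel ?K (\<lambda>x. \<Sum>s\<in>?Z. \<phi> x * (\<tau> s x * (\<epsilon> * grad_norm_sq u x))) = (\<Sum>s\<in>?Z. T s)"
      using iT unfolding set_integrable_def set_lebesgue_integral_def scaleR_sum_right T_def
      by (intro Bochner_Integration.integral_sum)
    have pt: "\<phi> x * energy_density V \<epsilon> u x \<le> 1 / 2 * (\<Sum>s\<in>?Z. \<phi> x * (\<tau> s x * (\<epsilon> * grad_norm_sq u x)))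
        + (1 + G\<^sup>2 / (2 * c)) * (\<phi> x * (V (u x) / \<epsilon>))" if x: "x \<in> ?K" for x
    proof -
      define g where "g = \<epsilon> * grad_norm_sq u x"
      have g: "g \<ge> 0" using ud(2) by (simp add: g_def grad_norm_sq_def sum_nonneg)
      have V0: "V (u x) \<ge> 0" by (rule admissible_potential_nonneg[OF V])
      have nn: "\<phi> x * (\<tau> s x * g) \<ge> 0" for s
        unfolding \<tau>_def by (intro mult_nonneg_nonneg b\<phi>(1) cutoff_bounds(1)[OF \<mu>2] g)
      have "\<phi> x * g \<le> (\<Sum>s\<in>?Z. \<phi> x * (\<tau> s x * g)) + G\<^sup>2 / c * (\<phi> x * (V (u x) / \<epsilon>))"
      proof (cases "\<exists>s\<in>?Z. dist s (u x) \<le> \<mu> / 2")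
        case True
        then obtain s where s: "s \<in> ?Z" "dist s (u x) \<le> \<mu> / 2" by blast
        have "\<tau> s x = 1" unfolding \<tau>_def by (rule cutoff_bounds(3)[OF \<mu>2 s(2)])
        then have "\<phi> x * g = \<phi> x * (\<tau> s x * g)" by simp
        also have "\<dots> \<le> (\<Sum>s\<in>?Z. \<phi> x * (\<tau> s x * g))"
          by (rule member_le_sum[OF s(1)]) (use nn fin in auto)
        also have "\<dots> \<le> \<dots> + G\<^sup>2 / c * (\<phi> x * (V (u x) / \<epsilon>))"
          using b\<phi>(1) V0 ud(2) c(1) by simp
        finally show ?thesis .
      next
        case False
        have "V (u x) \<ge> c"
          by (rule c(2)) (use est[OF x] False in force)+
        have "g \<le> \<epsilon> * (G / \<epsilon>)\<^sup>2" unfolding g_def using est[OF x] ud(2) by (intro mult_left_mono) auto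
        also have "\<dots> = G\<^sup>2 / c * (c / \<epsilon>)" using ud(2) c(1) by (simp add: power2_eq_square)
        also have "\<dots> \<le> G\<^sup>2 / c * (V (u x) / \<epsilon>)"
          using \<open>V (u x) \<ge> c\<close> ud(2) c(1) by (intro mult_left_mono divide_right_mono) auto
        finally have "\<phi> x * g \<le> \<phi> x * (G\<^sup>2 / c * (V (u x) / \<epsilon>))" by (rule mult_left_mono[OF _ b\<phi>(1)])
        moreover have "0 \<le> (\<Sum>s\<in>?Z. \<phi> x * (\<tau> s x * g))" by (intro sum_nonneg nn)
        ultimately show ?thesis by (simp add: mult.left_commute)
      qed
      moreover have "\<phi> x * energy_density V \<epsilon> u x = 1 / 2 * (\<phi> x * g) + \<phi> x * (V (u x) / \<epsilon>)"
        by (simp add: energy_density_def g_def distrib_left)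
      moreover have "(1 + G\<^sup>2 / (2 * c)) * (\<phi> x * (V (u x) / \<epsilon>)) = \<phi> x * (V (u x) / \<epsilon>) + 1 / 2 * (G\<^sup>2 / c * (\<phi> x * (V (u x) / \<epsilon>)))"
        by (simp add: distrib_right add_divide_distrib)
      ultimately show ?thesis unfolding g_def by linarith
    qed
    have "set_lebesgue_integral lborel ?K (\<lambda>x. \<phi> x * energy_density V \<epsilon> u x)
        \<le> set_lebesgue_integral lborel ?K (\<lambda>x. 1 / 2 * (\<Sum>s\<in>?Z. \<phi> x * (\<tau> s x * (\<epsilon> * grad_norm_sq u x)))
          + (1 + G\<^sup>2 / (2 * c)) * (\<phi> x * (V (u x) / \<epsilon>)))"
      by (rule set_integral_mono[OF iE set_integral_add(1)[OF set_integrable_mult_right[OF iS] set_integrable_mult_right[OF iP]] pt])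
    also have "\<dots> = 1 / 2 * (\<Sum>s\<in>?Z. T s) + (1 + G\<^sup>2 / (2 * c)) * P"
      by (simp only: set_integral_add(2)[OF set_integrable_mult_right[OF iS] set_integrable_mult_right[OF iP]]
          set_integral_mult_right ST P_def)
    also have "(\<Sum>s\<in>?Z. T s) \<le> (\<Sum>s\<in>?Z. A0 * P + B0 * sqrt \<epsilon> * m)" by (intro sum_mono T)
    also have "\<dots> = q * (A0 * P + B0 * sqrt \<epsilon> * m)" by (simp add: q_def)
    finally have "set_lebesgue_integral lborel ?K (\<lambda>x. \<phi> x * energy_density V \<epsilon> u x)
        \<le> 1 / 2 * (q * (A0 * P + B0 * sqrt \<epsilon> * m)) + (1 + G\<^sup>2 / (2 * c)) * P" by simp
    also have "\<dots> = A * P + B * sqrt \<epsilon>" by (simp add: A_def B_def algebra_simps)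
    finally show "set_lebesgue_integral lborel ?K (\<lambda>x. cutoff a b p x * energy_density V \<epsilon> u x)
        \<le> A * set_lebesgue_integral lborel ?K (\<lambda>x. cutoff a b p x * (V (u x) / \<epsilon>)) + B * sqrt \<epsilon>"
      by (simp only: P_def \<phi>_def)
  qed
qed

section \<open>Passage to the limit measure\<close>

lemma radon_measure_onD:
  assumes "radon_measure_on \<Omega> \<nu>" "open \<Omega>"
  shows "space \<nu> = \<Omega>"
    and "A \<in> sets borel \<Longrightarrow> A \<subseteq> \<Omega> \<Longrightarrow> A \<in> sets \<nu>"
    and "f \<in> borel_measurable borel \<Longrightarrow> f \<in> borel_measurable \<nu>"
    and "compact K \<Longrightarrow> K \<subseteq> \<Omega> \<Longrightarrow> emeasure \<nu> K < \<infinity>"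
proof -
  have s: "sets \<nu> = sets (restrict_space borel \<Omega>)" using assms by (simp add: radon_measure_on_def)
  from sets_eq_imp_space_eq[OF this] show "space \<nu> = \<Omega>" by (simp add: space_restrict_space)
  show "A \<in> sets borel \<Longrightarrow> A \<subseteq> \<Omega> \<Longrightarrow> A \<in> sets \<nu>"
    unfolding s by (subst sets_restrict_space_iff) (use \<open>open \<Omega>\<close> in auto)
  show "f \<in> borel_measurable borel \<Longrightarrow> f \<in> borel_measurable \<nu>"
    using measurable_restrict_space1[of f borel borel \<Omega>] measurable_cong_sets[OF s refl] by blast
  show "compact K \<Longrightarrow> K \<subseteq> \<Omega> \<Longrightarrow> emeasure \<nu> K < \<infinity>" using assms by (simp add: radon_measure_on_def)
qed

text \<open>Both \<open>\<phi>\<close> and \<open>\<xi>\<close> are continuous with support in the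
  closed disc, so the convergence of densities applies to each. The slope \<open>\<xi>\<close>
  vanishes off the annulus and has \<open>\<nu>\<close>-integral zero; the estimates transfer this
  to \<open>\<phi>\<close>, which is 1 on the inner disc.\<close>

lemma null_disc_of_null_annulus:
  fixes V :: "'b::euclidean_space \<Rightarrow> real" and p :: "real^2"
  assumes V: "admissible_potential V" and L: "limit_setting V \<Omega> M\<^sub>0 \<epsilon> u \<nu>"
    and ab: "0 < a" "a < b" and sub: "cball p b \<subseteq> \<Omega>"
    and null: "emeasure \<nu> {x. a \<le> dist p x \<and> dist p x \<le> b} = 0"
  shows "emeasure \<nu> (cball p a) = 0"
proof -
  let ?K = "cball p b"
  define \<phi> where "\<phi> = cutoff a b p"
  define \<xi> where "\<xi> = cutoff_slope a b p"
  note b\<phi> = cutoff_bounds[OF ab, of p, folded \<phi>_def \<xi>_def]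
  have open\<Omega>: "open \<Omega>" and M: "M\<^sub>0 > 0" and \<epsilon>: "\<And>n. 0 < \<epsilon> n" "\<And>n. \<epsilon> n \<le> 1" "\<epsilon> \<longlonglongrightarrow> 0"
    and rad: "radon_measure_on \<Omega> \<nu>"
    and conv: "densities_converge_on \<Omega> (\<lambda>n. energy_density V (\<epsilon> n) (u n)) \<nu>"
    using L by (auto simp: limit_setting_def smooth_bounded_domain_def)
  note \<nu> = radon_measure_onD[OF rad open\<Omega>]
  have sol: "solves_AC V \<Omega> (\<epsilon> n) (u n)" for n
    using L open\<Omega> \<epsilon>(1) by (auto simp: limit_setting_def solves_AC_def)
  have en: "energy_le V \<Omega> (\<epsilon> n) (u n) M\<^sub>0" for n
    using L by (auto simp: limit_setting_def energy_le_def)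
  have c\<phi>: "continuous_on S \<phi>" "continuous_on S \<xi>" for S
    unfolding \<phi>_def \<xi>_def by (rule continuous_on_cutoff continuous_on_cutoff_slope)+
  have support: "closure {x. f x \<noteq> 0} \<subseteq> ?K" "compact (closure {x. f x \<noteq> 0})"
    if "\<And>x. dist p x \<ge> b \<Longrightarrow> f x = 0" for f :: "real^2 \<Rightarrow> real"
  proof -
    have "{x. f x \<noteq> 0} \<subseteq> ?K" using that by force
    then show "closure {x. f x \<noteq> 0} \<subseteq> ?K" by (rule closure_minimal) simp
    then show "compact (closure {x. f x \<noteq> 0})" by (meson compact_cball compact_closure bounded_cball bounded_subset closure_subset order_trans)
  qed
  have lim: "(\<lambda>n. set_lebesgue_integral lborel ?K (\<lambda>x. f x * energy_density V (\<epsilon> n) (u n) x)) \<longlonglongrightarrow> integral\<^sup>L \<nu> f"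
    if f: "continuous_on UNIV f" "\<And>x. dist p x \<ge> b \<Longrightarrow> f x = 0" for f :: "real^2 \<Rightarrow> real"
  proof -
    have "(\<lambda>n. set_lebesgue_integral lborel \<Omega> (\<lambda>x. f x * energy_density V (\<epsilon> n) (u n) x)) \<longlonglongrightarrow> integral\<^sup>L \<nu> f"
      using conv f(1) support[of f, OF f(2)] sub unfolding densities_converge_on_def by blast
    moreover have "set_lebesgue_integral lborel \<Omega> (\<lambda>x. f x * e x) = set_lebesgue_integral lborel ?K (\<lambda>x. f x * e x)" for e
    proof -
      have "indicator \<Omega> x *\<^sub>R (f x * e x) = indicator ?K x *\<^sub>R (f x * e x)" for x
        using f(2)[of x] sub by (auto simp: indicator_def subset_iff)
      then show ?thesis unfolding set_lebesgue_integral_def by presburger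
    qed
    ultimately show ?thesis by simp
  qed
  have K: "?K \<in> sets \<nu>" by (rule \<nu>(2)[OF _ sub]) simp
  have int\<phi>: "integrable \<nu> \<phi>"
  proof (rule integrableI_bounded_set[OF K _ \<nu>(4)[OF compact_cball sub], where B = 1])
    show "\<phi> \<in> borel_measurable \<nu>" by (intro \<nu>(3) borel_measurable_continuous_onI c\<phi>)
    show "AE x in \<nu>. x \<in> ?K \<longrightarrow> norm (\<phi> x) \<le> 1" using b\<phi>(1,2) by (auto simp: abs_le_iff intro: order_trans[of _ 0])
    show "AE x in \<nu>. x \<notin> ?K \<longrightarrow> \<phi> x = 0" using b\<phi>(4) by auto
  qed
  have "integral\<^sup>L \<nu> \<xi> = 0"
  proof -
    let ?A = "{x. a \<le> dist p x \<and> dist p x \<le> b}"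
    have "closed ?A" by (intro closed_Collect_conj closed_Collect_le continuous_intros)
    then have "?A \<in> sets \<nu>" using sub by (intro \<nu>(2)) auto
    then have "?A \<in> null_sets \<nu>" using null by blast
    from AE_not_in[OF this] have "AE x in \<nu>. \<xi> x = 0"
      by (rule AE_mp) (intro AE_I2 impI b\<phi>(7), auto)
    then have "integral\<^sup>L \<nu> \<xi> = integral\<^sup>L \<nu> (\<lambda>x. 0)"
      by (intro integral_cong_AE) (auto intro: \<nu>(3) borel_measurable_continuous_onI c\<phi>)
    then show ?thesis by simp
  qed
  then have lim\<xi>: "(\<lambda>n. set_lebesgue_integral lborel ?K (\<lambda>x. \<xi> x * energy_density V (\<epsilon> n) (u n) x)) \<longlonglongrightarrow> 0"
    using lim[of \<xi>] c\<phi>(2) b\<phi>(7) by auto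
  obtain \<rho>' where \<rho>': "\<rho>' > 0" "(\<Union>x\<in>?K. cball x \<rho>') \<subseteq> \<Omega>"
    using compact_subset_open_imp_cball_epsilon_subset[OF compact_cball open\<Omega> sub] by blast
  \<comment> \<open>One distance to the complement of \<open>\<Omega>\<close> serves the whole disc;
    the third of it matches the \<open>3 * \<rho>\<close> of the interior estimates.\<close>
  define \<rho> where "\<rho> = \<rho>' / 3"
  have \<rho>: "\<rho> > 0" "\<And>x. x \<in> ?K \<Longrightarrow> cball x (3 * \<rho>) \<subseteq> \<Omega>"
    using \<rho>' unfolding \<rho>_def UN_subset_iff by auto
  obtain N G e0 where est: "e0 > 0"
    "\<And>\<Omega> \<epsilon> u x. solves_AC V \<Omega> \<epsilon> u \<Longrightarrow> \<epsilon> < e0 \<Longrightarrow> energy_le V \<Omega> \<epsilon> u M\<^sub>0 \<Longrightarrow> cball x (3 * \<rho>) \<subseteq> \<Omega> \<Longrightarrow>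
       norm (u x) \<le> N \<and> grad_norm_sq u x \<le> (G / \<epsilon>)\<^sup>2"
    using interior_estimates[OF V _ \<rho>(1), of M\<^sub>0] M by (metis less_imp_le)
  obtain A B where A: "A \<ge> 0" and B: "B \<ge> 0" and AB:
    "\<And>\<Omega> \<epsilon> u. solves_AC V \<Omega> \<epsilon> u \<Longrightarrow> \<epsilon> \<le> 1 \<Longrightarrow> energy_le V \<Omega> \<epsilon> u M\<^sub>0 \<Longrightarrow> cball p b \<subseteq> \<Omega> \<Longrightarrow>
      (\<And>x. x \<in> cball p b \<Longrightarrow> norm (u x) \<le> N \<and> grad_norm_sq u x \<le> (G / \<epsilon>)\<^sup>2) \<Longrightarrow>
      set_lebesgue_integral lborel (cball p b) (\<lambda>x. cutoff a b p x * energy_density V \<epsilon> u x)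
        \<le> A * set_lebesgue_integral lborel (cball p b) (\<lambda>x. cutoff a b p x * (V (u x) / \<epsilon>)) + B * sqrt \<epsilon>"
    using energy_le_potential[OF V less_imp_le[OF M] ab, where p = p and L = N and G = G] by blast
  have "eventually (\<lambda>n. \<epsilon> n < e0) sequentially" using order_tendstoD(2)[OF \<epsilon>(3) est(1)] .
  then have bound: "eventually (\<lambda>n. set_lebesgue_integral lborel ?K (\<lambda>x. \<phi> x * energy_density V (\<epsilon> n) (u n) x)
      \<le> A * (b\<^sup>2 / 2 * set_lebesgue_integral lborel ?K (\<lambda>x. \<xi> x * energy_density V (\<epsilon> n) (u n) x)) + B * sqrt (\<epsilon> n)) sequentially"
  proof eventually_elim
    case (elim n)
    have "set_lebesgue_integral lborel ?K (\<lambda>x. \<phi> x * energy_density V (\<epsilon> n) (u n) x)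
      \<le> A * set_lebesgue_integral lborel ?K (\<lambda>x. \<phi> x * (V (u n x) / \<epsilon> n)) + B * sqrt (\<epsilon> n)"
      unfolding \<phi>_def by (rule AB[OF sol \<epsilon>(2) en sub est(2)[OF sol elim en \<rho>(2)]])
    moreover have "set_lebesgue_integral lborel ?K (\<lambda>x. \<phi> x * (V (u n x) / \<epsilon> n))
      \<le> b\<^sup>2 / 2 * set_lebesgue_integral lborel ?K (\<lambda>x. \<xi> x * energy_density V (\<epsilon> n) (u n) x)"
      using pohozaev_inequality[OF V sol ab sub, of n] unfolding \<phi>_def \<xi>_def by linarith
    then have "A * set_lebesgue_integral lborel ?K (\<lambda>x. \<phi> x * (V (u n x) / \<epsilon> n))
      \<le> A * (b\<^sup>2 / 2 * set_lebesgue_integral lborel ?K (\<lambda>x. \<xi> x * energy_density V (\<epsilon> n) (u n) x))"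
      by (rule mult_left_mono[OF _ A])
    ultimately show ?case by linarith
  qed
  have "(\<lambda>n. A * (b\<^sup>2 / 2 * set_lebesgue_integral lborel ?K (\<lambda>x. \<xi> x * energy_density V (\<epsilon> n) (u n) x)) + B * sqrt (\<epsilon> n))
      \<longlonglongrightarrow> A * (b\<^sup>2 / 2 * 0) + B * sqrt 0"
    by (intro tendsto_intros lim\<xi> \<epsilon>(3))
  from tendsto_le[OF _ this lim[OF c\<phi>(1) b\<phi>(4)] bound] have "integral\<^sup>L \<nu> \<phi> \<le> 0" by simp
  moreover have "integral\<^sup>L \<nu> \<phi> \<ge> 0" using b\<phi>(1) by simp
  ultimately have "AE x in \<nu>. \<phi> x = 0"
    using integral_nonneg_eq_0_iff_AE[OF int\<phi>] b\<phi>(1) by simp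
  then have "AE x in \<nu>. x \<notin> cball p a"
    by (rule AE_mp) (use b\<phi>(3) in auto)
  moreover have "cball p a \<in> sets \<nu>" using sub ab by (intro \<nu>(2)) (auto simp: subset_iff)
  ultimately have "cball p a \<in> null_sets \<nu>"
    using AE_iff_null_sets[of "cball p a" \<nu>] by simp
  then show ?thesis by (rule null_setsD1)
qed

section \<open>The concentration set\<close>

text \<open>If every circle with radius between \<open>\<alpha>\<close> and \<open>\<beta>\<close>
  met \<open>T\<close>, the distances to \<open>p\<close> would fill that interval. Each set of a
  cover of \<open>T\<close> has distances in an interval no longer than its diameter, so the
  diameters would add up to at least \<open>\<beta> - \<alpha>\<close>.\<close>

lemma sphere_missing_set:
  fixes T :: "'a::metric_space set"
  assumes H: "hausdorff1 T < ennreal (\<beta> - \<alpha>)" and "\<alpha> < \<beta>"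
  obtains s where "\<alpha> < s" "s < \<beta>" "sphere p s \<inter> T = {}"
proof -
  have "\<exists>s. \<alpha> < s \<and> s < \<beta> \<and> sphere p s \<inter> T = {}"
  proof (rule ccontr)
    assume none: "\<not> ?thesis"
    have hit: "\<exists>y\<in>T. dist p y = s" if "\<alpha> < s" "s < \<beta>" for s
      using none that by (auto simp: sphere_def disjoint_iff)
    \<comment> \<open>Any scale would do: what counts is the sum of the diameters, not their
      smallness.\<close>
    have "hausdorff1_pre 1 T \<le> hausdorff1 T" unfolding hausdorff1_def by (rule SUP_upper) simp
    then have "hausdorff1_pre 1 T < ennreal (\<beta> - \<alpha>)" using H by (rule le_less_trans)
    then obtain C where C: "T \<subseteq> (\<Union>i. C i)" "\<And>i. bounded (C i)" "(\<Sum>i. ennreal (diameter (C i))) < ennreal (\<beta> - \<alpha>)"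
      unfolding hausdorff1_pre_def INF_less_iff by auto
    \<comment> \<open>The empty set is treated apart because \<open>Inf\<close> and
      \<open>Sup\<close> of an empty set of reals carry no information.\<close>
    define J where "J i = (if C i = {} then {} else {Inf (dist p ` C i) .. Sup (dist p ` C i)})" for i :: nat
    have bd: "bounded (dist p ` C i)" for i
    proof -
      obtain B where "\<forall>y\<in>C i. dist p y \<le> B" using C(2)[of i] bounded_any_center by blast
      then show ?thesis by (auto simp: bounded_iff)
    qed
    have sub: "{\<alpha><..<\<beta>} \<subseteq> (\<Union>i. J i)"
    proof
      fix s assume "s \<in> {\<alpha><..<\<beta>}"
      then obtain y where "y \<in> T" "dist p y = s" using hit by auto
      then obtain i where "y \<in> C i" using C(1) by blast
      then have "s \<in> J i"
        using \<open>dist p y = s\<close> bd[of i] bounded_imp_bdd_below bounded_imp_bdd_above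
        by (auto simp: J_def intro!: cInf_lower cSup_upper)
      then show "s \<in> (\<Union>i. J i)" by blast
    qed
    have J: "emeasure lborel (J i) \<le> ennreal (diameter (C i))" for i
    proof (cases "C i = {}")
      case False
      have "Sup (dist p ` C i) \<le> Inf (dist p ` C i) + diameter (C i)"
      proof (rule cSup_least)
        fix s assume "s \<in> dist p ` C i"
        then obtain y where y: "y \<in> C i" "s = dist p y" by blast
        have "s - diameter (C i) \<le> Inf (dist p ` C i)"
        proof (rule cInf_greatest)
          fix t assume "t \<in> dist p ` C i"
          then obtain z where z: "z \<in> C i" "t = dist p z" by blast
          show "s - diameter (C i) \<le> t"
            using diameter_bounded_bound[OF C(2) y(1) z(1)] dist_triangle[of p y z] y z by (simp add: dist_commute)
        qed (use False in simp)
        then show "s \<le> Inf (dist p ` C i) + diameter (C i)" by simp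
      qed (use False in simp)
      moreover have "Inf (dist p ` C i) \<le> Sup (dist p ` C i)"
        using False bd[of i] by (intro cInf_le_cSup) (auto intro: bounded_imp_bdd_above bounded_imp_bdd_below)
      ultimately show ?thesis using False by (simp add: J_def ennreal_leI)
    qed (simp add: J_def)
    have "ennreal (\<beta> - \<alpha>) = emeasure lborel {\<alpha><..<\<beta>}" using \<open>\<alpha> < \<beta>\<close> by simp
    also have "\<dots> \<le> emeasure lborel (\<Union>i. J i)" by (rule emeasure_mono[OF sub]) (simp add: J_def)
    also have "\<dots> \<le> (\<Sum>i. emeasure lborel (J i))" by (rule emeasure_subadditive_countably) (auto simp: J_def)
    also have "\<dots> \<le> (\<Sum>i. ennreal (diameter (C i)))" by (intro suminf_le J) auto
    also have "\<dots> < ennreal (\<beta> - \<alpha>)" by (rule C)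
    finally show False by simp
  qed
  then show thesis using that by blast
qed

section \<open>Clearing-out and the structure of the concentration set\<close>

lemma less_ennreal_mult_of_divide:
  assumes "m / ennreal r < ennreal k" "r > 0" "k \<ge> 0"
  shows "m < ennreal (k * r)"
proof (rule ccontr)
  assume "\<not> m < ennreal (k * r)"
  then have "ennreal (k * r) / ennreal r \<le> m / ennreal r" by (intro divide_right_mono_ennreal) simp
  moreover have "ennreal (k * r) / ennreal r = ennreal k" using assms by (simp add: divide_ennreal)
  ultimately show False using assms(1) by simp
qed

text \<open>A lower density below \<open>\<eta>\<^sub>0\<close> provides arbitrarily small radii at
  which the hypothesis of clearing-out holds, in particular one whose disc lies in
  \<open>\<Omega>\<close>.\<close>

lemma null_neighbourhood_off_concentration_set:
  assumes L: "limit_setting V \<Omega> M\<^sub>0 \<epsilon> u \<nu>" and \<eta>: "clearing_out_constant V \<eta>\<^sub>0"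
    and x: "x \<in> \<Omega>" "x \<notin> concentration_set \<Omega> \<nu> \<eta>\<^sub>0"
  obtains r where "r > 0" "cball x r \<subseteq> \<Omega>" "emeasure \<nu> (cball x r) = 0"
proof -
  have "open \<Omega>" using L by (auto simp: limit_setting_def smooth_bounded_domain_def)
  then obtain d where d: "d > 0" "ball x d \<subseteq> \<Omega>" using x(1) open_contains_ball by blast
  have \<eta>0: "\<eta>\<^sub>0 > 0" using \<eta> by (simp add: clearing_out_constant_def)
  let ?f = "\<lambda>r. emeasure \<nu> (cball x r \<inter> \<Omega>) / ennreal r"
  have "\<exists>r. 0 < r \<and> r < d \<and> ?f r < ennreal \<eta>\<^sub>0"
  proof (rule ccontr)
    assume none: "\<not> ?thesis"
    have "eventually (\<lambda>r. ennreal \<eta>\<^sub>0 \<le> ?f r) (at_right 0)"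
    proof (rule eventually_at_rightI[OF _ d(1)])
      fix r assume "r \<in> {0<..<d}"
      then show "ennreal \<eta>\<^sub>0 \<le> ?f r" using none not_less by auto
    qed
    from Liminf_bounded[OF this] show False
      using x by (simp add: concentration_set_def lower_density_def)
  qed
  then obtain r where r: "0 < r" "r < d" "?f r < ennreal \<eta>\<^sub>0" by blast
  have "emeasure \<nu> (cball x r \<inter> \<Omega>) < ennreal (\<eta>\<^sub>0 * r)"
    by (rule less_ennreal_mult_of_divide[OF r(3,1)]) (use \<eta>0 in simp)
  moreover have "ball x r \<subseteq> \<Omega>" using r d by (auto simp: subset_iff)
  ultimately have "emeasure \<nu> (cball x (r / 2) \<inter> \<Omega>) = 0"
    using \<eta> L r(1) unfolding clearing_out_constant_def by blast
  moreover have "cball x (r / 2) \<subseteq> \<Omega>" using r d(2) by (auto simp: subset_iff)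
  moreover from this have "cball x (r / 2) \<inter> \<Omega> = cball x (r / 2)" by blast
  ultimately show thesis using that[of "r / 2"] r(1) by simp
qed

text \<open>Small discs about \<open>y\<close> lie in the null disc, so the lower density at
  \<open>y\<close> is zero. Together with the preceding lemma this makes the concentration set
  relatively closed in \<open>\<Omega>\<close>.\<close>

lemma not_in_concentration_set_if_null_ball:
  assumes L: "limit_setting V \<Omega> M\<^sub>0 \<epsilon> u \<nu>" and "\<eta>\<^sub>0 > 0"
    and "r > 0" "cball x r \<subseteq> \<Omega>" "emeasure \<nu> (cball x r) = 0" and y: "dist x y < r"
  shows "y \<notin> concentration_set \<Omega> \<nu> \<eta>\<^sub>0"
proof -
  have op: "open \<Omega>" and rad: "radon_measure_on \<Omega> \<nu>"
    using L by (auto simp: limit_setting_def smooth_bounded_domain_def)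
  let ?f = "\<lambda>s. emeasure \<nu> (cball y s \<inter> \<Omega>) / ennreal s"
  have "cball x r \<in> sets \<nu>" using assms by (intro radon_measure_onD(2)[OF rad op]) auto
  have "?f s = 0" if "s < r - dist x y" for s
  proof -
    have "cball y s \<subseteq> cball x r"
    proof
      fix z assume "z \<in> cball y s"
      then show "z \<in> cball x r" using that dist_triangle[of x z y] by simp
    qed
    then have "emeasure \<nu> (cball y s \<inter> \<Omega>) \<le> emeasure \<nu> (cball x r)"
      using \<open>cball x r \<in> sets \<nu>\<close> by (intro emeasure_mono) auto
    then show ?thesis using assms by simp
  qed
  then have "eventually (\<lambda>s. ?f s = 0) (at_right 0)"
    using y by (auto simp: eventually_at_right[of 0 1] intro!: exI[of _ "r - dist x y"])
  then have "Liminf (at_right 0) ?f = Liminf (at_right (0::real)) (\<lambda>s. 0 :: ennreal)"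
    by (rule Liminf_eq)
  also have "\<dots> = 0" by (rule Liminf_const) simp
  finally show ?thesis using \<open>\<eta>\<^sub>0 > 0\<close> by (simp add: concentration_set_def lower_density_def)
qed

text \<open>Compactness turns the pointwise null neighbourhoods into a finite cover.\<close>

lemma null_compact_off_concentration_set:
  assumes L: "limit_setting V \<Omega> M\<^sub>0 \<epsilon> u \<nu>" and \<eta>: "clearing_out_constant V \<eta>\<^sub>0"
    and K: "compact K" "K \<subseteq> \<Omega>" "K \<inter> concentration_set \<Omega> \<nu> \<eta>\<^sub>0 = {}"
  shows "emeasure \<nu> K = 0"
proof -
  have op: "open \<Omega>" and rad: "radon_measure_on \<Omega> \<nu>"
    using L by (auto simp: limit_setting_def smooth_bounded_domain_def)
  have "\<forall>x\<in>K. \<exists>r. r > 0 \<and> cball x r \<subseteq> \<Omega> \<and> emeasure \<nu> (cball x r) = 0"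
    using null_neighbourhood_off_concentration_set[OF L \<eta>] K by (metis disjoint_iff subsetD)
  from bchoice[OF this] obtain r where r: "\<And>x. x \<in> K \<Longrightarrow> r x > 0" "\<And>x. x \<in> K \<Longrightarrow> cball x (r x) \<subseteq> \<Omega>"
    "\<And>x. x \<in> K \<Longrightarrow> emeasure \<nu> (cball x (r x)) = 0" by blast
  obtain F where F: "F \<subseteq> K" "finite F" "K \<subseteq> (\<Union>x\<in>F. ball x (r x))"
  proof (rule compactE_image[OF K(1), of K "\<lambda>x. ball x (r x)"])
    show "K \<subseteq> (\<Union>x\<in>K. ball x (r x))" using r(1) by force
  qed auto
  have sets: "cball x (r x) \<in> sets \<nu>" if "x \<in> F" for x
    using that F(1) r(2) by (intro radon_measure_onD(2)[OF rad op]) auto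
  have "(\<Union>x\<in>F. cball x (r x)) \<in> null_sets \<nu>"
    using F(1,2) r(3) sets by (intro null_sets_UN') (auto simp: countable_finite null_sets_def)
  moreover have "K \<subseteq> (\<Union>x\<in>F. cball x (r x))" using F(3) ball_subset_cball by blast
  moreover have "K \<in> sets \<nu>"
    using K by (intro radon_measure_onD(2)[OF rad op]) (auto intro: borel_compact)
  ultimately show ?thesis by (meson null_sets_subset null_setsD1)
qed

section \<open>Plane geometry of the cone\<close>

lemma norm_sq_perp:
  assumes "norm e = 1"
  shows "(e \<bullet> x)\<^sup>2 + (perp e \<bullet> x)\<^sup>2 = (norm x)\<^sup>2"
proof -
  have e: "(e$1)\<^sup>2 + (e$2)\<^sup>2 = 1"
    using assms by (simp add: norm_vec_def L2_set_def sum_2)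
  have "(e \<bullet> x)\<^sup>2 + (perp e \<bullet> x)\<^sup>2 = ((e$1)\<^sup>2 + (e$2)\<^sup>2) * ((x$1)\<^sup>2 + (x$2)\<^sup>2)"
    by (simp add: inner_vec_def sum_2 perp_def power2_eq_square algebra_simps)
  also have "\<dots> = (norm x)\<^sup>2" unfolding e by (simp add: norm_vec_def L2_set_def sum_2)
  finally show ?thesis .
qed

lemma norm_le_inner_perp:
  assumes "norm e = 1"
  shows "norm x \<le> \<bar>e \<bullet> x\<bar> + \<bar>perp e \<bullet> x\<bar>"
proof (rule power2_le_imp_le)
  show "(norm x)\<^sup>2 \<le> (\<bar>e \<bullet> x\<bar> + \<bar>perp e \<bullet> x\<bar>)\<^sup>2"
    unfolding norm_sq_perp[OF assms, symmetric] by (simp add: power2_sum)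
qed simp

lemma inner_perp_le_norm:
  assumes "norm e = 1"
  shows "\<bar>e \<bullet> x\<bar> \<le> norm x" "\<bar>perp e \<bullet> x\<bar> \<le> norm x"
proof -
  have "(e \<bullet> x)\<^sup>2 \<le> (norm x)\<^sup>2" "(perp e \<bullet> x)\<^sup>2 \<le> (norm x)\<^sup>2"
    unfolding norm_sq_perp[OF assms, symmetric] by simp_all
  then show "\<bar>e \<bullet> x\<bar> \<le> norm x" "\<bar>perp e \<bullet> x\<bar> \<le> norm x"
    by (simp_all add: abs_le_square_iff[of _ "norm x", simplified])
qed

text \<open>The origin of the constant: outside the cone the normal part \<open>P\<close> of
  \<open>x - x\<^sub>0\<close> exceeds \<open>\<theta> * \<rho> / (1 + \<theta>)\<close>, while a
  point of the half cone at distance \<open>d\<close> from \<open>x\<close> would force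
  \<open>P < (2 + \<theta>) * d\<close>.\<close>

lemma disc_outside_half_cone:
  assumes e: "norm e = 1" and "\<theta> > 0" and x: "x \<notin> cone_one x\<^sub>0 e \<theta>"
    and y: "dist x y < \<theta> / ((1 + \<theta>) * (2 + \<theta>)) * dist x\<^sub>0 x"
  shows "y \<notin> cone_one x\<^sub>0 e (\<theta> / 2)"
proof
  define \<rho> where "\<rho> = dist x\<^sub>0 x"
  define d where "d = dist x y"
  define P where "P = \<bar>perp e \<bullet> (x - x\<^sub>0)\<bar>"
  define E where "E = \<bar>e \<bullet> (x - x\<^sub>0)\<bar>"
  assume "y \<in> cone_one x\<^sub>0 e (\<theta> / 2)"
  then have yc: "\<bar>perp e \<bullet> (y - x\<^sub>0)\<bar> \<le> \<theta> / 2 * \<bar>e \<bullet> (y - x\<^sub>0)\<bar>" by (simp add: cone_one_def)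
  have xc: "\<theta> * E < P" using x by (simp add: cone_one_def P_def E_def)
  have yx: "y - x\<^sub>0 = (x - x\<^sub>0) + (y - x)" by simp
  have n: "norm (y - x) = d" by (simp add: d_def dist_norm norm_minus_commute)
  have "P - d \<le> \<bar>perp e \<bullet> (y - x\<^sub>0)\<bar>"
    using inner_perp_le_norm(2)[OF e, of "y - x"] unfolding yx inner_add_right n P_def by linarith
  moreover have "\<bar>e \<bullet> (y - x\<^sub>0)\<bar> \<le> E + d"
    using inner_perp_le_norm(1)[OF e, of "y - x"] unfolding yx inner_add_right n E_def by linarith
  then have "\<theta> / 2 * \<bar>e \<bullet> (y - x\<^sub>0)\<bar> \<le> \<theta> / 2 * (E + d)" using \<open>\<theta> > 0\<close> by (intro mult_left_mono) auto
  ultimately have "P - d \<le> \<theta> / 2 * (E + d)" using yc by linarith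
  then have "2 * P - 2 * d \<le> \<theta> * E + \<theta> * d" by (simp add: field_simps)
  then have 1: "P < (2 + \<theta>) * d" using xc by (simp add: algebra_simps)
  have "\<rho> \<le> E + P"
    using norm_le_inner_perp[OF e, of "x - x\<^sub>0"] by (simp add: \<rho>_def E_def P_def dist_norm norm_minus_commute)
  then have "\<theta> * \<rho> \<le> \<theta> * E + \<theta> * P" using \<open>\<theta> > 0\<close> by (simp add: distrib_left[symmetric])
  then have 2: "\<theta> * \<rho> < (1 + \<theta>) * P" using xc by (simp add: algebra_simps)
  have k: "(1 + \<theta>) * (2 + \<theta>) > 0" using \<open>\<theta> > 0\<close> by simp
  have "d < \<theta> * \<rho> / ((1 + \<theta>) * (2 + \<theta>))" using y by (simp add: d_def \<rho>_def)
  then have "(1 + \<theta>) * (2 + \<theta>) * d < \<theta> * \<rho>"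
    unfolding pos_less_divide_eq[OF k] by (simp only: mult.commute)
  also have "\<dots> < (1 + \<theta>) * P" by (rule 2)
  also have "\<dots> < (1 + \<theta>) * ((2 + \<theta>) * d)" using 1 \<open>\<theta> > 0\<close> by simp
  finally show False by (simp add: mult.assoc)
qed

text \<open>If the circle missed the concentration set, then so would a closed annulus just outside
  it, by compactness and relative closedness. That annulus is null, hence so is the disc about
  \<open>x\<close>, and \<open>x\<close> would have lower density zero.\<close>

lemma concentration_point_sphere_meets:
  fixes V :: "'b::euclidean_space \<Rightarrow> real"
  assumes V: "admissible_potential V" and L: "limit_setting V \<Omega> M\<^sub>0 \<epsilon> u \<nu>"
    and \<eta>: "clearing_out_constant V \<eta>\<^sub>0"
    and x: "x \<in> concentration_set \<Omega> \<nu> \<eta>\<^sub>0" and s: "0 < s" "s < t" and sub: "ball x t \<subseteq> \<Omega>"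
  shows "sphere x s \<inter> concentration_set \<Omega> \<nu> \<eta>\<^sub>0 \<noteq> {}"
proof
  let ?S = "concentration_set \<Omega> \<nu> \<eta>\<^sub>0"
  assume disj: "sphere x s \<inter> ?S = {}"
  have \<eta>0: "\<eta>\<^sub>0 > 0" using \<eta> by (simp add: clearing_out_constant_def)
  have op: "open \<Omega>" using L by (auto simp: limit_setting_def smooth_bounded_domain_def)
  have "open (\<Omega> - ?S)"
    unfolding open_contains_ball
  proof
    fix z assume "z \<in> \<Omega> - ?S"
    then obtain r where r: "r > 0" "cball z r \<subseteq> \<Omega>" "emeasure \<nu> (cball z r) = 0"
      using null_neighbourhood_off_concentration_set[OF L \<eta>, of z] by blast
    then have "ball z r \<subseteq> \<Omega> - ?S"
      using not_in_concentration_set_if_null_ball[OF L \<eta>0 r] by (auto simp: subset_iff)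
    then show "\<exists>r>0. ball z r \<subseteq> \<Omega> - ?S" using r(1) by blast
  qed
  moreover have "sphere x s \<subseteq> \<Omega> - ?S" using disj sub s by (auto simp: subset_iff disjoint_iff)
  ultimately obtain h where h: "h > 0" "(\<Union>y\<in>sphere x s. cball y h) \<subseteq> \<Omega> - ?S"
    using compact_subset_open_imp_cball_epsilon_subset[OF compact_sphere] by blast
  \<comment> \<open>\<open>s + h\<close> keeps the annulus within distance \<open>h\<close> of the
    circle, and the midpoint of \<open>s\<close> and \<open>t\<close> keeps the closed disc inside
    \<open>ball x t\<close>.\<close>
  define b where "b = min (s + h) ((s + t) / 2)"
  have b: "s < b" "b \<le> s + h" "b < t" using s h(1) by (auto simp: b_def min_less_iff_disj)
  have subb: "cball x b \<subseteq> \<Omega>" using sub b by (auto simp: subset_iff)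
  let ?A = "{z. s \<le> dist x z \<and> dist x z \<le> b}"
  have A: "?A \<subseteq> \<Omega> - ?S"
  proof
    fix z assume z: "z \<in> ?A"
    \<comment> \<open>The radial projection of \<open>z\<close> to the circle; its distance to
      \<open>z\<close> is \<open>dist x z - s\<close>.\<close>
    define y where "y = x + (s / dist x z) *\<^sub>R (z - x)"
    have pos: "dist x z > 0" using z s(1) by auto
    have "dist x y = s" using pos s(1) by (simp add: y_def dist_norm norm_minus_commute)
    moreover have "dist y z \<le> h"
    proof -
      have "z - y = (1 - s / dist x z) *\<^sub>R (z - x)" by (simp add: y_def algebra_simps)
      then have "dist y z = \<bar>1 - s / dist x z\<bar> * dist x z"
        by (metis dist_commute dist_norm norm_scaleR)
      moreover have "0 \<le> 1 - s / dist x z" using z pos by simp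
      ultimately have "dist y z = (1 - s / dist x z) * dist x z" by simp
      also have "\<dots> = dist x z - s" using pos by (simp add: left_diff_distrib)
      finally show ?thesis using z b by simp
    qed
    ultimately have "z \<in> (\<Union>y\<in>sphere x s. cball y h)" by auto
    then show "z \<in> \<Omega> - ?S" using h(2) by blast
  qed
  have "closed ?A" by (intro closed_Collect_conj closed_Collect_le continuous_intros)
  moreover have "bounded ?A" by (rule bounded_subset[OF bounded_cball[of x b]]) auto
  ultimately have "compact ?A" by (simp add: compact_eq_bounded_closed)
  then have "emeasure \<nu> ?A = 0"
    using A by (intro null_compact_off_concentration_set[OF L \<eta>]) auto
  then have "emeasure \<nu> (cball x s) = 0"
    by (rule null_disc_of_null_annulus[OF V L s(1) b(1) subb])
  then have "x \<notin> ?S"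
    using not_in_concentration_set_if_null_ball[OF L \<eta>0 s(1), of x x] subb b s by (auto simp: subset_iff)
  then show False using x by simp
qed

theorem proposition1:
  fixes V :: "real^'k \<Rightarrow> real"
    and \<Omega> :: "(real^2) set"
    and M\<^sub>0 \<eta>\<^sub>0 :: real
    and \<epsilon> :: "nat \<Rightarrow> real"
    and u :: "nat \<Rightarrow> real^2 \<Rightarrow> real^'k"
    and \<nu> :: "(real^2) measure"
    and x\<^sub>0 e :: "real^2"
    and \<theta> :: real
  assumes "admissible_potential V"
    and "limit_setting V \<Omega> M\<^sub>0 \<epsilon> u \<nu>"
    and "clearing_out_constant V \<eta>\<^sub>0"
    and "regular_point_with (concentration_set \<Omega> \<nu> \<eta>\<^sub>0) x\<^sub>0 e"
    and "\<theta> > 0"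
  shows "\<exists>R>0. \<forall>r. 0 < r \<and> r \<le> R \<longrightarrow>
           concentration_set \<Omega> \<nu> \<eta>\<^sub>0 \<inter> ball x\<^sub>0 r \<subseteq> cone_one x\<^sub>0 e \<theta>"
proof -
  let ?S = "concentration_set \<Omega> \<nu> \<eta>\<^sub>0"
  have e: "norm e = 1" and x0: "x\<^sub>0 \<in> ?S"
    and lim: "((\<lambda>r. hausdorff1 (?S \<inter> (ball x\<^sub>0 r - cone_one x\<^sub>0 e (\<theta> / 2))) / ennreal r) \<longlongrightarrow> 0) (at_right 0)"
    using assms(4,5) unfolding regular_point_with_def by auto
  have op: "open \<Omega>" using assms(2) by (auto simp: limit_setting_def smooth_bounded_domain_def)
  have "x\<^sub>0 \<in> \<Omega>" using x0 by (simp add: concentration_set_def)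
  then obtain D where D: "D > 0" "ball x\<^sub>0 D \<subseteq> \<Omega>" using op open_contains_ball by blast
  \<comment> \<open>With this \<open>c\<close> the disc of radius \<open>c * \<rho>\<close> about a
    point off the cone avoids the cone of half the slope; \<open>c < 1\<close> keeps it inside
    \<open>ball x\<^sub>0 (2 * \<rho>)\<close>.\<close>
  define c where "c = \<theta> / ((1 + \<theta>) * (2 + \<theta>))"
  have k: "(1 + \<theta>) * (2 + \<theta>) > 0" using \<open>\<theta> > 0\<close> by simp
  have "\<theta> < (1 + \<theta>) * (2 + \<theta>)" using \<open>\<theta> > 0\<close> by (simp add: algebra_simps add_pos_pos)
  then have c: "0 < c" "c < 1"
    using \<open>\<theta> > 0\<close> k unfolding c_def by (simp_all only: divide_pos_pos pos_divide_less_eq mult_1)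
  \<comment> \<open>The bound is used at radius \<open>2 * \<rho>\<close>, so the threshold
    \<open>c / 2\<close> gives measure below \<open>c * \<rho>\<close>, the length of the interval
    of available circle radii.\<close>
  have "eventually (\<lambda>r. hausdorff1 (?S \<inter> (ball x\<^sub>0 r - cone_one x\<^sub>0 e (\<theta> / 2))) / ennreal r < ennreal (c / 2)) (at_right 0)"
    by (rule order_tendstoD(2)[OF lim]) (use c in simp)
  then obtain R\<^sub>0 where R0: "R\<^sub>0 > 0" "\<And>r. 0 < r \<Longrightarrow> r < R\<^sub>0 \<Longrightarrow>
      hausdorff1 (?S \<inter> (ball x\<^sub>0 r - cone_one x\<^sub>0 e (\<theta> / 2))) / ennreal r < ennreal (c / 2)"
    by (auto simp: eventually_at_right[of 0 1])
  \<comment> \<open>The halving makes the radius \<open>2 * \<rho>\<close> admissible for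
    \<open>R\<^sub>0\<close> and keeps the disc of that radius inside
    \<open>\<Omega>\<close>.\<close>
  define R where "R = min R\<^sub>0 D / 2"
  have R: "R > 0" "2 * R \<le> R\<^sub>0" "2 * R \<le> D" using R0(1) D(1) by (auto simp: R_def)
  have "x \<in> cone_one x\<^sub>0 e \<theta>" if x: "x \<in> ?S" "x \<in> ball x\<^sub>0 R" for x
  proof (rule ccontr)
    assume out: "x \<notin> cone_one x\<^sub>0 e \<theta>"
    define \<rho> where "\<rho> = dist x\<^sub>0 x"
    have "x \<noteq> x\<^sub>0" using out by (auto simp: cone_one_def)
    then have \<rho>: "\<rho> > 0" "\<rho> < R" using x(2) by (auto simp: \<rho>_def)
    let ?T = "?S \<inter> (ball x\<^sub>0 (2 * \<rho>) - cone_one x\<^sub>0 e (\<theta> / 2))"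
    have disc: "y \<in> ball x\<^sub>0 (2 * \<rho>) - cone_one x\<^sub>0 e (\<theta> / 2)" if "dist x y < c * \<rho>" for y
    proof -
      have "c * \<rho> < 1 * \<rho>" using c \<rho> by (intro mult_strict_right_mono) auto
      then have "dist x\<^sub>0 y < 2 * \<rho>" using that dist_triangle[of x\<^sub>0 y x] by (simp add: \<rho>_def)
      moreover have "y \<notin> cone_one x\<^sub>0 e (\<theta> / 2)"
        by (rule disc_outside_half_cone[OF e \<open>\<theta> > 0\<close> out]) (use that in \<open>simp add: c_def \<rho>_def\<close>)
      ultimately show ?thesis by simp
    qed
    have "hausdorff1 ?T / ennreal (2 * \<rho>) < ennreal (c / 2)"
      using \<rho> R by (intro R0(2)) auto
    then have "hausdorff1 ?T < ennreal (c / 2 * (2 * \<rho>))"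
      by (rule less_ennreal_mult_of_divide) (use \<rho> c in auto)
    then have "hausdorff1 ?T < ennreal (c * \<rho> - 0)" by simp
    then obtain s where s: "0 < s" "s < c * \<rho>" "sphere x s \<inter> ?T = {}"
      by (rule sphere_missing_set[where p = x]) (use c \<rho> in auto)
    have "sphere x s \<inter> ?S = {}" using s disc by (auto simp: disjoint_iff)
    moreover have "ball x (c * \<rho>) \<subseteq> \<Omega>"
    proof
      fix y assume "y \<in> ball x (c * \<rho>)"
      then have "dist x\<^sub>0 y < 2 * \<rho>" using disc[of y] by simp
      then show "y \<in> \<Omega>" using \<rho> R(3) D(2) by auto
    qed
    ultimately show False
      using concentration_point_sphere_meets[OF assms(1-3) x(1) s(1,2)] by blast
  qed
  then show ?thesis using R(1) by (intro exI[of _ R]) (auto simp: subset_iff)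
qed

end
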